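(* Let $Q=Q(a,b,c,d)$ be a non-degenerate quadrilateral linkage with planar moduli space $M(Q)$, and regard its cross-ratio map as a smooth map $Cr:M(Q)\to C$, where $C=\{z\in\mathbb{C}:|z-1|=\frac{ac}{bd}\}$. Then: (5) if $M(Q)$ consists of one component, then $Cr$ is a stable mapping with exactly two fold points, and its image is an arc of the circle $C$; (6) if $M(Q)$ consists of two components, then $Cr$ is a stable mapping, has no singularities (no critical points), and maps each of the two component circles of $M(Q)$ bijectively onto the circle $C$.
   Context: A quadrilateral linkage $Q=Q(a,b,c,d)$ is given by positive reals $a,b,c,d$ such that the largest does not exceed the sum of the other three. A planar configuration of $Q$ is a quadruple $V=(v_1,v_2,v_3,v_4)\in\mathbb{C}^4$ with $|v_2-v_1|=a$, $|v_3-v_2|=b$, $|v_4-v_3|=c$, $|v_1-v_4|=d$. The planar moduli space $M(Q)$ is the set of configurations modulo orientation-preserving isometries of $\mathbb{C}=\mathbb{R}^2$. $Q$ is non-degenerate if $a\pm b\pm c\pm d\neq 0$ for all choices of signs; then $M(Q)$ is a smooth compact 1-manifold, diffeomorphic to a circle or a disjoint union of two circles. The cross-ratio map is $$Cr(V)=\frac{v_3-v_1}{v_3-v_2}:\frac{v_4-v_1}{v_4-v_2}=\frac{(v_3-v_1)(v_4-v_2)}{(v_3-v_2)(v_4-v_1)}.$$ It satisfies $Cr=1-R$ with $R(V)=\frac{(v_2-v_1)(v_4-v_3)}{(v_2-v_3)(v_4-v_1)}$, and $|R(V)|=\frac{ac}{bd}$, so $Cr$ takes values in $C$. A smooth map between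 compact 1-manifolds is stable if every sufficiently $C^\infty$-close smooth map is equivalent to it under diffeomorphisms of source and target; a fold point is a critical point at which, in local coordinates, the second derivative is non-zero (local normal form $x\mapsto x^2$). *)

theory Defs
  imports "HOL-Analysis.Analysis"
begin

section \<open>Smooth functions\<close>

primrec Ck_on :: "nat \<Rightarrow> 'a::real_normed_vector set \<Rightarrow> ('a \<Rightarrow> 'b::real_normed_vector) \<Rightarrow> bool" where
  "Ck_on 0 S f \<longleftrightarrow> continuous_on S f"
| "Ck_on (Suc k) S f \<longleftrightarrow>
     (\<forall>x\<in>S. f differentiable at x) \<and> (\<forall>v. Ck_on k S (\<lambda>x. frechet_derivative f (at x) v))"

definition smooth_on :: "'a::real_normed_vector set \<Rightarrow> ('a \<Rightarrow> 'b::real_normed_vector) \<Rightarrow> bool" where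
  "smooth_on S f \<longleftrightarrow> open S \<and> (\<forall>k. Ck_on k S f)"

text \<open>Smoothness on an arbitrary subset: local extendability to a smooth function of the ambient
  space.\<close>

definition smooth_on_subset :: "'a::real_normed_vector set \<Rightarrow> ('a \<Rightarrow> 'b::real_normed_vector) \<Rightarrow> bool" where
  "smooth_on_subset S f \<longleftrightarrow> (\<forall>x\<in>S. \<exists>U g. x \<in> U \<and> smooth_on U g \<and> (\<forall>y\<in>S \<inter> U. g y = f y))"


section \<open>Smooth 1-manifolds\<close>

text \<open>A smooth 1-manifold is given by the set of all its charts. A chart is a pair of its domain
  and a coordinate function, whose values off the domain are irrelevant.\<close>

type_synonym 'a atlas = "('a set \<times> ('a \<Rightarrow> real)) set"

definition carrier :: "'a atlas \<Rightarrow> 'a set" where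
  "carrier A = (\<Union>(U, \<phi>)\<in>A. U)"

text \<open>The quotient smooth structure on \<open>\<pi> ` S\<close> for a submanifold \<open>S\<close> of a normed space and a
  map \<open>\<pi>\<close> that is meant to become a submersion: a coordinate is smooth if its pullback to \<open>S\<close> is, and
  its inverse is smooth if it lifts locally to smooth curves in \<open>S\<close>. With \<open>\<pi>\<close> the identity this
  is the usual structure of the submanifold \<open>S\<close> itself.\<close>

definition quotient_atlas :: "'e::real_normed_vector set \<Rightarrow> ('e \<Rightarrow> 'a) \<Rightarrow> 'a atlas" where
  "quotient_atlas S \<pi> = {(U, \<phi>).
     U \<subseteq> \<pi> ` S \<and> openin (top_of_set S) {x \<in> S. \<pi> x \<in> U} \<and>
     inj_on \<phi> U \<and> open (\<phi> ` U) \<and>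
     smooth_on_subset {x \<in> S. \<pi> x \<in> U} (\<phi> \<circ> \<pi>) \<and>
     (\<forall>p\<in>U. \<exists>J \<gamma>. \<phi> p \<in> J \<and> smooth_on J \<gamma> \<and>
        (\<forall>t\<in>J. \<gamma> t \<in> S \<and> \<pi> (\<gamma> t) \<in> U \<and> \<phi> (\<pi> (\<gamma> t)) = t))}"

definition submanifold_atlas :: "'e::real_normed_vector set \<Rightarrow> 'e atlas" where
  "submanifold_atlas S = quotient_atlas S (\<lambda>x. x)"

definition quotient_topology :: "'e topology \<Rightarrow> ('e \<Rightarrow> 'a) \<Rightarrow> 'a topology" where
  "quotient_topology X \<pi> =
     topology (\<lambda>U. U \<subseteq> \<pi> ` topspace X \<and> openin X {x \<in> topspace X. \<pi> x \<in> U})"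

lemma openin_quotient_topology:
  "openin (quotient_topology X \<pi>) U \<longleftrightarrow>
     U \<subseteq> \<pi> ` topspace X \<and> openin X {x \<in> topspace X. \<pi> x \<in> U}"
proof -
  have "istopology (\<lambda>U. U \<subseteq> \<pi> ` topspace X \<and> openin X {x \<in> topspace X. \<pi> x \<in> U})"
    unfolding istopology_def
  proof (intro conjI allI impI)
    fix S T
    assume *: "S \<subseteq> \<pi> ` topspace X \<and> openin X {x \<in> topspace X. \<pi> x \<in> S}"
      "T \<subseteq> \<pi> ` topspace X \<and> openin X {x \<in> topspace X. \<pi> x \<in> T}"
    have "{x \<in> topspace X. \<pi> x \<in> S \<inter> T} =
        {x \<in> topspace X. \<pi> x \<in> S} \<inter> {x \<in> topspace X. \<pi> x \<in> T}" by auto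
    with * show "openin X {x \<in> topspace X. \<pi> x \<in> S \<inter> T}" by (simp only: openin_Int)
    from * show "S \<inter> T \<subseteq> \<pi> ` topspace X" by blast
  next
    fix \<K>
    assume *: "\<forall>K\<in>\<K>. K \<subseteq> \<pi> ` topspace X \<and> openin X {x \<in> topspace X. \<pi> x \<in> K}"
    have "{x \<in> topspace X. \<pi> x \<in> \<Union>\<K>} = (\<Union>K\<in>\<K>. {x \<in> topspace X. \<pi> x \<in> K})" by auto
    moreover have "openin X (\<Union>K\<in>\<K>. {x \<in> topspace X. \<pi> x \<in> K})"
      by (rule openin_Union) (use * in blast)
    ultimately show "openin X {x \<in> topspace X. \<pi> x \<in> \<Union>\<K>}" by (simp only:)
    from * show "\<Union>\<K> \<subseteq> \<pi> ` topspace X" by blast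
  qed
  then show ?thesis
    unfolding quotient_topology_def by (simp only: topology_inverse')
qed

lemma topspace_quotient_topology: "topspace (quotient_topology X \<pi>) = \<pi> ` topspace X"
proof
  show "topspace (quotient_topology X \<pi>) \<subseteq> \<pi> ` topspace X"
    using openin_topspace[of "quotient_topology X \<pi>"]
    unfolding openin_quotient_topology by (rule conjunct1)
  have "openin (quotient_topology X \<pi>) (\<pi> ` topspace X)"
  proof -
    have "{x \<in> topspace X. \<pi> x \<in> \<pi> ` topspace X} = topspace X" by blast
    then show ?thesis by (simp only: openin_quotient_topology openin_topspace subset_refl)
  qed
  then show "\<pi> ` topspace X \<subseteq> topspace (quotient_topology X \<pi>)"
    by (rule openin_subset)
qed

lemma quotient_map_quotient_topology: "quotient_map X (quotient_topology X \<pi>) \<pi>"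
  unfolding quotient_map_def topspace_quotient_topology openin_quotient_topology by blast


section \<open>Smooth maps between 1-manifolds and their singularities\<close>

definition local_rep :: "'a set \<Rightarrow> ('a \<Rightarrow> real) \<Rightarrow> ('b \<Rightarrow> real) \<Rightarrow> ('a \<Rightarrow> 'b) \<Rightarrow> real \<Rightarrow> real" where
  "local_rep U \<phi> \<psi> f = \<psi> \<circ> f \<circ> inv_into U \<phi>"

definition smooth_map :: "'a atlas \<Rightarrow> 'b atlas \<Rightarrow> ('a \<Rightarrow> 'b) \<Rightarrow> bool" where
  "smooth_map A B f \<longleftrightarrow> (\<forall>p\<in>carrier A. \<exists>(U, \<phi>)\<in>A. \<exists>(V, \<psi>)\<in>B.
     p \<in> U \<and> f ` U \<subseteq> V \<and> smooth_on (\<phi> ` U) (local_rep U \<phi> \<psi> f))"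

definition diffeomorphism :: "'a atlas \<Rightarrow> 'b atlas \<Rightarrow> ('a \<Rightarrow> 'b) \<Rightarrow> bool" where
  "diffeomorphism A B h \<longleftrightarrow> bij_betw h (carrier A) (carrier B) \<and>
     smooth_map A B h \<and> smooth_map B A (inv_into (carrier A) h)"

definition critical_point :: "'a atlas \<Rightarrow> 'b atlas \<Rightarrow> ('a \<Rightarrow> 'b) \<Rightarrow> 'a \<Rightarrow> bool" where
  "critical_point A B f p \<longleftrightarrow> (\<exists>(U, \<phi>)\<in>A. \<exists>(V, \<psi>)\<in>B. p \<in> U \<and> f ` U \<subseteq> V \<and>
     (local_rep U \<phi> \<psi> f has_real_derivative 0) (at (\<phi> p)))"

definition fold_point :: "'a atlas \<Rightarrow> 'b atlas \<Rightarrow> ('a \<Rightarrow> 'b) \<Rightarrow> 'a \<Rightarrow> bool" where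
  "fold_point A B f p \<longleftrightarrow> (\<exists>(U, \<phi>)\<in>A. \<exists>(V, \<psi>)\<in>B. p \<in> U \<and> f ` U \<subseteq> V \<and>
     (local_rep U \<phi> \<psi> f has_real_derivative 0) (at (\<phi> p)) \<and>
     (deriv ^^ 2) (local_rep U \<phi> \<psi> f) (\<phi> p) \<noteq> 0)"

definition equivalent_maps :: "'a atlas \<Rightarrow> 'b atlas \<Rightarrow> ('a \<Rightarrow> 'b) \<Rightarrow> ('a \<Rightarrow> 'b) \<Rightarrow> bool" where
  "equivalent_maps A B f g \<longleftrightarrow> (\<exists>h k. diffeomorphism A A h \<and> diffeomorphism B B k \<and>
     (\<forall>p\<in>carrier A. g (h p) = k (f p)))"

text \<open>Uniform closeness of all derivatives up to order \<open>r\<close>, read in a pair of charts over a compact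
  set \<open>K\<close>. These sets form the usual subbasis of the \<open>C\<^sup>\<infinity>\<close> topology (weak and strong
  topologies agree for a compact source). Functions are not restricted off the carrier, so maps that
  agree on the carrier are topologically indistinguishable.\<close>

definition Cinf_subbasic ::
  "'a atlas \<Rightarrow> 'b atlas \<Rightarrow> ('a \<Rightarrow> 'b) \<Rightarrow> nat \<Rightarrow> 'a set \<Rightarrow> ('a \<Rightarrow> real) \<Rightarrow> 'b set \<Rightarrow> ('b \<Rightarrow> real)
     \<Rightarrow> 'a set \<Rightarrow> real \<Rightarrow> ('a \<Rightarrow> 'b) set" where
  "Cinf_subbasic A B f r U \<phi> V \<psi> K \<epsilon> = {g. smooth_map A B g \<and> g ` K \<subseteq> V \<and>
     (\<forall>i\<le>r. \<forall>x\<in>\<phi> ` K.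
        \<bar>(deriv ^^ i) (local_rep U \<phi> \<psi> g) x - (deriv ^^ i) (local_rep U \<phi> \<psi> f) x\<bar> < \<epsilon>)}"

definition Cinf_topology :: "'a atlas \<Rightarrow> 'b atlas \<Rightarrow> ('a \<Rightarrow> 'b) topology" where
  "Cinf_topology A B = topology_generated_by
     {Cinf_subbasic A B f r U \<phi> V \<psi> K \<epsilon> | f r U \<phi> V \<psi> K \<epsilon>.
        smooth_map A B f \<and> (U, \<phi>) \<in> A \<and> (V, \<psi>) \<in> B \<and>
        K \<subseteq> U \<and> compact (\<phi> ` K) \<and> f ` K \<subseteq> V \<and> \<epsilon> > 0}"

definition stable_map :: "'a atlas \<Rightarrow> 'b atlas \<Rightarrow> ('a \<Rightarrow> 'b) \<Rightarrow> bool" where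
  "stable_map A B f \<longleftrightarrow> smooth_map A B f \<and>
     (\<exists>W. openin (Cinf_topology A B) W \<and> f \<in> W \<and> (\<forall>g\<in>W. equivalent_maps A B f g))"


section \<open>Quadrilateral linkages\<close>

definition quadrilateral_linkage :: "real \<Rightarrow> real \<Rightarrow> real \<Rightarrow> real \<Rightarrow> bool" where
  "quadrilateral_linkage a b c d \<longleftrightarrow> a > 0 \<and> b > 0 \<and> c > 0 \<and> d > 0 \<and>
     a \<le> b + c + d \<and> b \<le> a + c + d \<and> c \<le> a + b + d \<and> d \<le> a + b + c"

definition nondegenerate :: "real \<Rightarrow> real \<Rightarrow> real \<Rightarrow> real \<Rightarrow> bool" where
  "nondegenerate a b c d \<longleftrightarrow>
     (\<forall>s\<in>{1, -1}. \<forall>t\<in>{1, -1}. \<forall>u\<in>{1, -1}. a + s * b + t * c + u * d \<noteq> 0)"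

type_synonym quadruple = "complex \<times> complex \<times> complex \<times> complex"

definition configurations :: "real \<Rightarrow> real \<Rightarrow> real \<Rightarrow> real \<Rightarrow> quadruple set" where
  "configurations a b c d = {(v1, v2, v3, v4).
     cmod (v2 - v1) = a \<and> cmod (v3 - v2) = b \<and> cmod (v4 - v3) = c \<and> cmod (v1 - v4) = d}"

definition direct_isometries :: "(complex \<Rightarrow> complex) set" where
  "direct_isometries = {\<lambda>z. u * z + w | u w. cmod u = 1}"

definition congruence :: "real \<Rightarrow> real \<Rightarrow> real \<Rightarrow> real \<Rightarrow> (quadruple \<times> quadruple) set" where
  "congruence a b c d = {((v1, v2, v3, v4), (w1, w2, w3, w4)).
     (v1, v2, v3, v4) \<in> configurations a b c d \<and> (w1, w2, w3, w4) \<in> configurations a b c d \<and>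
     (\<exists>g\<in>direct_isometries. w1 = g v1 \<and> w2 = g v2 \<and> w3 = g v3 \<and> w4 = g v4)}"

definition moduli_space :: "real \<Rightarrow> real \<Rightarrow> real \<Rightarrow> real \<Rightarrow> quadruple set set" where
  "moduli_space a b c d = configurations a b c d // congruence a b c d"

definition moduli_proj :: "real \<Rightarrow> real \<Rightarrow> real \<Rightarrow> real \<Rightarrow> quadruple \<Rightarrow> quadruple set" where
  "moduli_proj a b c d V = congruence a b c d `` {V}"

definition moduli_topology :: "real \<Rightarrow> real \<Rightarrow> real \<Rightarrow> real \<Rightarrow> quadruple set topology" where
  "moduli_topology a b c d =
     quotient_topology (top_of_set (configurations a b c d)) (moduli_proj a b c d)"

definition moduli_atlas :: "real \<Rightarrow> real \<Rightarrow> real \<Rightarrow> real \<Rightarrow> quadruple set atlas" where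
  "moduli_atlas a b c d = quotient_atlas (configurations a b c d) (moduli_proj a b c d)"

fun cross_ratio :: "quadruple \<Rightarrow> complex" where
  "cross_ratio (v1, v2, v3, v4) = ((v3 - v1) * (v4 - v2)) / ((v3 - v2) * (v4 - v1))"

definition Cr :: "quadruple set \<Rightarrow> complex" where
  "Cr X = the_elem (cross_ratio ` X)"

definition target_circle :: "real \<Rightarrow> real \<Rightarrow> real \<Rightarrow> real \<Rightarrow> complex set" where
  "target_circle a b c d = {z. cmod (z - 1) = (a * c) / (b * d)}"

text \<open>A closed arc, neither a point nor the whole circle.\<close>

definition circle_arc :: "complex \<Rightarrow> real \<Rightarrow> complex set \<Rightarrow> bool" where
  "circle_arc z r I \<longleftrightarrow>
     (\<exists>s t. s < t \<and> t < s + 2 * pi \<and> I = (\<lambda>x. z + of_real r * cis x) ` {s..t})"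

lemma topspace_moduli_topology: "topspace (moduli_topology a b c d) = moduli_space a b c d"
  unfolding moduli_topology_def topspace_quotient_topology moduli_space_def quotient_def
    moduli_proj_def topspace_euclidean_subtopology by blast

lemma equiv_congruence: "equiv (configurations a b c d) (congruence a b c d)"
proof (rule equivI)
  show "congruence a b c d \<subseteq> configurations a b c d \<times> configurations a b c d"
    by (auto simp: congruence_def)
  have id: "(\<lambda>z. z) \<in> direct_isometries"
    unfolding direct_isometries_def by (rule CollectI, rule exI[of _ 1], rule exI[of _ 0]) auto
  show "refl_on (configurations a b c d) (congruence a b c d)"
    unfolding refl_on_def by (auto simp: congruence_def intro!: bexI[OF _ id])
  show "sym (congruence a b c d)"
  proof (rule symI)
    fix V W assume "(V, W) \<in> congruence a b c d"
    then obtain v1 v2 v3 v4 u w where *: "V = (v1, v2, v3, v4)"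
      "W = (u * v1 + w, u * v2 + w, u * v3 + w, u * v4 + w)" "cmod u = 1"
      "V \<in> configurations a b c d" "W \<in> configurations a b c d"
      by (auto simp: congruence_def direct_isometries_def)
    then have "u \<noteq> 0" by auto
    have g: "(\<lambda>z. inverse u * z + - (inverse u * w)) \<in> direct_isometries"
      unfolding direct_isometries_def
      by (rule CollectI, rule exI[of _ "inverse u"], rule exI[of _ "- (inverse u * w)"])
        (simp add: norm_inverse *(3))
    have inv: "x = inverse u * (u * x + w) + - (inverse u * w)" for x
      using \<open>u \<noteq> 0\<close> by (simp add: field_simps)
    show "(W, V) \<in> congruence a b c d"
      unfolding congruence_def mem_Collect_eq *(1,2) prod.case
      using *(4,5) inv unfolding *(1,2) by (intro conjI bexI[OF _ g]) simp_all
  qed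
  show "trans (congruence a b c d)"
  proof (rule transI)
    fix V W X assume "(V, W) \<in> congruence a b c d" "(W, X) \<in> congruence a b c d"
    then obtain v1 v2 v3 v4 u w u' w' where *: "V = (v1, v2, v3, v4)"
      "X = (u' * (u * v1 + w) + w', u' * (u * v2 + w) + w',
            u' * (u * v3 + w) + w', u' * (u * v4 + w) + w')"
      "cmod u = 1" "cmod u' = 1" "V \<in> configurations a b c d" "X \<in> configurations a b c d"
      by (auto simp: congruence_def direct_isometries_def)
    have g: "(\<lambda>z. (u' * u) * z + (u' * w + w')) \<in> direct_isometries"
      unfolding direct_isometries_def
      by (rule CollectI, rule exI[of _ "u' * u"], rule exI[of _ "u' * w + w'"])
        (simp add: norm_mult *(3,4))
    have comp: "u' * (u * x + w) + w' = (u' * u) * x + (u' * w + w')" for x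
      by (simp add: algebra_simps)
    show "(V, X) \<in> congruence a b c d"
      unfolding congruence_def mem_Collect_eq *(1,2) prod.case
      using *(5,6) unfolding *(1,2) by (intro conjI bexI[OF _ g]) (simp_all only: comp)
  qed
qed

lemma cross_ratio_congruence:
  assumes "(V, W) \<in> congruence a b c d"
  shows "cross_ratio W = cross_ratio V"
proof -
  from assms obtain v1 v2 v3 v4 u w where *: "V = (v1, v2, v3, v4)"
    "W = (u * v1 + w, u * v2 + w, u * v3 + w, u * v4 + w)" "cmod u = 1"
    by (auto simp: congruence_def direct_isometries_def)
  have d: "(u * x + w) - (u * y + w) = u * (x - y)" for x y by (simp add: algebra_simps)
  have "u \<noteq> 0" using *(3) by auto
  have "(u * x) * (u * y) / ((u * x') * (u * y')) = x * y / (x' * y')" for x y x' y'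
  proof -
    have "(u * x) * (u * y) / ((u * x') * (u * y')) = (u * u) * (x * y) / ((u * u) * (x' * y'))"
      by (simp only: mult_ac)
    then show ?thesis using \<open>u \<noteq> 0\<close> by simp
  qed
  then show ?thesis unfolding *(1,2) cross_ratio.simps d .
qed

lemma Cr_moduli_proj:
  assumes "V \<in> configurations a b c d"
  shows "Cr (moduli_proj a b c d V) = cross_ratio V"
proof -
  have "V \<in> moduli_proj a b c d V"
    using equiv_class_self[OF equiv_congruence assms] by (simp add: moduli_proj_def)
  then have "cross_ratio ` moduli_proj a b c d V = {cross_ratio V}"
    by (auto simp: moduli_proj_def dest: cross_ratio_congruence)
  then show ?thesis by (simp add: Cr_def)
qed

end

theory Submission
  imports Defs
begin

text \<open>Up to congruence a quadrilateral is determined by its angles at the second and the fourth vertex,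
that is, by two unit complex numbers \<open>P\<close> and \<open>Q\<close>, and the only condition on them is that both pairs
of sides span the same diagonal. With \<open>W = P Q\<close> and twice the signed area \<open>y\<close> this condition becomes
\<open>y\<^sup>2 = m - n Re W\<close> with constants \<open>m\<close> and \<open>n > 0\<close> (Bretschneider's formula), and \<open>(W, y)\<close> are global
coordinates: the moduli space is a curve in the cylinder over the unit circle, and \<open>Cr = 1 - r W\<close>
is, up to an affine map, its projection to that circle. Non-degeneracy gives \<open>m > - n\<close> and \<open>m \<noteq> n\<close>.

If \<open>m > n\<close>, the right-hand side is positive, so the curve consists of two graphs over the whole
circle and the projection is a diffeomorphism on each of them. If \<open>m < n\<close>, the curve is an oval over
the arc \<open>Re W \<le> m/n\<close>: in terms of the sine \<open>s\<close> of half the angle of \<open>W\<close>, measured from \<open>-1\<close>, it is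
the ellipse \<open>y\<^sup>2 + 2 n s\<^sup>2 = m + n\<close>. Parametrised by the angle of the ellipse, \<open>Cr\<close> becomes the
function \<open>fold_angle \<kappa>\<close>, whose two critical points are non-degenerate. As one case has one component
and the other has two, the number of components decides which case is present (\<open>connected_case\<close>,
\<open>disconnected_case\<close>).

Stability is a statement about functions on the real line, once maps are read along
parametrisations of the circles. A map near \<open>Cr\<close> in the smooth topology has a lift that is close to
that of \<open>Cr\<close> together with its first two derivatives (\<open>smooth_neighbourhood_of_lift\<close>). In the case
of two components the derivative of the lift remains positive, and the inverses of the lifts form
the required diffeomorphism of the source (\<open>stable_coverings\<close>). In the case of one component the
lift remains a Morse function with one maximum and one minimum. A diffeomorphism of the target
matches the two critical values (\<open>fold_angle_perturbation\<close>), and two such functions with the same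
critical values differ by a diffeomorphism of the source, since both can be brought into the form \<open>M
+ R sin \<eta>\<close> (\<open>simple_Morse_normal_form\<close>). The delicate point there is smoothness of \<open>\<eta>\<close> at the
critical points, which rests on Hadamard's lemma (\<open>smooth_signed_sqrt\<close>).\<close>

section \<open>Calculus of smooth functions\<close>

lemma Ck_on_cong:
  assumes "open S" "\<And>x. x \<in> S \<Longrightarrow> f x = g x" "Ck_on k S f"
  shows "Ck_on k S g"
  using assms(2,3)
proof (induction k arbitrary: f g)
  case 0
  then show ?case by (simp cong: continuous_on_cong)
next
  case (Suc k)
  have d: "(g has_derivative frechet_derivative f (at x)) (at x)" if "x \<in> S" for x
  proof (rule has_derivative_transform_within_open[OF _ assms(1) that])
    show "(f has_derivative frechet_derivative f (at x)) (at x)"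
      using Suc.prems(2) that frechet_derivative_works by auto
  qed (rule Suc.prems(1))
  have "Ck_on k S (\<lambda>x. frechet_derivative g (at x) v)" for v
  proof (rule Suc.IH)
    show "Ck_on k S (\<lambda>x. frechet_derivative f (at x) v)" using Suc.prems(2) by simp
    show "frechet_derivative f (at x) v = frechet_derivative g (at x) v" if "x \<in> S" for x
      using frechet_derivative_at[OF d[OF that]] by (rule fun_cong)
  qed
  moreover have "g differentiable (at x)" if "x \<in> S" for x
    using d[OF that] by (rule differentiableI)
  ultimately show ?case by simp
qed

lemma Ck_on_SucI:
  assumes "open S" "\<And>x. x \<in> S \<Longrightarrow> (f has_derivative f' x) (at x)"
    and "\<And>v. Ck_on k S (\<lambda>x. f' x v)"
  shows "Ck_on (Suc k) S f"
proof -
  have "Ck_on k S (\<lambda>x. frechet_derivative f (at x) v)" for v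
  proof (rule Ck_on_cong[OF assms(1) _ assms(3)])
    show "f' x v = frechet_derivative f (at x) v" if "x \<in> S" for x
      using frechet_derivative_at[OF assms(2)[OF that]] by (rule fun_cong)
  qed
  moreover have "f differentiable (at x)" if "x \<in> S" for x
    using assms(2)[OF that] by (rule differentiableI)
  ultimately show ?thesis by simp
qed

lemma Ck_on_SucD: "Ck_on (Suc k) S f \<Longrightarrow> Ck_on k S f"
proof (induction k arbitrary: f)
  case 0
  then show ?case
    by (auto intro!: continuous_at_imp_continuous_on differentiable_imp_continuous_within)
next
  case (Suc k)
  then show ?case by (metis Ck_on.simps(2))
qed

lemma Ck_on_subset: "T \<subseteq> S \<Longrightarrow> Ck_on k S f \<Longrightarrow> Ck_on k T f"
  by (induction k arbitrary: f) (auto intro: continuous_on_subset)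

lemma Ck_on_Suc_has_derivative:
  "Ck_on (Suc k) S f \<Longrightarrow> x \<in> S \<Longrightarrow> (f has_derivative frechet_derivative f (at x)) (at x)"
  by (simp add: frechet_derivative_works)

lemma Ck_on_const: "open S \<Longrightarrow> Ck_on k S (\<lambda>x. c)"
proof (induction k arbitrary: c)
  case (Suc k)
  show ?case using Suc by (intro Ck_on_SucI[where f' = "\<lambda>x v. 0"]) simp_all
qed simp

lemma Ck_on_bounded_linear:
  assumes "open S" "bounded_linear L" "Ck_on k S f"
  shows "Ck_on k S (\<lambda>x. L (f x))"
  using assms(3)
proof (induction k arbitrary: f)
  case 0
  then show ?case using bounded_linear.continuous_on[OF assms(2)] by simp
next
  case (Suc k)
  show ?case
    by (rule Ck_on_SucI[OF assms(1) bounded_linear.has_derivative[OF assms(2)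
          Ck_on_Suc_has_derivative[OF Suc.prems]] Suc.IH]) (use Suc.prems in auto)
qed

lemma Ck_on_add:
  assumes "open S" "Ck_on k S f" "Ck_on k S g"
  shows "Ck_on k S (\<lambda>x. f x + g x)"
  using assms(2,3)
proof (induction k arbitrary: f g)
  case 0
  then show ?case by (simp add: continuous_on_add)
next
  case (Suc k)
  show ?case
    by (rule Ck_on_SucI[OF assms(1) has_derivative_add[OF Ck_on_Suc_has_derivative[OF Suc.prems(1)]
          Ck_on_Suc_has_derivative[OF Suc.prems(2)]] Suc.IH]) (use Suc.prems in auto)
qed

lemma Ck_on_sum:
  assumes "open S" "\<And>i. i \<in> I \<Longrightarrow> Ck_on k S (f i)"
  shows "Ck_on k S (\<lambda>x. \<Sum>i\<in>I. f i x)"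
  using assms(2)
  by (induction I rule: infinite_finite_induct) (auto intro: Ck_on_const Ck_on_add assms(1))

lemma Ck_on_bilinear:
  assumes "open S" "bounded_bilinear B" "Ck_on k S f" "Ck_on k S g"
  shows "Ck_on k S (\<lambda>x. B (f x) (g x))"
  using assms(3,4)
proof (induction k arbitrary: f g)
  case 0
  then show ?case using bounded_bilinear.continuous_on[OF assms(2)] by auto
next
  case (Suc k)
  have "Ck_on k S (\<lambda>x. B (f x) (frechet_derivative g (at x) v)
      + B (frechet_derivative f (at x) v) (g x))" for v
    using Suc.prems
    by (intro Ck_on_add[OF assms(1)] Suc.IH Ck_on_SucD[OF Suc.prems(1)] Ck_on_SucD[OF Suc.prems(2)])
      auto
  then show ?case
    by (rule Ck_on_SucI[OF assms(1), rotated])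
      (rule bounded_bilinear.FDERIV[OF assms(2) Ck_on_Suc_has_derivative[OF Suc.prems(1)]
          Ck_on_Suc_has_derivative[OF Suc.prems(2)]])
qed

text \<open>The chain rule differentiates the outer function in the variable direction \<open>Df(x) v\<close>;
  expanding that direction in a basis brings the induction hypothesis to bear, which is why
  the middle space is finite-dimensional.\<close>

lemma Ck_on_compose:
  fixes f :: "'a::real_normed_vector \<Rightarrow> 'b::euclidean_space"
    and g :: "'b \<Rightarrow> 'c::real_normed_vector"
  assumes "open S" "open T" "f ` S \<subseteq> T" "Ck_on k S f" "Ck_on k T g"
  shows "Ck_on k S (\<lambda>x. g (f x))"
  using assms(4,5)
proof (induction k arbitrary: g)
  case 0
  then show ?case using continuous_on_compose2[of T g S f] assms(3) by auto
next
  case (Suc k)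
  let ?Df = "\<lambda>x. frechet_derivative f (at x)" and ?Dg = "\<lambda>y. frechet_derivative g (at y)"
  have dg: "(g has_derivative ?Dg (f x)) (at (f x))" if "x \<in> S" for x
    using Suc.prems(2) that assms(3) by (intro Ck_on_Suc_has_derivative[where S = T and k = k]) auto
  have der: "((\<lambda>x. g (f x)) has_derivative
      (\<lambda>v. \<Sum>b\<in>Basis. (?Df x v \<bullet> b) *\<^sub>R ?Dg (f x) b)) (at x)" if x: "x \<in> S" for x
  proof -
    have lin: "linear (?Dg (f x))"
      using dg[OF x] has_derivative_linear by blast
    have "?Dg (f x) (?Df x v) = (\<Sum>b\<in>Basis. (?Df x v \<bullet> b) *\<^sub>R ?Dg (f x) b)" for v
      by (subst (1) euclidean_representation[of "?Df x v", symmetric])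
        (simp only: linear_sum[OF lin] linear_scale[OF lin])
    then show ?thesis
      using has_derivative_compose[OF Ck_on_Suc_has_derivative[OF Suc.prems(1) x] dg[OF x]] by simp
  qed
  have "Ck_on k S (\<lambda>x. \<Sum>b\<in>Basis. (?Df x v \<bullet> b) *\<^sub>R ?Dg (f x) b)" for v
    using Suc.prems
    by (intro Ck_on_sum[OF assms(1)] Ck_on_bilinear[OF assms(1) bounded_bilinear_scaleR]
        Ck_on_bounded_linear[OF assms(1) bounded_linear_inner_left] Suc.IH
        Ck_on_SucD[OF Suc.prems(1)]) auto
  from Ck_on_SucI[OF assms(1) der this] show ?case by blast
qed

lemma smooth_on_open: "smooth_on S f \<Longrightarrow> open S"
  by (simp add: smooth_on_def)

lemma smooth_on_cong: "smooth_on S f \<Longrightarrow> (\<And>x. x \<in> S \<Longrightarrow> f x = g x) \<Longrightarrow> smooth_on S g"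
  unfolding smooth_on_def using Ck_on_cong by blast

lemma smooth_on_subset: "smooth_on S f \<Longrightarrow> T \<subseteq> S \<Longrightarrow> open T \<Longrightarrow> smooth_on T f"
  unfolding smooth_on_def using Ck_on_subset by blast

lemma smooth_on_continuous_on: "smooth_on S f \<Longrightarrow> continuous_on S f"
  unfolding smooth_on_def using Ck_on.simps(1) by blast

lemma smooth_on_differentiable: "smooth_on S f \<Longrightarrow> x \<in> S \<Longrightarrow> f differentiable (at x)"
  unfolding smooth_on_def using Ck_on.simps(2) by blast

lemma smooth_on_frechet: "smooth_on S f \<Longrightarrow> smooth_on S (\<lambda>x. frechet_derivative f (at x) v)"
  unfolding smooth_on_def using Ck_on.simps(2) by blast

lemma smooth_on_local:
  assumes "\<And>x. x \<in> S \<Longrightarrow> \<exists>U. x \<in> U \<and> smooth_on U f"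
  and "open S"
  shows "smooth_on S f"
proof -
  have "Ck_on k S f" if "\<And>x. x \<in> S \<Longrightarrow> \<exists>U. x \<in> U \<and> open U \<and> Ck_on k U f" for k f
    using that
  proof (induction k arbitrary: f)
    case 0
    then show ?case
      by (metis Ck_on.simps(1) continuous_at_imp_continuous_on continuous_on_eq_continuous_at)
  next
    case (Suc k)
    have "f differentiable at x" if "x \<in> S" for x
      using Suc.prems[OF that] by auto
    moreover have "Ck_on k S (\<lambda>x. frechet_derivative f (at x) v)" for v
      using Suc.prems by (intro Suc.IH) (metis Ck_on.simps(2))
    ultimately show ?case by simp
  qed
  then show ?thesis using assms unfolding smooth_on_def by metis
qed

named_theorems smooth_intros

lemma smooth_on_const [smooth_intros]: "open S \<Longrightarrow> smooth_on S (\<lambda>x. c)"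
  by (simp add: smooth_on_def Ck_on_const)

lemma smooth_on_linear_comp:
  "bounded_linear L \<Longrightarrow> smooth_on S f \<Longrightarrow> smooth_on S (\<lambda>x. L (f x))"
  by (simp add: smooth_on_def Ck_on_bounded_linear)

lemma smooth_on_ident [smooth_intros]: 
  assumes "open S" shows "smooth_on S (\<lambda>x. x)"
proof -
  have "Ck_on k S (\<lambda>x. x)" for k
    using assms by (cases k) (simp_all del: Ck_on.simps(2) add: Ck_on_const Ck_on_SucI[OF assms has_derivative_ident])
  then show ?thesis by (simp add: smooth_on_def assms)
qed

lemma smooth_on_add [smooth_intros]:
  "smooth_on S f \<Longrightarrow> smooth_on S g \<Longrightarrow> smooth_on S (\<lambda>x. f x + g x)"
  by (simp add: smooth_on_def Ck_on_add)

lemma smooth_on_uminus [smooth_intros]: "smooth_on S f \<Longrightarrow> smooth_on S (\<lambda>x. - f x)"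
  by (rule smooth_on_linear_comp[OF bounded_linear_minus[OF bounded_linear_ident]])

lemma smooth_on_diff [smooth_intros]:
  "smooth_on S f \<Longrightarrow> smooth_on S g \<Longrightarrow> smooth_on S (\<lambda>x. f x - g x)"
  using smooth_on_add[OF _ smooth_on_uminus] by fastforce

lemma smooth_on_mult [smooth_intros]:
  fixes f g :: "'a::real_normed_vector \<Rightarrow> 'b::real_normed_algebra"
  shows "smooth_on S f \<Longrightarrow> smooth_on S g \<Longrightarrow> smooth_on S (\<lambda>x. f x * g x)"
  by (simp add: smooth_on_def Ck_on_bilinear[OF _ bounded_bilinear_mult])

lemma smooth_on_Re [smooth_intros]: "smooth_on S f \<Longrightarrow> smooth_on S (\<lambda>x. Re (f x))"
  by (rule smooth_on_linear_comp[OF bounded_linear_Re])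

lemma smooth_on_Im [smooth_intros]: "smooth_on S f \<Longrightarrow> smooth_on S (\<lambda>x. Im (f x))"
  by (rule smooth_on_linear_comp[OF bounded_linear_Im])

lemma smooth_on_cnj [smooth_intros]: "smooth_on S f \<Longrightarrow> smooth_on S (\<lambda>x. cnj (f x))"
  by (rule smooth_on_linear_comp[OF bounded_linear_cnj])

lemma smooth_on_of_real [smooth_intros]:
  "smooth_on S f \<Longrightarrow> smooth_on S (\<lambda>x. of_real (f x) :: complex)"
  by (rule smooth_on_linear_comp[OF bounded_linear_of_real])

lemma smooth_on_fst [smooth_intros]: "smooth_on S f \<Longrightarrow> smooth_on S (\<lambda>x. fst (f x))"
  by (rule smooth_on_linear_comp[OF bounded_linear_fst])

lemma smooth_on_snd [smooth_intros]: "smooth_on S f \<Longrightarrow> smooth_on S (\<lambda>x. snd (f x))"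
  by (rule smooth_on_linear_comp[OF bounded_linear_snd])

lemma smooth_on_Pair [smooth_intros]:
  assumes "smooth_on S f" "smooth_on S g"
  shows "smooth_on S (\<lambda>x. (f x, g x))"
proof -
  have "smooth_on S (\<lambda>x. (f x, 0) + (0, g x))"
    by (intro smooth_on_add smooth_on_linear_comp[of "\<lambda>x. (x, 0)"]
        smooth_on_linear_comp[of "\<lambda>x. (0, x)"] assms bounded_linear_Pair
        bounded_linear_ident bounded_linear_zero)
  then show ?thesis by simp
qed

lemma smooth_on_compose:
  fixes f :: "'a::real_normed_vector \<Rightarrow> 'b::euclidean_space"
  assumes "smooth_on T g" "smooth_on S f" "\<And>x. x \<in> S \<Longrightarrow> f x \<in> T"
  shows "smooth_on S (\<lambda>x. g (f x))"
  using assms Ck_on_compose[of S T f] by (auto simp: smooth_on_def image_subset_iff)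

text \<open>Many functions have a derivative that is a smooth expression in the function itself: reciprocals, square
  roots, inverse functions. Each order of differentiability of such a function yields the next one.\<close>

lemma smooth_on_bootstrap:
  assumes "open S" "\<And>x. x \<in> S \<Longrightarrow> (f has_derivative f' x) (at x)"
    and "\<And>k v. Ck_on k S f \<Longrightarrow> Ck_on k S (\<lambda>x. f' x v)"
  shows "smooth_on S f"
proof -
  have "Ck_on k S f" for k
  proof (induction k)
    case 0
    have "isCont f x" if "x \<in> S" for x
      using assms(2)[OF that] has_derivative_continuous by blast
    then show ?case by (simp add: continuous_at_imp_continuous_on)
  next
    case (Suc k)
    show ?case by (rule Ck_on_SucI[OF assms(1,2) assms(3)[OF Suc]])
  qed
  then show ?thesis using assms(1) by (simp add: smooth_on_def)
qed

lemma smooth_on_inverse [smooth_intros]: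
  fixes f :: "'a::real_normed_vector \<Rightarrow> 'b::{real_normed_field,euclidean_space}"
  assumes "smooth_on S f" "\<And>x. x \<in> S \<Longrightarrow> f x \<noteq> 0"
  shows "smooth_on S (\<lambda>x. inverse (f x))"
proof -
  have "open (- {0::'b})" by auto
  then have "smooth_on (- {0}) (inverse :: 'b \<Rightarrow> 'b)"
  proof (rule smooth_on_bootstrap)
    show "((inverse :: 'b \<Rightarrow> 'b) has_derivative (\<lambda>v. inverse x * v * (- inverse x))) (at x)"
      if "x \<in> - {0}" for x
      using has_derivative_inverse'[of x UNIV] that by simp
    show "Ck_on k (- {0}) (\<lambda>x::'b. inverse x * v * (- inverse x))"
      if "Ck_on k (- {0}) (inverse :: 'b \<Rightarrow> 'b)" for k v
      by (intro Ck_on_bilinear[OF \<open>open (- {0})\<close> bounded_bilinear_mult] that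
          Ck_on_bounded_linear[OF \<open>open (- {0})\<close> bounded_linear_minus[OF bounded_linear_ident]]
          Ck_on_const[OF \<open>open (- {0})\<close>])
  qed
  from smooth_on_compose[OF this assms(1)] assms(2) show ?thesis by auto
qed

lemma smooth_on_divide [smooth_intros]:
  fixes f :: "'a::real_normed_vector \<Rightarrow> 'b::{real_normed_field,euclidean_space}"
  assumes "smooth_on S f" "smooth_on S g" "\<And>x. x \<in> S \<Longrightarrow> g x \<noteq> 0"
  shows "smooth_on S (\<lambda>x. f x / g x)"
  unfolding divide_inverse by (intro smooth_intros assms)

section \<open>Smooth functions of one real variable\<close>

lemma smooth_on_real_derivative:
  fixes f :: "real \<Rightarrow> real"
  assumes "open S" "\<And>x. x \<in> S \<Longrightarrow> (f has_real_derivative f' x) (at x)" "smooth_on S f'"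
  shows "smooth_on S f"
  using assms
  by (intro smooth_on_bootstrap[where f' = "\<lambda>x v. f' x * v"])
    (auto simp: has_field_derivative_def smooth_on_def
      intro: Ck_on_bounded_linear bounded_linear_mult_left)

lemma smooth_on_has_deriv:
  fixes f :: "real \<Rightarrow> real"
  assumes "smooth_on S f" "x \<in> S"
  shows "(f has_real_derivative deriv f x) (at x)"
  using smooth_on_differentiable[OF assms]
  by (simp add: DERIV_deriv_iff_real_differentiable)

lemma smooth_on_deriv:
  fixes f :: "real \<Rightarrow> real"
  assumes "smooth_on S f"
  shows "smooth_on S (deriv f)"
proof (rule smooth_on_cong[OF smooth_on_frechet[OF assms, of 1]])
  fix x assume "x \<in> S"
  then have "(f has_derivative (\<lambda>v. deriv f x * v)) (at x)"
    using smooth_on_has_deriv[OF assms] by (simp add: has_field_derivative_def)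
  then show "frechet_derivative f (at x) 1 = deriv f x"
    by (metis frechet_derivative_at mult.right_neutral)
qed

lemma smooth_on_deriv_sequence:
  fixes D :: "nat \<Rightarrow> real \<Rightarrow> real"
  assumes "open S" "\<And>n x. x \<in> S \<Longrightarrow> (D n has_real_derivative D (Suc n) x) (at x)"
  shows "smooth_on S (D n)"
proof -
  have "Ck_on k S (D n)" for k n
  proof (induction k arbitrary: n)
    case 0
    have "isCont (D n) x" if "x \<in> S" for x
      using assms(2)[OF that] by (rule DERIV_isCont)
    then show ?case by (simp add: continuous_at_imp_continuous_on)
  next
    case (Suc k)
    show ?case
      by (rule Ck_on_SucI[where f' = "\<lambda>x v. D (Suc n) x * v", OF assms(1)])
        (use assms(2) Suc in \<open>auto simp: has_field_derivative_def
          intro: Ck_on_bounded_linear[OF assms(1) bounded_linear_mult_left]\<close>)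
  qed
  then show ?thesis using assms(1) by (simp add: smooth_on_def)
qed

lemma smooth_on_sin [smooth_intros]: "smooth_on S f \<Longrightarrow> smooth_on S (\<lambda>x. sin (f x :: real))"
  and smooth_on_cos [smooth_intros]: "smooth_on S f \<Longrightarrow> smooth_on S (\<lambda>x. cos (f x :: real))"
proof -
  have shift: "sin (x + of_nat (Suc n) * (pi / 2)) = cos (x + of_nat n * (pi / 2))" for x n
  proof -
    have "x + of_nat (Suc n) * (pi / 2) = (x + of_nat n * (pi / 2)) + pi / 2"
      by (simp add: algebra_simps)
    then show ?thesis by (simp only: sin_add sin_pi_half cos_pi_half)
  qed
  have "smooth_on UNIV (\<lambda>x. sin (x + of_nat n * (pi / 2)))" for n
    by (rule smooth_on_deriv_sequence[where D = "\<lambda>n x. sin (x + of_nat n * (pi / 2))"])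
      (unfold shift, auto intro!: derivative_eq_intros)
  from this[of 0] this[of 1] have "smooth_on UNIV (sin :: real \<Rightarrow> real)"
    "smooth_on UNIV (cos :: real \<Rightarrow> real)" by (simp_all add: sin_add)
  then show "smooth_on S f \<Longrightarrow> smooth_on S (\<lambda>x. sin (f x :: real))"
    "smooth_on S f \<Longrightarrow> smooth_on S (\<lambda>x. cos (f x :: real))"
    using smooth_on_compose by blast+
qed

lemma smooth_on_cis [smooth_intros]: 
  assumes "smooth_on S f"
  shows "smooth_on S (\<lambda>x. cis (f x))"
proof -
  have "cis t = of_real (cos t) + \<i> * of_real (sin t)" for t by (simp add: complex_eq_iff)
  then show ?thesis using assms smooth_on_open[OF assms] by (auto intro!: smooth_intros)
qed

lemma smooth_on_sqrt [smooth_intros]: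
  assumes "smooth_on S f" "\<And>x. x \<in> S \<Longrightarrow> f x > 0"
  shows "smooth_on S (\<lambda>x. sqrt (f x))"
proof -
  have o: "open {0::real<..}" by auto
  have "smooth_on {0<..} (\<lambda>x. sqrt x)"
  proof (rule smooth_on_bootstrap[OF o])
    show "(sqrt has_derivative (\<lambda>v. inverse (2 * sqrt x) * v)) (at x)" if "x \<in> {0<..}" for x
      unfolding has_field_derivative_def[symmetric]
      using that DERIV_real_sqrt[of x] by (simp add: field_simps)
    show "Ck_on k {0<..} (\<lambda>x. inverse (2 * sqrt x) * v)" if "Ck_on k {0<..} sqrt" for k and v :: real
    proof -
      have "open (- {0::real})" by auto
      then have "Ck_on k (- {0::real}) inverse"
        using smooth_on_inverse[OF smooth_on_ident] by (auto simp: smooth_on_def)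
      then have "Ck_on k {0<..} (\<lambda>x. inverse (2 * sqrt x))"
        by (rule Ck_on_compose[OF o \<open>open (- {0})\<close> _
              Ck_on_bounded_linear[OF o bounded_linear_mult_right that], rotated]) auto
      then show ?thesis by (rule Ck_on_bounded_linear[OF o bounded_linear_mult_left])
    qed
  qed
  from smooth_on_compose[OF this assms(1)] assms(2) show ?thesis by auto
qed

lemma smooth_on_arctan [smooth_intros]: "smooth_on S f \<Longrightarrow> smooth_on S (\<lambda>x. arctan (f x))"
proof -
  have "smooth_on UNIV (\<lambda>x. arctan x)"
  proof (rule smooth_on_real_derivative)
    show "(arctan has_real_derivative inverse (1 + x\<^sup>2)) (at x)" for x by (rule DERIV_arctan)
    have "1 + x\<^sup>2 > 0" for x :: real by (simp add: add_pos_nonneg)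
    then show "smooth_on UNIV (\<lambda>x::real. inverse (1 + x\<^sup>2))"
      unfolding power2_eq_square by (intro smooth_intros) (auto simp: less_le)
  qed auto
  then show "smooth_on S f \<Longrightarrow> smooth_on S (\<lambda>x. arctan (f x))"
    using smooth_on_compose by blast
qed

lemma smooth_on_arcsin [smooth_intros]:
  assumes "smooth_on S f" "\<And>x. x \<in> S \<Longrightarrow> \<bar>f x\<bar> < 1"
  shows "smooth_on S (\<lambda>x. arcsin (f x))"
proof -
  have "smooth_on {-1<..<1} (\<lambda>x. arcsin x)"
  proof (rule smooth_on_real_derivative)
    show "(arcsin has_real_derivative inverse (sqrt (1 - x * x))) (at x)" if "x \<in> {-1<..<1}" for x
      using that DERIV_arcsin[of x] by (simp add: power2_eq_square)
    have "1 - x * x > 0" if "x \<in> {-1<..<1}" for x :: real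
      using that abs_square_less_1[of x] by (simp add: power2_eq_square abs_less_iff)
    then show "smooth_on {-1<..<1} (\<lambda>x::real. inverse (sqrt (1 - x * x)))"
      by (intro smooth_intros) force+
  qed auto
  from smooth_on_compose[OF this assms(1)] assms(2) show ?thesis by (auto simp: abs_less_iff)
qed

lemma continuous_imp_antiderivative:
  fixes f :: "real \<Rightarrow> real"
  assumes "continuous_on UNIV f"
  obtains F where "\<And>x. (F has_real_derivative f x) (at x)"
proof -
  have "\<exists>F. \<forall>x :: real. -\<infinity> < ereal x \<longrightarrow> x < \<infinity> \<longrightarrow> (F has_vector_derivative f x) (at x)"
    using assms by (intro einterval_antiderivative) (auto simp: continuous_on_eq_continuous_at)
  then show thesis using that by (auto simp: has_real_derivative_iff_has_vector_derivative)
qed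

text \<open>Hadamard's lemma: the quotient is \<open>\<integral>\<^sub>0\<^sup>1 f'(z + s (x - z)) ds\<close>, and
  differentiation under the integral sign gives all its derivatives.\<close>

lemma Hadamard:
  fixes f :: "real \<Rightarrow> real"
  assumes "smooth_on UNIV f"
  obtains q where "smooth_on UNIV q" "\<And>x. f x = f z + (x - z) * q x"
proof -
  define F where "F n = (deriv ^^ n) f" for n
  define D where "D n x = integral (cbox 0 1) (\<lambda>s. s ^ n * F (Suc n) (z + s * (x - z)))" for n x
  have F0: "F 0 = f" and F1: "F (Suc 0) = deriv f" by (simp_all add: F_def)
  have sm: "smooth_on UNIV (F n)" for n
    by (induction n) (use assms smooth_on_deriv in \<open>auto simp: F_def\<close>)
  have der: "(F n has_real_derivative F (Suc n) x) (at x)" for n x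
    using smooth_on_has_deriv[OF sm, of x n] by (simp add: F_def)
  have cont: "continuous_on T (\<lambda>x. F n (h x))" if "continuous_on T h"
    for T and h :: "'x::topological_space \<Rightarrow> real" and n
    using continuous_on_compose2[OF smooth_on_continuous_on[OF sm] that] by auto
  have "(D n has_real_derivative D (Suc n) x) (at x within UNIV)" for n x
    unfolding D_def
  proof (rule leibniz_rule_field_derivative[where f = "\<lambda>x s. s ^ n * F (Suc n) (z + s * (x - z))"
        and fx = "\<lambda>x s. s ^ Suc n * F (Suc (Suc n)) (z + s * (x - z))" and U = UNIV])
    fix x s :: real
    have "((\<lambda>x. s ^ n * F (Suc n) (z + s * (x - z))) has_real_derivative
        s ^ n * (F (Suc (Suc n)) (z + s * (x - z)) * s)) (at x)"
      by (rule DERIV_cmult[OF DERIV_chain2[OF der]]) (auto intro!: derivative_eq_intros)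
    then show "((\<lambda>x. s ^ n * F (Suc n) (z + s * (x - z))) has_real_derivative
        s ^ Suc n * F (Suc (Suc n)) (z + s * (x - z))) (at x within UNIV)"
      by (simp add: mult_ac)
  next
    fix x :: real
    show "(\<lambda>s. s ^ n * F (Suc n) (z + s * (x - z))) integrable_on cbox 0 1"
      by (intro integrable_continuous continuous_intros cont)
  next
    show "continuous_on (UNIV \<times> cbox 0 1)
        (\<lambda>(x, s). s ^ Suc n * F (Suc (Suc n)) (z + s * (x - z)))"
      unfolding split_beta by (intro continuous_intros cont)
  qed simp_all
  then have "smooth_on UNIV (D 0)"
    by (intro smooth_on_deriv_sequence) auto
  moreover have "f x = f z + (x - z) * D 0 x" for x
  proof -
    have "((\<lambda>s. (x - z) * deriv f (z + s * (x - z))) has_integral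
        f (z + 1 * (x - z)) - f (z + 0 * (x - z))) {0..1}"
    proof (rule fundamental_theorem_of_calculus)
      fix s :: real
      have "((\<lambda>s. f (z + s * (x - z))) has_real_derivative deriv f (z + s * (x - z)) * (x - z)) (at s)"
        using der[of 0] unfolding F0 F1
        by (intro DERIV_chain2[where f = f]) (auto intro!: derivative_eq_intros)
      then show "((\<lambda>s. f (z + s * (x - z))) has_vector_derivative
          (x - z) * deriv f (z + s * (x - z))) (at s within {0..1})"
        by (auto simp: has_real_derivative_iff_has_vector_derivative mult.commute
            intro: has_vector_derivative_at_within)
    qed simp
    then have "integral {0..1} (\<lambda>s. (x - z) * deriv f (z + s * (x - z))) = f x - f z"
      by (auto dest: integral_unique)
    then show ?thesis by (simp add: D_def F1)
  qed
  ultimately show thesis using that by blast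
qed

section \<open>Periodic functions and diffeomorphisms of the circle\<close>

lemma shift_int:
  assumes "\<And>t. f (t + 2 * pi) = f t + (d::real)"
  shows "f (t + 2 * pi * of_int n) = f t + d * of_int n"
proof -
  have *: "f (t + 2 * pi * real n) = f t + d * real n" for n t
  proof (induction n)
    case (Suc n)
    have "f (t + 2 * pi * real (Suc n)) = f (t + 2 * pi * real n + 2 * pi)"
      by (simp add: algebra_simps)
    also have "\<dots> = f (t + 2 * pi * real n) + d" by (rule assms)
    finally show ?case using Suc by (simp add: algebra_simps)
  qed simp
  show ?thesis
  proof (cases n)
    case (nonneg k)
    then show ?thesis using *[of t k] by simp
  next
    case (neg k)
    have "t + 2 * pi * of_int n + 2 * pi * real (Suc k) = t"
      unfolding neg of_int_minus of_int_of_nat_eq by (simp only: mult_minus_right)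
    then have "f t = f (t + 2 * pi * of_int n) + d * real (Suc k)"
      using *[of "t + 2 * pi * of_int n" "Suc k"] by (simp only:)
    moreover have "d * of_int n = - (d * real (Suc k))"
      unfolding neg of_int_minus of_int_of_nat_eq by (simp only: mult_minus_right)
    ultimately show ?thesis by linarith
  qed
qed

lemma shift_into_period:
  obtains n :: int where "a \<le> t + 2 * pi * of_int n" "t + 2 * pi * of_int n < a + 2 * pi"
proof
  let ?n = "- \<lfloor>(t - a) / (2 * pi)\<rfloor>"
  have "of_int \<lfloor>(t - a) / (2 * pi)\<rfloor> * (2 * pi) \<le> t - a"
    by (simp add: pos_le_divide_eq[symmetric])
  then show "a \<le> t + 2 * pi * of_int ?n" by (simp add: mult.commute)
  have "t - a < (of_int \<lfloor>(t - a) / (2 * pi)\<rfloor> + 1) * (2 * pi)"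
    by (subst pos_divide_less_eq[symmetric]) (simp, linarith)
  then show "t + 2 * pi * of_int ?n < a + 2 * pi" by (simp add: algebra_simps)
qed

lemma periodic_all:
  assumes "\<And>t. Pr (t + 2 * pi) = Pr t" "\<And>t. a \<le> t \<Longrightarrow> t < a + 2 * pi \<Longrightarrow> Pr t"
  shows "Pr t"
proof -
  obtain n :: int where "a \<le> t + 2 * pi * of_int n" "t + 2 * pi * of_int n < a + 2 * pi"
    by (rule shift_into_period)
  from assms(2)[OF this] show ?thesis
    using shift_int[of "\<lambda>t. of_bool (Pr t)" 0 t n] assms(1) by (simp add: of_bool_def split: if_splits)
qed

lemma smooth_on_periodic:
  fixes f :: "real \<Rightarrow> real"
  assumes per: "\<And>t. f (t + 2 * pi) = f t + d"
    and loc: "\<And>t. a \<le> t \<Longrightarrow> t < a + 2 * pi \<Longrightarrow> \<exists>U. t \<in> U \<and> smooth_on U f"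
  shows "smooth_on UNIV f"
proof (rule smooth_on_local)
  fix t :: real
  obtain n :: int where n: "a \<le> t + 2 * pi * of_int n" "t + 2 * pi * of_int n < a + 2 * pi"
    by (rule shift_into_period)
  then obtain U where U: "t + 2 * pi * of_int n \<in> U" "smooth_on U f" using loc by blast
  let ?V = "(\<lambda>s. s + 2 * pi * of_int n) -` U"
  have "open ?V"
    using smooth_on_open[OF U(2)] by (intro open_vimage continuous_intros)
  then have "smooth_on ?V (\<lambda>s. f (s + 2 * pi * of_int n) + - (d * of_int n))"
    by (intro smooth_intros smooth_on_compose[OF U(2)]) auto
  then have "smooth_on ?V f" using shift_int[of f d, OF per] by simp
  then show "\<exists>U. t \<in> U \<and> smooth_on U f" using U(1) by (intro exI[of _ ?V]) auto
qed simp

lemma deriv_periodic: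
  fixes f :: "real \<Rightarrow> real"
  assumes "\<And>t. f (t + 2 * pi) = f t + d" "smooth_on UNIV f"
  shows "deriv f (t + 2 * pi) = deriv f t"
proof -
  have "((\<lambda>x. f (x + 2 * pi)) has_real_derivative deriv f (t + 2 * pi)) (at t)"
    using smooth_on_has_deriv[OF assms(2), of "t + 2 * pi"] by (simp add: DERIV_shift[symmetric] add.commute)
  moreover have "((\<lambda>x. f (x + 2 * pi)) has_real_derivative deriv f t) (at t)"
    unfolding assms(1) using smooth_on_has_deriv[OF assms(2), of t] by (auto intro!: derivative_eq_intros)
  ultimately show ?thesis by (rule DERIV_unique)
qed

text \<open>These are the lifts to the real line of the orientation-preserving diffeomorphisms of the circle.\<close>

definition circle_lift :: "(real \<Rightarrow> real) \<Rightarrow> bool" where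
  "circle_lift \<eta> \<longleftrightarrow> smooth_on UNIV \<eta> \<and> (\<forall>t. 0 < deriv \<eta> t) \<and> (\<forall>t. \<eta> (t + 2 * pi) = \<eta> t + 2 * pi)"

lemma circle_lift_strict_mono:
  assumes "circle_lift \<eta>" shows "strict_mono \<eta>"
proof (rule strict_monoI)
  fix x y :: real assume "x < y"
  then show "\<eta> x < \<eta> y"
    by (rule DERIV_pos_imp_increasing)
      (use assms smooth_on_has_deriv[of UNIV \<eta>] in \<open>unfold circle_lift_def, blast\<close>)
qed

lemma circle_lift_bij:
  assumes "circle_lift \<eta>" shows "bij \<eta>"
proof -
  have cont: "continuous_on T \<eta>" for T
    using assms smooth_on_continuous_on continuous_on_subset unfolding circle_lift_def by blast
  have "y \<in> range \<eta>" for y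
  proof -
    obtain n :: int where n: "\<eta> 0 \<le> y + 2 * pi * of_int n" "y + 2 * pi * of_int n < \<eta> 0 + 2 * pi"
      by (rule shift_into_period)
    have "\<eta> (0 + 2 * pi) = \<eta> 0 + 2 * pi" using assms unfolding circle_lift_def by blast
    then have "\<exists>t\<ge>0. t \<le> 2 * pi \<and> \<eta> t = y + 2 * pi * of_int n"
      using n cont[of "{0..2 * pi}"] by (intro IVT') simp_all
    then obtain t where "\<eta> t = y + 2 * pi * of_int n" by blast
    then have "\<eta> (t + 2 * pi * of_int (- n)) = y"
      using shift_int[of \<eta> "2 * pi" t "- n"] assms by (simp add: circle_lift_def)
    then show ?thesis by (intro range_eqI) (rule sym)
  qed
  then have "surj \<eta>" by (simp add: set_eq_iff)
  moreover have "inj \<eta>" by (rule strict_mono_imp_inj_on[OF circle_lift_strict_mono[OF assms]])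
  ultimately show ?thesis by (simp only: bij_def)
qed

lemma circle_lift_ident: "circle_lift (\<lambda>t. t)"
  by (simp add: circle_lift_def smooth_on_ident)

lemma circle_lift_compose:
  assumes "circle_lift \<eta>" "circle_lift \<theta>" shows "circle_lift (\<lambda>t. \<eta> (\<theta> t))"
proof -
  have "((\<lambda>t. \<eta> (\<theta> t)) has_real_derivative deriv \<eta> (\<theta> t) * deriv \<theta> t) (at t)" for t
    using assms by (intro DERIV_chain2[where f = \<eta> and g = \<theta>] smooth_on_has_deriv[of UNIV])
      (simp_all add: circle_lift_def)
  then have "deriv (\<lambda>t. \<eta> (\<theta> t)) t = deriv \<eta> (\<theta> t) * deriv \<theta> t" for t
    by (rule DERIV_imp_deriv)
  then show ?thesis
    using assms by (simp add: circle_lift_def smooth_on_compose[of UNIV \<eta>])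
qed

text \<open>By the formula for the derivative of an inverse function, the derivative of the inverse is a smooth
function of the inverse, so the bootstrap applies.\<close>

lemma circle_lift_inv:
  assumes "circle_lift \<eta>" shows "circle_lift (inv \<eta>)"
proof -
  have sm: "smooth_on UNIV \<eta>" and pos: "deriv \<eta> t > 0" and per: "\<eta> (t + 2 * pi) = \<eta> t + 2 * pi" for t
    using assms by (auto simp: circle_lift_def)
  note bij = circle_lift_bij[OF assms]
  have inv1: "\<eta> (inv \<eta> y) = y" and inv2: "inv \<eta> (\<eta> t) = t" for y t
    using bij by (simp_all add: bij_def surj_f_inv_f)
  have der: "(inv \<eta> has_real_derivative inverse (deriv \<eta> (inv \<eta> y))) (at y)" for y
  proof (rule DERIV_inverse_function[where f = \<eta> and a = "y - 1" and b = "y + 1"])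
    show "(\<eta> has_real_derivative deriv \<eta> (inv \<eta> y)) (at (inv \<eta> y))"
      using smooth_on_has_deriv[OF sm] by simp
    have "isCont (inv \<eta>) (\<eta> (inv \<eta> y))"
      using DERIV_isCont[OF smooth_on_has_deriv[OF sm]]
      by (intro isCont_inverse_function[where f = \<eta> and g = "inv \<eta>" and x = "inv \<eta> y" and d = 1])
        (simp_all add: inv2)
    then show "isCont (inv \<eta>) y" by (simp add: inv1)
    show "deriv \<eta> (inv \<eta> y) \<noteq> 0" using pos[of "inv \<eta> y"] by simp
  qed (simp_all add: inv1)
  have "smooth_on UNIV (inv \<eta>)"
  proof (rule smooth_on_bootstrap[where f' = "\<lambda>y v. inverse (deriv \<eta> (inv \<eta> y)) * v"])
    show "(inv \<eta> has_derivative (*) (inverse (deriv \<eta> (inv \<eta> y)))) (at y)" for y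
      using der[of y] by (simp add: has_field_derivative_def)
    have "smooth_on UNIV (\<lambda>t. inverse (deriv \<eta> t))"
      using pos by (intro smooth_intros smooth_on_deriv sm) (metis less_irrefl)
    then show "Ck_on k UNIV (\<lambda>y. inverse (deriv \<eta> (inv \<eta> y)) * v)"
      if "Ck_on k UNIV (inv \<eta>)" for k v
      using that Ck_on_compose[of UNIV UNIV "inv \<eta>" k "\<lambda>t. inverse (deriv \<eta> t)"]
      by (intro Ck_on_bounded_linear[OF open_UNIV bounded_linear_mult_left]) (simp add: smooth_on_def)
  qed simp
  moreover have "deriv (inv \<eta>) y > 0" for y
    using DERIV_imp_deriv[OF der[of y]] pos by simp
  moreover have "inv \<eta> (y + 2 * pi) = inv \<eta> y + 2 * pi" for y
    using inv2[of "inv \<eta> y + 2 * pi"] by (simp add: per inv1)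
  ultimately show ?thesis by (simp add: circle_lift_def)
qed

section \<open>Morse functions on the circle with one maximum and one minimum\<close>

text \<open>By Hadamard's lemma \<open>H = (t - z)\<^sup>2 h\<close> and \<open>K = (t - z) k\<close> with \<open>h > 0\<close> and \<open>k \<noteq> 0\<close> near \<open>z\<close>. The sign of
  \<open>K\<close> turns \<open>sqrt H = \<bar>t - z\<bar> sqrt h\<close> into \<open>(t - z) sqrt h\<close> up to a constant sign, and this is smooth.\<close>

lemma smooth_signed_sqrt:
  fixes H K :: "real \<Rightarrow> real"
  assumes H: "smooth_on UNIV H" "H z = 0" "deriv H z = 0" "deriv (deriv H) z > 0"
    and K: "smooth_on UNIV K" "K z = 0" "deriv K z \<noteq> 0"
  obtains U p where "z \<in> U" "smooth_on U (\<lambda>t. - sgn (K t) * sqrt (H t))" "p > 0"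
    "((\<lambda>t. - sgn (K t) * sqrt (H t)) has_real_derivative - sgn (deriv K z) * p) (at z)"
proof -
  have first_order: "deriv f z = q z" 
    if "smooth_on UNIV q" "\<And>x. f x = f z + (x - z) * q x" for f q :: "real \<Rightarrow> real"
  proof -
    have "((\<lambda>x. f z + (x - z) * q x) has_real_derivative q z) (at z)"
      using smooth_on_has_deriv[OF that(1), of z] by (auto intro!: derivative_eq_intros)
    then have "(f has_real_derivative q z) (at z)"
      by (rule has_field_derivative_transform_within_open[OF _ open_UNIV UNIV_I])
        (rule that(2)[symmetric])
    then show ?thesis by (rule DERIV_imp_deriv)
  qed
  obtain k where k: "smooth_on UNIV k" "\<And>x. K x = K z + (x - z) * k x" using Hadamard[where z = z, OF K(1)] by blast
  obtain h1 where h1: "smooth_on UNIV h1" "\<And>x. H x = H z + (x - z) * h1 x" using Hadamard[where z = z, OF H(1)] by blast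
  have "h1 z = 0" using first_order[OF h1] H by simp
  obtain h where h: "smooth_on UNIV h" "\<And>x. h1 x = h1 z + (x - z) * h x" using Hadamard[where z = z, OF h1(1)] by blast
  have Heq: "H x = (x - z)\<^sup>2 * h x" for x
    using h1(2)[of x] h(2)[of x] H(2) \<open>h1 z = 0\<close> by (simp add: power2_eq_square)
  have Keq: "K x = (x - z) * k x" for x using k(2)[of x] K(2) by simp
  have kz: "k z = deriv K z" using first_order[OF k] by simp
  have dH: "(H has_real_derivative 2 * (x - z) * h x + (x - z)\<^sup>2 * deriv h x) (at x)" for x
    unfolding Heq[abs_def] using smooth_on_has_deriv[OF h(1), of x]
    by (auto intro!: derivative_eq_intros)
  have "deriv H = (\<lambda>x. 2 * (x - z) * h x + (x - z)\<^sup>2 * deriv h x)"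
    using DERIV_imp_deriv[OF dH] by blast
  moreover have "((\<lambda>x. 2 * (x - z) * h x + (x - z)\<^sup>2 * deriv h x) has_real_derivative 2 * h z) (at z)"
    using smooth_on_has_deriv[OF h(1), of z] smooth_on_has_deriv[OF smooth_on_deriv[OF h(1)], of z]
    by (auto intro!: derivative_eq_intros)
  ultimately have hz: "h z > 0" using H(4) DERIV_imp_deriv by fastforce
  define U where "U = {t. 0 < h t} \<inter> {t. 0 < k t * k z}"
  have "continuous_on UNIV h" "continuous_on UNIV k"
    using h(1) k(1) smooth_on_continuous_on by auto
  then have "open U" unfolding U_def by (intro open_Int open_Collect_less continuous_intros) auto
  have "z \<in> U" using hz kz K(3) by (auto simp: U_def zero_less_mult_iff linorder_neq_iff)
  define c where "c t = - sgn (k z) * ((t - z) * sqrt (h t))" for t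
  have "smooth_on U c"
    unfolding c_def using \<open>open U\<close>
    by (intro smooth_intros smooth_on_subset[OF h(1)]) (auto simp: U_def)
  have eq: "c t = - sgn (K t) * sqrt (H t)" if "t \<in> U" for t
  proof -
    have "sgn (k t) = sgn (k z)" using that by (auto simp: U_def zero_less_mult_iff)
    then have "sgn (K t) * sqrt (H t) = sgn (k z) * ((sgn (t - z) * \<bar>t - z\<bar>) * sqrt (h t))"
      unfolding Heq Keq sgn_mult by (simp add: real_sqrt_mult)
    then show ?thesis by (simp add: c_def mult.commute[of "sgn (t - z)"] abs_mult_sgn)
  qed
  have "(c has_real_derivative - sgn (deriv K z) * sqrt (h z)) (at z)"
  proof -
    have "((\<lambda>t. sqrt (h t)) has_real_derivative inverse (sqrt (h z)) / 2 * deriv h z) (at z)"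
      using hz smooth_on_has_deriv[OF h(1), of z] by (intro DERIV_chain2[OF DERIV_real_sqrt]) auto
    from DERIV_cmult[OF DERIV_mult[OF DERIV_diff[OF DERIV_ident DERIV_const[of z]] this], of "- sgn (k z)"]
    show ?thesis unfolding c_def kz[symmetric] by simp
  qed
  then have "((\<lambda>t. - sgn (K t) * sqrt (H t)) has_real_derivative - sgn (deriv K z) * sqrt (h z)) (at z)"
    by (rule has_field_derivative_transform_within_open[OF _ \<open>open U\<close> \<open>z \<in> U\<close> eq])
  then show thesis
    using that[OF \<open>z \<in> U\<close> smooth_on_cong[OF \<open>smooth_on U c\<close> eq] real_sqrt_gt_zero[OF hz]] by blast
qed

text \<open>Morse functions on the circle with one minimum and one maximum, read on the real line: in the period that
starts at \<open>p\<close>, the minimum is at \<open>p\<close> and the maximum at \<open>q\<close>.\<close>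

definition simple_Morse :: "(real \<Rightarrow> real) \<Rightarrow> real \<Rightarrow> real \<Rightarrow> bool" where
  "simple_Morse G p q \<longleftrightarrow> smooth_on UNIV G \<and> (\<forall>t. G (t + 2 * pi) = G t) \<and> p < q \<and> q < p + 2 * pi \<and>
     (\<forall>t. p < t \<and> t < q \<longrightarrow> 0 < deriv G t) \<and> (\<forall>t. q < t \<and> t < p + 2 * pi \<longrightarrow> deriv G t < 0) \<and>
     deriv G p = 0 \<and> deriv G q = 0 \<and> 0 < deriv (deriv G) p \<and> deriv (deriv G) q < 0"

text \<open>The angle has to be an antiderivative of \<open>S' C - S C'\<close>. For such a function \<open>\<eta>\<close>, the scalar product and the
cross product of \<open>(C, S)\<close> and \<open>(cos \<eta>, sin \<eta>)\<close> have derivative zero, so the two points agree everywhere if they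
agree once.\<close>

lemma angle_of_unit_curve:
  fixes C S :: "real \<Rightarrow> real"
  assumes sm: "smooth_on UNIV C" "smooth_on UNIV S" and CS: "\<And>t. C t * C t + S t * S t = 1"
    and start: "C p = cos \<phi>" "S p = sin \<phi>"
  obtains \<eta> where "smooth_on UNIV \<eta>" "\<eta> p = \<phi>" "\<And>t. cos (\<eta> t) = C t" "\<And>t. sin (\<eta> t) = S t"
proof -
  have dC: "(C has_real_derivative deriv C t) (at t)" and dS: "(S has_real_derivative deriv S t) (at t)" for t
    using smooth_on_has_deriv sm by blast+
  have CS': "C t * deriv C t + S t * deriv S t = 0" for t
  proof -
    have "((\<lambda>t. C t * C t + S t * S t) has_real_derivative 2 * (C t * deriv C t + S t * deriv S t)) (at t)"
      using dC[of t] dS[of t] by (auto intro!: derivative_eq_intros)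
    moreover have "((\<lambda>t. C t * C t + S t * S t) has_real_derivative 0) (at t)"
      unfolding CS by simp
    ultimately have "2 * (C t * deriv C t + S t * deriv S t) = 0" by (rule DERIV_unique)
    then show ?thesis by simp
  qed
  define \<nu> where "\<nu> t = deriv S t * C t - S t * deriv C t" for t
  have "deriv S t = C t * \<nu> t" "deriv C t = - S t * \<nu> t" for t
    unfolding \<nu>_def using CS[of t] CS'[of t] by algebra+
  note dC = dC[unfolded this] and dS = dS[unfolded this]
  have sm\<nu>: "smooth_on UNIV \<nu>"
    unfolding \<nu>_def by (intro smooth_intros smooth_on_deriv sm)
  obtain F where F: "\<And>t. (F has_real_derivative \<nu> t) (at t)"
    using continuous_imp_antiderivative[OF smooth_on_continuous_on[OF sm\<nu>]] by blast
  define \<eta> where "\<eta> t = F t - F p + \<phi>" for t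
  have d\<eta>: "(\<eta> has_real_derivative \<nu> t) (at t)" for t
    unfolding \<eta>_def using F[of t] by (auto intro!: derivative_eq_intros)
  have \<eta>p: "\<eta> p = \<phi>" by (simp add: \<eta>_def)
  have "((\<lambda>t. C t * cos (\<eta> t) + S t * sin (\<eta> t)) has_real_derivative 0) (at x)"
    "((\<lambda>t. S t * cos (\<eta> t) - C t * sin (\<eta> t)) has_real_derivative 0) (at x)" for x
    using dC[of x] dS[of x] d\<eta>[of x] by (auto intro!: derivative_eq_intros simp: algebra_simps)
  then have AB: "C t * cos (\<eta> t) + S t * sin (\<eta> t) = C p * cos (\<eta> p) + S p * sin (\<eta> p)"
    "S t * cos (\<eta> t) - C t * sin (\<eta> t) = S p * cos (\<eta> p) - C p * sin (\<eta> p)" for t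
    using DERIV_isconst_all by blast+
  have "cos (\<eta> t) = C t \<and> sin (\<eta> t) = S t" for t
    using AB[of t] CS[of t] CS[of p] unfolding \<eta>p start[symmetric] by algebra
  then show thesis
    using that smooth_on_real_derivative[OF open_UNIV d\<eta> sm\<nu>] \<eta>p by blast
qed

text \<open>The normal form is \<open>M + R sin \<eta>\<close>. With \<open>S = (G - M) / R\<close> the cosine of the wanted angle
  \<open>\<eta>\<close> has to be \<open>C = \<plusminus>sqrt (1 - S\<^sup>2)\<close>, positive exactly where \<open>G\<close> increases; as
  \<open>1 - S\<^sup>2\<close> has non-degenerate double zeros at the two critical points, \<open>C\<close> is smooth. Then \<open>(C, S)\<close>
  is a smooth curve on the unit circle, and \<open>\<eta>\<close> is its angle.\<close>

lemma simple_Morse_normal_form: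
  assumes "simple_Morse G p q"
  obtains \<eta> where "circle_lift \<eta>" "\<And>t. G t = (G q + G p) / 2 + (G q - G p) / 2 * sin (\<eta> t)"
    "G p < G q"
proof -
  have sm: "smooth_on UNIV G" and per: "\<And>t. G (t + 2 * pi) = G t"
    and ord: "p < q" "q < p + 2 * pi"
    and inc: "\<And>t. p < t \<Longrightarrow> t < q \<Longrightarrow> 0 < deriv G t"
    and dec: "\<And>t. q < t \<Longrightarrow> t < p + 2 * pi \<Longrightarrow> deriv G t < 0"
    and crit: "deriv G p = 0" "deriv G q = 0"
    and nondeg: "0 < deriv (deriv G) p" "deriv (deriv G) q < 0"
    using assms unfolding simple_Morse_def by blast+
  define M where "M = (G q + G p) / 2"
  define R where "R = (G q - G p) / 2"
  have contG: "continuous_on T G" for T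
    using smooth_on_continuous_on[OF sm] continuous_on_subset by blast
  have Ginc: "G s < G t" if "p \<le> s" "s < t" "t \<le> q" for s t
  proof (rule DERIV_pos_imp_increasing_open[OF that(2) _ contG])
    fix x assume "s < x" "x < t"
    then show "\<exists>y. (G has_real_derivative y) (at x) \<and> 0 < y"
      using smooth_on_has_deriv[OF sm UNIV_I, of x] inc[of x] that by force
  qed
  have Gdec: "G t < G s" if "q \<le> s" "s < t" "t \<le> p + 2 * pi" for s t
  proof (rule DERIV_neg_imp_decreasing_open[OF that(2) _ contG])
    fix x assume "s < x" "x < t"
    then show "\<exists>y. (G has_real_derivative y) (at x) \<and> y < 0"
      using smooth_on_has_deriv[OF sm UNIV_I, of x] dec[of x] that by force
  qed
  have Rpos: "R > 0" using Ginc[of p q] ord by (simp add: R_def)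
  define S where "S t = (G t - M) / R" for t
  have smS: "smooth_on UNIV S"
    unfolding S_def divide_inverse by (intro smooth_intros sm open_UNIV)
  have dS: "deriv S = (\<lambda>t. deriv G t / R)"
    unfolding S_def using smooth_on_has_deriv[OF sm UNIV_I] Rpos
    by (intro ext DERIV_imp_deriv) (auto intro!: derivative_eq_intros)
  have ddS: "deriv (deriv S) t = deriv (deriv G) t / R" for t
    unfolding dS using smooth_on_has_deriv[OF smooth_on_deriv[OF sm] UNIV_I]
    by (intro DERIV_imp_deriv DERIV_cdivide)
  have perS: "S (t + 2 * pi) = S t" for t by (simp add: S_def per)
  have Sq: "S q = 1" and Sp: "S p = -1"
    using Rpos by (simp_all add: S_def M_def R_def field_simps)
  have S_lt: "-1 < S t" "S t < 1" if "p < t" "t < p + 2 * pi" "t \<noteq> q" for t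
  proof -
    have "G p < G t \<and> G t < G q"
      using Ginc[of p t] Ginc[of t q] Gdec[of q t] Gdec[of t "p + 2 * pi"] per[of p] that ord
      by (cases "t < q") auto
    then have "S p < S t \<and> S t < S q"
      using Rpos by (simp add: S_def divide_strict_right_mono)
    then show "-1 < S t" "S t < 1" using Sp Sq by simp_all
  qed
  define H where "H t = 1 - S t * S t" for t
  \<comment> \<open>\<open>K\<close> is periodic, has its zeros exactly at the critical points, and is negative where \<open>G\<close> increases.\<close>
  define K where "K t = sin ((t - q) / 2) * sin ((t - p) / 2)" for t
  have smH: "smooth_on UNIV H" unfolding H_def by (intro smooth_intros smS open_UNIV)
  have smK: "smooth_on UNIV K"
    unfolding K_def divide_inverse by (intro smooth_intros open_UNIV)
  have dH: "deriv H = (\<lambda>t. - 2 * S t * deriv S t)"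
    unfolding H_def using smooth_on_has_deriv[OF smS UNIV_I]
    by (intro ext DERIV_imp_deriv) (auto intro!: derivative_eq_intros)
  have ddH: "deriv (deriv H) t = - 2 * (deriv S t * deriv S t + S t * deriv (deriv S) t)" for t
    unfolding dH
    using smooth_on_has_deriv[OF smS UNIV_I, of t] smooth_on_has_deriv[OF smooth_on_deriv[OF smS] UNIV_I, of t]
    by (intro DERIV_imp_deriv) (auto intro!: derivative_eq_intros simp: algebra_simps)
  have dK: "deriv K t = cos ((t - q) / 2) / 2 * sin ((t - p) / 2)
      + sin ((t - q) / 2) * (cos ((t - p) / 2) / 2)" for t
    unfolding K_def by (intro DERIV_imp_deriv) (auto intro!: derivative_eq_intros)
  define C where "C t = - sgn (K t) * sqrt (H t)" for t
  have half: "0 < sin (x / 2)" if "0 < x" "x < 2 * pi" for x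
    using that by (intro sin_gt_zero) auto
  have Kq: "K q = 0" "deriv K q > 0"
    using half[of "q - p"] ord by (simp_all add: K_def dK)
  have odd: "sin ((x - y) / 2) = - sin ((y - x) / 2)" for x y :: real
  proof -
    have "(x - y) / 2 = - ((y - x) / 2)" by (simp add: field_simps)
    then show ?thesis by (simp only: sin_minus)
  qed
  have Kp: "K p = 0" "deriv K p < 0"
    using half[of "q - p"] ord by (simp_all add: K_def dK odd[of p q])
  have Kneg: "K t < 0" if "p < t" "t < q" for t
    using half[of "q - t"] half[of "t - p"] that ord by (simp add: K_def odd[of t q])
  have Kpos: "K t > 0" if "q < t" "t < p + 2 * pi" for t
    using half[of "t - q"] half[of "t - p"] that ord by (simp add: K_def)
  have Hpos: "H t > 0" if "p < t" "t < p + 2 * pi" "t \<noteq> q" for t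
    using S_lt[OF that] mult_pos_pos[of "1 - S t" "1 + S t"] by (simp add: H_def algebra_simps)
  have Hq: "H q = 0" "deriv H q = 0" "0 < deriv (deriv H) q"
    and Hp: "H p = 0" "deriv H p = 0" "0 < deriv (deriv H) p"
    using Rpos nondeg
    by (simp_all only: ddH ddS) (simp_all add: dH dS Sp Sq crit H_def divide_neg_pos)
  obtain Uq rq where Uq: "q \<in> Uq" "smooth_on Uq C" "rq > 0"
      "(C has_real_derivative - sgn (deriv K q) * rq) (at q)"
    unfolding C_def
    using smooth_signed_sqrt[OF smH Hq smK Kq(1) less_imp_neq[OF Kq(2), symmetric]] by blast
  obtain Up rp where Up: "p \<in> Up" "smooth_on Up C" "rp > 0"
      "(C has_real_derivative - sgn (deriv K p) * rp) (at p)"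
    unfolding C_def
    using smooth_signed_sqrt[OF smH Hp smK Kp(1) less_imp_neq[OF Kp(2)]] by blast
  have perC: "C (t + 2 * pi) = C t + 0" for t
  proof -
    have "sin ((t + 2 * pi - x) / 2) = - sin ((t - x) / 2)" for x
      using sin_periodic_pi[of "(t - x) / 2"] by (simp add: diff_divide_distrib add_divide_distrib algebra_simps)
    then show ?thesis by (simp add: C_def K_def H_def perS)
  qed
  have smC: "smooth_on UNIV C"
  proof (rule smooth_on_periodic[where f = C, OF perC])
    fix t assume t: "p \<le> t" "t < p + 2 * pi"
    consider "t = p" | "t = q" | "p < t" "t < q" | "q < t" "t < p + 2 * pi" using t by linarith
    then show "\<exists>U. t \<in> U \<and> smooth_on U C"
    proof cases
      case 3
      have "smooth_on {p<..<q} (\<lambda>t. sqrt (H t))"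
        using ord by (intro smooth_intros smooth_on_subset[OF smH]) (simp_all add: Hpos)
      then have "smooth_on {p<..<q} C"
        by (rule smooth_on_cong) (simp add: C_def Kneg)
      then show ?thesis using 3 by (intro exI[of _ "{p<..<q}"]) simp
    next
      case 4
      have "smooth_on {q<..<p + 2 * pi} (\<lambda>t. - sqrt (H t))"
        using ord by (intro smooth_intros smooth_on_subset[OF smH]) (simp_all add: Hpos)
      then have "smooth_on {q<..<p + 2 * pi} C"
        by (rule smooth_on_cong) (simp add: C_def Kpos)
      then show ?thesis using 4 by (intro exI[of _ "{q<..<p + 2 * pi}"]) simp
    qed (use Up Uq in blast)+
  qed
  have Cp: "C p = 0" and Cq: "C q = 0" by (simp_all add: C_def Kp Kq)
  have CS: "C t * C t + S t * S t = 1" for t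
  proof (rule periodic_all[where Pr = "\<lambda>t. C t * C t + S t * S t = 1" and a = p])
    fix t assume t: "p \<le> t" "t < p + 2 * pi"
    consider "t = p" | "t = q" | "p < t" "t \<noteq> q" using t(1) by linarith
    then show "C t * C t + S t * S t = 1"
    proof cases
      case 3
      then have "K t \<noteq> 0" "H t > 0"
        using Kneg[of t] Kpos[of t] Hpos[of t] t by (cases "t < q"; force)+
      then have "C t * C t = H t" by (simp add: C_def sgn_if)
      then show ?thesis by (simp add: H_def)
    qed (simp_all add: Cp Cq Sp Sq)
  qed (simp add: perC perS)
  obtain \<eta> where sm\<eta>: "smooth_on UNIV \<eta>" and \<eta>p: "\<eta> p = - (pi / 2)"
    and cos\<eta>: "\<And>t. cos (\<eta> t) = C t" and sin\<eta>: "\<And>t. sin (\<eta> t) = S t"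
    using angle_of_unit_curve[OF smC smS CS, of p "- (pi / 2)"] Cp Sp by auto
  define \<nu> where "\<nu> = deriv \<eta>"
  have d\<eta>: "(\<eta> has_real_derivative \<nu> t) (at t)" for t
    unfolding \<nu>_def by (rule smooth_on_has_deriv[OF sm\<eta> UNIV_I])
  have dS\<nu>: "deriv S t = C t * \<nu> t" and dC\<nu>: "deriv C t = - S t * \<nu> t" for t
    unfolding sin\<eta>[symmetric] cos\<eta>[symmetric] using d\<eta>[of t]
    by (intro DERIV_imp_deriv; auto intro!: derivative_eq_intros)+
  have per\<nu>: "\<nu> (t + 2 * pi) = \<nu> t" for t
  proof -
    have "\<nu> s = deriv S s * C s - S s * deriv C s" for s
      unfolding dS\<nu> dC\<nu> using CS[of s] by algebra
    then show ?thesis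
      using deriv_periodic[where f = C, OF perC smC] deriv_periodic[where f = S and d = 0, OF _ smS] perS perC
      by simp
  qed
  have \<nu>pos: "\<nu> t > 0" for t
  proof (rule periodic_all[where Pr = "\<lambda>t. \<nu> t > 0" and a = p])
    fix t assume t: "p \<le> t" "t < p + 2 * pi"
    consider "t = p" | "t = q" | "p < t" "t < q" | "q < t" "t < p + 2 * pi" using t by linarith
    then show "\<nu> t > 0"
    proof cases
      case 1
      then show ?thesis using DERIV_imp_deriv[OF Up(4)] Up(3) Kp dC\<nu>[of p] by (simp add: Sp)
    next
      case 2
      then show ?thesis using DERIV_imp_deriv[OF Uq(4)] Uq(3) Kq dC\<nu>[of q] by (simp add: Sq)
    next
      case 3
      then have "C t > 0" "deriv S t > 0"
        using Kneg[of t] Hpos[of t] inc[of t] Rpos ord by (simp_all add: C_def dS)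
      then show ?thesis using dS\<nu>[of t] by (simp add: zero_less_mult_iff)
    next
      case 4
      then have "C t < 0" "deriv S t < 0"
        using Kpos[of t] Hpos[of t] dec[of t] Rpos ord by (simp_all add: C_def dS divide_neg_pos)
      then show ?thesis using dS\<nu>[of t] by (simp add: mult_less_0_iff)
    qed
  qed (simp add: per\<nu>)
  have cont\<eta>: "continuous_on T \<eta>" for T
    using smooth_on_continuous_on[OF sm\<eta>] continuous_on_subset by blast
  have mono: "\<eta> s < \<eta> t" if "s < t" for s t
    by (rule DERIV_pos_imp_increasing[OF that]) (use d\<eta> \<nu>pos in blast)
  \<comment> \<open>The angle starts at \<open>- pi / 2\<close> and increases. Since \<open>C\<close>, its cosine, vanishes within the period
    only at \<open>p\<close> and \<open>q\<close>, the angle has to be \<open>pi / 2\<close> at \<open>q\<close> and \<open>3 pi / 2\<close> at the end of the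
    period; thus it gains exactly one turn.\<close>
  have \<eta>q: "\<eta> q = pi / 2"
  proof (rule ccontr)
    assume "\<eta> q \<noteq> pi / 2"
    then consider "\<eta> q < pi / 2" | "pi / 2 < \<eta> q" by linarith
    then show False
    proof cases
      case 1
      then have "cos (\<eta> q) > 0" using mono[OF ord(1)] \<eta>p by (intro cos_gt_zero_pi) auto
      then show ?thesis by (simp add: cos\<eta> Cq)
    next
      case 2
      then obtain t where t: "p \<le> t" "t \<le> q" "\<eta> t = pi / 2"
        using IVT'[of \<eta> p "pi / 2" q] \<eta>p ord cont\<eta> by auto
      then have "p < t" "t < q" using 2 \<eta>p by (auto simp: less_le)
      then have "C t > 0" using Kneg[of t] Hpos[of t] ord by (simp add: C_def)
      then show ?thesis using cos\<eta>[of t] t by simp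
    qed
  qed
  have C2pi: "C (p + 2 * pi) = 0" using perC[of p] Cp by simp
  have \<eta>2pi: "\<eta> (p + 2 * pi) = pi / 2 + pi"
  proof (rule ccontr)
    assume "\<eta> (p + 2 * pi) \<noteq> pi / 2 + pi"
    then consider "\<eta> (p + 2 * pi) < pi / 2 + pi" | "pi / 2 + pi < \<eta> (p + 2 * pi)" by linarith
    then show False
    proof cases
      case 1
      then have "cos (\<eta> (p + 2 * pi) - pi) > 0"
        using mono[OF ord(2)] \<eta>q by (intro cos_gt_zero_pi) auto
      then show ?thesis using cos\<eta>[of "p + 2 * pi"] C2pi by (simp add: cos_diff)
    next
      case 2
      then obtain t where t: "q \<le> t" "t \<le> p + 2 * pi" "\<eta> t = pi / 2 + pi"
        using IVT'[of \<eta> q "pi / 2 + pi" "p + 2 * pi"] \<eta>q ord cont\<eta> by auto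
      then have "q < t" "t < p + 2 * pi" using 2 \<eta>q by (auto simp: less_le)
      then have "C t < 0" using Kpos[of t] Hpos[of t] ord by (simp add: C_def)
      moreover have "cos (\<eta> t) = 0"
        unfolding t(3) by (simp only: cos_periodic_pi cos_pi_half minus_zero)
      ultimately show ?thesis using cos\<eta>[of t] by simp
    qed
  qed
  have "\<eta> (t + 2 * pi) = \<eta> t + 2 * pi" for t
  proof -
    have "((\<lambda>t. \<eta> (t + 2 * pi) - \<eta> t) has_real_derivative 0) (at x)" for x
    proof -
      have "((\<lambda>x. \<eta> (x + 2 * pi)) has_real_derivative \<nu> (x + 2 * pi)) (at x)"
        using d\<eta>[of "x + 2 * pi"] by (simp only: DERIV_shift)
      then show ?thesis using d\<eta>[of x] per\<nu>[of x] by (auto intro!: derivative_eq_intros)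
    qed
    from DERIV_isconst_all[OF allI[OF this], of t p] show ?thesis by (simp add: \<eta>p \<eta>2pi)
  qed
  then have "circle_lift \<eta>"
    using sm\<eta> \<nu>pos by (simp add: circle_lift_def \<nu>_def)
  moreover have "G t = (G q + G p) / 2 + (G q - G p) / 2 * sin (\<eta> t)" for t
    unfolding sin\<eta> S_def M_def[symmetric] R_def[symmetric] using Rpos by simp
  ultimately show thesis by (rule that) (rule Ginc[OF order_refl ord(1) order_refl])
qed

lemma simple_Morse_bounds:
  assumes "simple_Morse G p q"
  shows "G p \<le> G t" "G t \<le> G q"
proof -
  obtain \<eta> where \<eta>: "\<And>t. G t = (G q + G p) / 2 + (G q - G p) / 2 * sin (\<eta> t)" and less: "G p < G q"
    by (rule simple_Morse_normal_form[OF assms]) blast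
  define R where "R = (G q - G p) / 2"
  have "0 \<le> R" using less by (simp add: R_def)
  then have "R * sin (\<eta> t) \<le> R * 1" "R * (- 1) \<le> R * sin (\<eta> t)"
    by (intro mult_left_mono sin_le_one sin_ge_minus_one; assumption)+
  moreover have "G t = (G q + G p) / 2 + R * sin (\<eta> t)" unfolding R_def by (rule \<eta>)
  moreover have "G q = (G q + G p) / 2 + R" "G p = (G q + G p) / 2 - R" by (simp_all add: R_def field_simps)
  ultimately show "G p \<le> G t" "G t \<le> G q" by linarith+
qed

lemma simple_Morse_compose:
  assumes k: "circle_lift k" and f: "simple_Morse f p q"
  shows "simple_Morse (\<lambda>t. k (f t)) p q"
proof -
  have smk: "smooth_on UNIV k" and kpos: "deriv k x > 0" for x
    using k by (simp_all add: circle_lift_def)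
  have smf: "smooth_on UNIV f" using f by (simp add: simple_Morse_def)
  have "((\<lambda>t. k (f t)) has_real_derivative deriv k (f t) * deriv f t) (at t)" for t
    by (rule DERIV_chain2[where f = k and g = f];
        rule smooth_on_has_deriv[OF _ UNIV_I]; fact smk smf)
  then have d1: "deriv (\<lambda>t. k (f t)) = (\<lambda>t. deriv k (f t) * deriv f t)"
    using DERIV_imp_deriv by blast
  have d2: "deriv (deriv (\<lambda>t. k (f t))) t = deriv k (f t) * deriv (deriv f) t" if "deriv f t = 0" for t
  proof -
    have "((\<lambda>t. deriv k (f t)) has_real_derivative deriv (deriv k) (f t) * deriv f t) (at t)"
      by (rule DERIV_chain2[where f = "deriv k" and g = f];
          rule smooth_on_has_deriv[OF _ UNIV_I]; fact smooth_on_deriv[OF smk] smf)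
    from DERIV_mult[OF this smooth_on_has_deriv[OF smooth_on_deriv[OF smf] UNIV_I, of t]]
    have "((\<lambda>t. deriv k (f t) * deriv f t) has_real_derivative deriv k (f t) * deriv (deriv f) t) (at t)"
      by (simp add: that mult.commute)
    then show ?thesis unfolding d1 by (rule DERIV_imp_deriv)
  qed
  have "smooth_on UNIV (\<lambda>t. k (f t))"
    by (rule smooth_on_compose[OF smk smf UNIV_I])
  then show ?thesis
    using f kpos d2 unfolding simple_Morse_def d1 by (simp add: mult_pos_neg)
qed

text \<open>The normal form depends only on the two critical values, so equal values give equal normal forms.\<close>

lemma simple_Morse_equivalent:
  assumes F: "simple_Morse F p q" and G: "simple_Morse G p' q'" and eq: "F p = G p'" "F q = G q'"
  obtains h where "circle_lift h" "\<And>t. G (h t) = F t"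
proof -
  obtain \<eta> where \<eta>: "circle_lift \<eta>" "\<And>t. F t = (F q + F p) / 2 + (F q - F p) / 2 * sin (\<eta> t)"
    by (rule simple_Morse_normal_form[OF F]) blast
  obtain \<theta> where \<theta>: "circle_lift \<theta>" "\<And>t. G t = (G q' + G p') / 2 + (G q' - G p') / 2 * sin (\<theta> t)"
    by (rule simple_Morse_normal_form[OF G]) blast
  have "G (inv \<theta> (\<eta> t)) = F t" for t
  proof -
    have "\<theta> (inv \<theta> (\<eta> t)) = \<eta> t" using circle_lift_bij[OF \<theta>(1)] by (simp add: bij_is_surj surj_f_inv_f)
    then show ?thesis using \<eta>(2)[of t] \<theta>(2)[of "inv \<theta> (\<eta> t)"] eq by simp
  qed
  with that[of "\<lambda>t. inv \<theta> (\<eta> t)"] circle_lift_compose[OF circle_lift_inv[OF \<theta>(1)] \<eta>(1)] show thesis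
    by blast
qed

section \<open>The angle of the folded circle and its perturbations\<close>

text \<open>The model of the folded cross-ratio: \<open>t\<close> is the parameter of an ellipse and the value is an angle on the target
circle. It runs back and forth over an arc that is symmetric about the angle \<open>\<pi>\<close>.\<close>

definition fold_angle :: "real \<Rightarrow> real \<Rightarrow> real" where
  "fold_angle \<kappa> t = pi + 2 * arcsin (\<kappa> * sin t)"

context
  fixes \<kappa> :: real
  assumes \<kappa>: "0 < \<kappa>" "\<kappa> < 1"
begin

lemma fold_angle_abs_less: "\<bar>\<kappa> * sin t\<bar> < 1"
proof -
  have "\<bar>\<kappa> * sin t\<bar> \<le> \<kappa> * 1"
    unfolding abs_mult using \<kappa> by (intro mult_mono) auto
  then show ?thesis using \<kappa> by simp
qed

lemma fold_angle_radicand: "0 < 1 - (\<kappa> * sin t)\<^sup>2" "1 - (\<kappa> * sin t)\<^sup>2 \<le> 1"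
  using fold_angle_abs_less[of t] by (simp_all add: abs_square_less_1)

lemma fold_angle_smooth: "smooth_on UNIV (fold_angle \<kappa>)"
  unfolding fold_angle_def[abs_def]
  by (intro smooth_intros open_UNIV fold_angle_abs_less)

lemma fold_angle_periodic: "fold_angle \<kappa> (t + 2 * pi) = fold_angle \<kappa> t"
  by (simp add: fold_angle_def)

lemma fold_angle_has_deriv:
  "(fold_angle \<kappa> has_real_derivative 2 * \<kappa> * cos t / sqrt (1 - (\<kappa> * sin t)\<^sup>2)) (at t)"
proof -
  have "((\<lambda>t. arcsin (\<kappa> * sin t)) has_real_derivative
      inverse (sqrt (1 - (\<kappa> * sin t)\<^sup>2)) * (\<kappa> * cos t)) (at t)"
    using fold_angle_abs_less[of t]
    by (intro DERIV_chain2[where f = arcsin and g = "\<lambda>t. \<kappa> * sin t"] DERIV_arcsin DERIV_cmult DERIV_sin) auto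
  from DERIV_add[OF DERIV_const DERIV_cmult[OF this, of 2], of pi] show ?thesis
    unfolding fold_angle_def[abs_def] by (simp add: field_simps)
qed

lemma deriv_fold_angle: "deriv (fold_angle \<kappa>) = (\<lambda>t. 2 * \<kappa> * cos t / sqrt (1 - (\<kappa> * sin t)\<^sup>2))"
  using DERIV_imp_deriv[OF fold_angle_has_deriv] by blast

lemma deriv2_fold_angle:
  "deriv (deriv (fold_angle \<kappa>)) t =
     - 2 * \<kappa> * (1 - \<kappa>\<^sup>2) * sin t / ((1 - (\<kappa> * sin t)\<^sup>2) * sqrt (1 - (\<kappa> * sin t)\<^sup>2))"
proof -
  define D where "D t = 1 - (\<kappa> * sin t)\<^sup>2" for t
  have D: "D t > 0" for t unfolding D_def by (rule fold_angle_radicand)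
  have dD: "(D has_real_derivative - 2 * \<kappa>\<^sup>2 * sin t * cos t) (at t)"
    unfolding D_def by (auto intro!: derivative_eq_intros simp: power2_eq_square)
  have "((\<lambda>t. sqrt (D t)) has_real_derivative inverse (sqrt (D t)) / 2 * (- 2 * \<kappa>\<^sup>2 * sin t * cos t)) (at t)"
    by (rule DERIV_chain2[where f = sqrt and g = D, OF DERIV_real_sqrt[OF D] dD])
  from DERIV_divide[OF DERIV_cmult[OF DERIV_cos, of "2 * \<kappa>" t] this]
  have "((\<lambda>t. 2 * \<kappa> * cos t / sqrt (D t)) has_real_derivative
     (2 * \<kappa> * - sin t * sqrt (D t) - 2 * \<kappa> * cos t * (inverse (sqrt (D t)) / 2 * (- 2 * \<kappa>\<^sup>2 * sin t * cos t)))
       / (sqrt (D t) * sqrt (D t))) (at t)" using D[of t] by simp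
  moreover have "(2 * \<kappa> * - sin t * sqrt (D t) - 2 * \<kappa> * cos t * (inverse (sqrt (D t)) / 2 * (- 2 * \<kappa>\<^sup>2 * sin t * cos t)))
       / (sqrt (D t) * sqrt (D t)) = - 2 * \<kappa> * (1 - \<kappa>\<^sup>2) * sin t / (D t * sqrt (D t))"
  proof -
    define r where "r = sqrt (D t)"
    have r: "r > 0" "r * r = D t" using D[of t] by (simp_all add: r_def)
    have "D t = 1 - \<kappa>\<^sup>2 * (1 - (cos t)\<^sup>2)" by (simp add: D_def power_mult_distrib sin_squared_eq)
    then have num: "r * r - \<kappa>\<^sup>2 * (cos t)\<^sup>2 = 1 - \<kappa>\<^sup>2" using r by (simp add: algebra_simps)
    have "(2 * \<kappa> * - sin t * r - 2 * \<kappa> * cos t * (inverse r / 2 * (- 2 * \<kappa>\<^sup>2 * sin t * cos t))) / (r * r)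
      = - 2 * \<kappa> * (r * r - \<kappa>\<^sup>2 * (cos t)\<^sup>2) * sin t / (r * r * r)"
      using r by (simp add: field_simps power2_eq_square)
    then show ?thesis unfolding r_def[symmetric] unfolding r(2)[symmetric] num .
  qed
  ultimately have "((\<lambda>t. 2 * \<kappa> * cos t / sqrt (D t)) has_real_derivative
      - 2 * \<kappa> * (1 - \<kappa>\<^sup>2) * sin t / (D t * sqrt (D t))) (at t)" by simp
  then show ?thesis unfolding deriv_fold_angle D_def by (rule DERIV_imp_deriv)
qed

lemma deriv_fold_angle_ge: "cos t \<ge> 1 / 2 \<Longrightarrow> deriv (fold_angle \<kappa>) t \<ge> \<kappa>"
  and deriv_fold_angle_le: "cos t \<le> - 1 / 2 \<Longrightarrow> deriv (fold_angle \<kappa>) t \<le> - \<kappa>"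
  and deriv_fold_angle_abs_le: "\<bar>deriv (fold_angle \<kappa>) t\<bar> \<le> 2"
proof -
  define r where "r = sqrt (1 - (\<kappa> * sin t)\<^sup>2)"
  have r: "0 < r" "r \<le> 1" using fold_angle_radicand[of t] by (simp_all add: r_def)
  have d: "deriv (fold_angle \<kappa>) t = 2 * \<kappa> * cos t / r" by (simp add: deriv_fold_angle r_def)
  have r1: "\<kappa> * r \<le> \<kappa> * 1" using r \<kappa> by (intro mult_left_mono) auto
  show "deriv (fold_angle \<kappa>) t \<ge> \<kappa>" if "cos t \<ge> 1 / 2"
  proof -
    have "\<kappa> * 1 \<le> \<kappa> * (2 * cos t)" using that \<kappa> by (intro mult_left_mono) auto
    then show ?thesis unfolding d using r r1 by (simp add: pos_le_divide_eq)
  qed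
  show "deriv (fold_angle \<kappa>) t \<le> - \<kappa>" if "cos t \<le> - 1 / 2"
  proof -
    have "\<kappa> * (2 * cos t) \<le> \<kappa> * (- 1)" using that \<kappa> by (intro mult_left_mono) auto
    then show ?thesis unfolding d using r r1 by (simp add: pos_divide_le_eq)
  qed
  have "\<kappa>\<^sup>2 \<le> 1" using \<kappa> by (simp add: power_le_one)
  then have "(\<kappa> * cos t)\<^sup>2 \<le> 1 - (\<kappa> * sin t)\<^sup>2"
    by (simp add: cos_squared_eq power_mult_distrib algebra_simps)
  then have "\<bar>\<kappa> * cos t\<bar> \<le> r" unfolding r_def by (intro real_le_rsqrt) simp
  then show "\<bar>deriv (fold_angle \<kappa>) t\<bar> \<le> 2"
    unfolding d using r \<kappa> by (simp add: abs_mult pos_divide_le_eq)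
qed

lemma deriv2_fold_angle_le: "sin t \<ge> 1 / 2 \<Longrightarrow> deriv (deriv (fold_angle \<kappa>)) t \<le> - (\<kappa> * (1 - \<kappa>\<^sup>2))"
  and deriv2_fold_angle_ge: "sin t \<le> - 1 / 2 \<Longrightarrow> deriv (deriv (fold_angle \<kappa>)) t \<ge> \<kappa> * (1 - \<kappa>\<^sup>2)"
proof -
  define D where "D = 1 - (\<kappa> * sin t)\<^sup>2"
  define c where "c = \<kappa> * (1 - \<kappa>\<^sup>2)"
  have D: "0 < D" "D \<le> 1" using fold_angle_radicand[of t] by (simp_all add: D_def)
  have "\<kappa>\<^sup>2 < 1" using \<kappa> by (simp add: power_less_one_iff)
  then have c: "c > 0" using \<kappa> by (simp add: c_def)
  have Q: "0 < D * sqrt D" "D * sqrt D \<le> 1" using D mult_le_one[of D "sqrt D"] by auto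
  have d: "deriv (deriv (fold_angle \<kappa>)) t = c * (- 2 * sin t) / (D * sqrt D)"
    unfolding deriv2_fold_angle D_def c_def by (simp add: algebra_simps)
  have cQ: "c * (D * sqrt D) \<le> c * 1" using Q c by (intro mult_left_mono) auto
  show "deriv (deriv (fold_angle \<kappa>)) t \<le> - (\<kappa> * (1 - \<kappa>\<^sup>2))" if "sin t \<ge> 1 / 2"
  proof -
    have "c * (- 2 * sin t) \<le> c * (- 1)" using that c by (intro mult_left_mono) auto
    then show ?thesis unfolding d c_def[symmetric] pos_divide_le_eq[OF Q(1)] using cQ by linarith
  qed
  show "deriv (deriv (fold_angle \<kappa>)) t \<ge> \<kappa> * (1 - \<kappa>\<^sup>2)" if "sin t \<le> - 1 / 2"
  proof -
    have "c * 1 \<le> c * (- 2 * sin t)" using that c by (intro mult_left_mono) auto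
    then show ?thesis unfolding d c_def[symmetric] pos_le_divide_eq[OF Q(1)] using cQ by linarith
  qed
qed

lemma fold_angle_simple_Morse: "simple_Morse (fold_angle \<kappa>) (- (pi / 2)) (pi / 2)"
proof -
  have e: "0 < \<kappa> * (1 - \<kappa>\<^sup>2)" using \<kappa> by (simp add: power_less_one_iff)
  have "deriv (fold_angle \<kappa>) t > 0" if "- (pi / 2) < t" "t < pi / 2" for t
    using cos_gt_zero_pi[of t] that \<kappa> fold_angle_radicand[of t] by (simp add: deriv_fold_angle)
  moreover have "deriv (fold_angle \<kappa>) t < 0" if "pi / 2 < t" "t < - (pi / 2) + 2 * pi" for t
  proof -
    have "cos t < 0"
      using cos_gt_zero_pi[of "t - pi"] that by (simp add: cos_diff)
    then show ?thesis using \<kappa> fold_angle_radicand[of t]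
      by (simp add: deriv_fold_angle divide_neg_pos mult_pos_neg)
  qed
  moreover have "deriv (fold_angle \<kappa>) (- (pi / 2)) = 0" "deriv (fold_angle \<kappa>) (pi / 2) = 0"
    by (simp_all add: deriv_fold_angle)
  moreover have "0 < deriv (deriv (fold_angle \<kappa>)) (- (pi / 2))" "deriv (deriv (fold_angle \<kappa>)) (pi / 2) < 0"
    using deriv2_fold_angle_ge[of "- (pi / 2)"] deriv2_fold_angle_le[of "pi / 2"] e by simp_all
  moreover have "- (pi / 2) < pi / 2" "pi / 2 < - (pi / 2) + 2 * pi" using pi_gt_zero by linarith+
  ultimately show ?thesis
    unfolding simple_Morse_def using fold_angle_smooth fold_angle_periodic by blast
qed

text \<open>The points \<open>\<plusminus>\<pi>/3\<close> and \<open>\<plusminus>2\<pi>/3\<close> cut the period into four arcs. On two of them the first derivative is at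
least \<open>\<kappa>\<close> in absolute value, on the other two the second derivative is at least \<open>\<kappa> (1 - \<kappa>\<^sup>2)\<close>. A
perturbation below the smaller bound keeps these signs, and so the shape of the graph.\<close>

lemma fold_angle_perturbation_Morse:
  assumes sm: "smooth_on UNIV g" and per: "\<And>t. g (t + 2 * pi) = g t"
    and c1: "\<And>t. \<bar>deriv g t - deriv (fold_angle \<kappa>) t\<bar> < \<kappa> * (1 - \<kappa>\<^sup>2)"
    and c2: "\<And>t. \<bar>deriv (deriv g) t - deriv (deriv (fold_angle \<kappa>)) t\<bar> < \<kappa> * (1 - \<kappa>\<^sup>2)"
  obtains p q where "simple_Morse g p q"
proof -
  have e: "\<kappa> * (1 - \<kappa>\<^sup>2) \<le> \<kappa>" using \<kappa> by (simp add: algebra_simps)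
  have cos60: "cos x \<ge> 1 / 2" if "\<bar>x\<bar> \<le> pi / 3" for x
  proof -
    have "cos \<bar>x\<bar> \<ge> cos (pi / 3)" using that pi_gt_zero by (intro cos_monotone_0_pi_le) linarith+
    then show ?thesis by (simp add: cos_60)
  qed
  have pos: "deriv g t > 0" if "- (pi / 3) \<le> t" "t \<le> pi / 3" for t
    using deriv_fold_angle_ge[OF cos60[of t]] c1[of t] e that by linarith
  have neg: "deriv g t < 0" if "2 * pi / 3 \<le> t" "t \<le> 4 * pi / 3" for t
  proof -
    have "\<bar>t - pi\<bar> \<le> pi / 3" using that by linarith
    from cos60[OF this] have "cos t \<le> - 1 / 2" by (simp add: cos_diff)
    from deriv_fold_angle_le[OF this] c1[of t] e show ?thesis by linarith
  qed
  have neg2: "deriv (deriv g) t < 0" if "pi / 3 \<le> t" "t \<le> 2 * pi / 3" for t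
  proof -
    have "\<bar>t - pi / 2\<bar> \<le> pi / 3" using that by linarith
    from cos60[OF this] have "sin t \<ge> 1 / 2" by (simp add: cos_diff)
    from deriv2_fold_angle_le[OF this] c2[of t] show ?thesis by linarith
  qed
  have pos2: "deriv (deriv g) t > 0" if "- (2 * pi / 3) \<le> t" "t \<le> - (pi / 3)" for t
  proof -
    have "\<bar>t + pi / 2\<bar> \<le> pi / 3" using that by linarith
    from cos60[OF this] have "sin t \<le> - 1 / 2" by (simp add: cos_add)
    from deriv2_fold_angle_ge[OF this] c2[of t] show ?thesis by linarith
  qed
  have perd: "deriv g (t + 2 * pi) = deriv g t" for t
    using deriv_periodic[where f = g and d = 0] per sm by simp
  have smd: "smooth_on UNIV (deriv g)" by (rule smooth_on_deriv[OF sm])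
  have cont: "continuous_on T (deriv g)" for T
    using smooth_on_continuous_on[OF smd] continuous_on_subset by blast
  have dd: "(deriv g has_real_derivative deriv (deriv g) t) (at t)" for t
    by (rule smooth_on_has_deriv[OF smd UNIV_I])
  have decr: "deriv g t < deriv g s" if "pi / 3 \<le> s" "s < t" "t \<le> 2 * pi / 3" for s t
  proof (rule DERIV_neg_imp_decreasing[OF that(2)])
    fix x assume "s \<le> x" "x \<le> t"
    with that dd[of x] neg2[of x]
    show "\<exists>y. (deriv g has_real_derivative y) (at x) \<and> y < 0"
      by (intro exI[of _ "deriv (deriv g) x"] conjI) linarith+
  qed
  have incr: "deriv g s < deriv g t" if "- (2 * pi / 3) \<le> s" "s < t" "t \<le> - (pi / 3)" for s t
  proof (rule DERIV_pos_imp_increasing[OF that(2)])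
    fix x assume "s \<le> x" "x \<le> t"
    with that dd[of x] pos2[of x]
    show "\<exists>y. (deriv g has_real_derivative y) (at x) \<and> 0 < y"
      by (intro exI[of _ "deriv (deriv g) x"] conjI) linarith+
  qed
  have ends: "deriv g (pi / 3) > 0" "deriv g (2 * pi / 3) < 0" "deriv g (- (pi / 3)) > 0"
    "deriv g (- (2 * pi / 3)) < 0"
    using pos[of "pi / 3"] neg[of "2 * pi / 3"] pos[of "- (pi / 3)"] neg[of "- (2 * pi / 3) + 2 * pi"]
      perd[of "- (2 * pi / 3)"] pi_gt_zero by simp_all
  obtain q where q: "pi / 3 \<le> q" "q \<le> 2 * pi / 3" "deriv g q = 0"
    using IVT2'[of "deriv g" "2 * pi / 3" 0 "pi / 3"] ends cont pi_gt_zero by auto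
  obtain p where p: "- (2 * pi / 3) \<le> p" "p \<le> - (pi / 3)" "deriv g p = 0"
    using IVT'[of "deriv g" "- (2 * pi / 3)" 0 "- (pi / 3)"] ends cont pi_gt_zero by auto
  have "deriv g t > 0" if "p < t" "t < q" for t
  proof -
    consider "t \<le> - (pi / 3)" | "- (pi / 3) \<le> t" "t \<le> pi / 3" | "pi / 3 \<le> t" by linarith
    then show ?thesis
      using incr[of p t] decr[of t q] pos[of t] p q that by cases simp_all
  qed
  moreover have "deriv g t < 0" if "q < t" "t < p + 2 * pi" for t
  proof -
    consider "t \<le> 2 * pi / 3" | "2 * pi / 3 \<le> t" "t \<le> 4 * pi / 3" | "4 * pi / 3 \<le> t" by linarith
    then show ?thesis
    proof cases
      case 1
      then show ?thesis using decr[of q t] q that by simp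
    next
      case 2
      then show ?thesis by (rule neg)
    next
      case 3
      then have "deriv g (t - 2 * pi) < deriv g p" using p that by (intro incr) linarith+
      then show ?thesis using perd[of "t - 2 * pi"] p by simp
    qed
  qed
  moreover have "deriv (deriv g) q < 0" "0 < deriv (deriv g) p"
    using neg2[OF q(1,2)] pos2[OF p(1,2)] .
  moreover have "p < q" "q < p + 2 * pi" using p(1,2) q(1,2) pi_gt_zero by linarith+
  ultimately have "simple_Morse g p q"
    unfolding simple_Morse_def using sm per p(3) q(3) by blast
  then show thesis by (rule that)
qed

text \<open>A perturbation \<open>g\<close> may move the two critical values. A diffeomorphism of the target of the form
  \<open>x \<mapsto> x + A + B sin x\<close> carries the old ones to the new ones: its two parameters solve the two equations, and
  smallness of the perturbation gives \<open>\<bar>B\<bar> < 1\<close>. Then both functions have the same normal form.\<close>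

lemma fold_angle_perturbation:
  assumes sm: "smooth_on UNIV g" and per: "\<And>t. g (t + 2 * pi) = g t"
    and c0: "\<And>t. \<bar>g t - fold_angle \<kappa> t\<bar> < \<kappa> * (1 - \<kappa>\<^sup>2)"
    and c1: "\<And>t. \<bar>deriv g t - deriv (fold_angle \<kappa>) t\<bar> < \<kappa> * (1 - \<kappa>\<^sup>2)"
    and c2: "\<And>t. \<bar>deriv (deriv g) t - deriv (deriv (fold_angle \<kappa>)) t\<bar> < \<kappa> * (1 - \<kappa>\<^sup>2)"
  obtains h k where "circle_lift h" "circle_lift k" "\<And>t. g (h t) = k (fold_angle \<kappa> t)"
proof -
  obtain p q where pq: "simple_Morse g p q"
    by (rule fold_angle_perturbation_Morse[OF sm per c1 c2])
  define e where "e = \<kappa> * (1 - \<kappa>\<^sup>2)"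
  define \<mu> where "\<mu> = 2 * arcsin \<kappa>"
  have fmax: "fold_angle \<kappa> (pi / 2) = pi + \<mu>" and fmin: "fold_angle \<kappa> (- (pi / 2)) = pi - \<mu>"
    using \<kappa> by (simp_all add: fold_angle_def \<mu>_def arcsin_minus)
  have gq: "\<bar>g q - (pi + \<mu>)\<bar> < e" and gp: "\<bar>g p - (pi - \<mu>)\<bar> < e"
    using simple_Morse_bounds(2)[OF pq, of "pi / 2"] simple_Morse_bounds(2)[OF fold_angle_simple_Morse, of q]
      simple_Morse_bounds(1)[OF pq, of "- (pi / 2)"] simple_Morse_bounds(1)[OF fold_angle_simple_Morse, of p]
      c0[of "pi / 2"] c0[of "- (pi / 2)"] c0[of p] c0[of q] unfolding fmax fmin e_def[symmetric] by linarith+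
  have sin\<mu>: "sin \<mu> \<ge> e"
  proof -
    have k2: "0 < 1 - \<kappa>\<^sup>2" "1 - \<kappa>\<^sup>2 < 1" using \<kappa> by (simp_all add: power_less_one_iff)
    have "sin \<mu> = 2 * \<kappa> * sqrt (1 - \<kappa>\<^sup>2)"
      using \<kappa> by (simp add: \<mu>_def sin_double cos_arcsin)
    moreover have "1 - \<kappa>\<^sup>2 \<le> sqrt (1 - \<kappa>\<^sup>2)"
      using k2 power_le_one[of "1 - \<kappa>\<^sup>2" 1]
      by (intro real_le_rsqrt) (simp add: power2_eq_square mult_left_le)
    then have "\<kappa> * (1 - \<kappa>\<^sup>2) \<le> \<kappa> * sqrt (1 - \<kappa>\<^sup>2)" using \<kappa> by (intro mult_left_mono) auto
    moreover have "0 \<le> \<kappa> * sqrt (1 - \<kappa>\<^sup>2)" using \<kappa> k2 by simp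
    ultimately show ?thesis unfolding e_def by linarith
  qed
  have epos: "e > 0" using \<kappa> by (simp add: e_def power_less_one_iff)
  define B where "B = (g p - g q + 2 * \<mu>) / (2 * sin \<mu>)"
  define A where "A = (g p + g q) / 2 - pi"
  define k where "k x = x + A + B * sin x" for x
  have Bs: "B * sin \<mu> = (g p - g q + 2 * \<mu>) / 2" using sin\<mu> epos by (simp add: B_def)
  have "\<bar>B\<bar> < 1"
  proof -
    have "\<bar>g p - g q + 2 * \<mu>\<bar> < 2 * sin \<mu>" using gp gq sin\<mu> by linarith
    then show ?thesis using sin\<mu> epos by (simp add: B_def)
  qed
  have kd: "(k has_real_derivative 1 + B * cos x) (at x)" for x
    unfolding k_def by (auto intro!: derivative_eq_intros)
  have "1 + B * cos x > 0" for x
  proof -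
    have "\<bar>B * cos x\<bar> \<le> \<bar>B\<bar> * 1" unfolding abs_mult by (intro mult_left_mono) auto
    then show ?thesis using \<open>\<bar>B\<bar> < 1\<close> by linarith
  qed
  moreover have "smooth_on UNIV k" unfolding k_def by (intro smooth_intros open_UNIV)
  moreover have "k (x + 2 * pi) = k x + 2 * pi" for x by (simp add: k_def)
  ultimately have k: "circle_lift k"
    using DERIV_imp_deriv[OF kd] by (simp add: circle_lift_def)
  have "k (pi - \<mu>) = g p" "k (pi + \<mu>) = g q"
    using Bs by (simp_all add: k_def A_def field_simps)
  then obtain h where "circle_lift h" "\<And>t. g (h t) = k (fold_angle \<kappa> t)"
    using simple_Morse_equivalent[OF simple_Morse_compose[OF k fold_angle_simple_Morse] pq]
    unfolding fmax fmin by blast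
  with that k show thesis by blast
qed

end

section \<open>Atlases and lifts to circle parametrisations\<close>

text \<open>What the argument uses of a smooth structure: charts are injective with open image, and each transition
function is defined and smooth near the coordinate of every common point.\<close>

definition compatible_atlas :: "'a atlas \<Rightarrow> bool" where
  "compatible_atlas A \<longleftrightarrow> (\<forall>U \<phi>. (U, \<phi>) \<in> A \<longrightarrow> inj_on \<phi> U \<and> open (\<phi> ` U)) \<and>
     (\<forall>U \<phi> V \<psi> p. (U, \<phi>) \<in> A \<and> (V, \<psi>) \<in> A \<and> p \<in> U \<and> p \<in> V \<longrightarrow>
        (\<exists>I. \<phi> p \<in> I \<and> I \<subseteq> \<phi> ` (U \<inter> V) \<and> smooth_on I (\<psi> \<circ> inv_into U \<phi>)))"

text \<open>Parametrisations of a component by the angle on a circle. Their local inverses have to be charts on all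
arcs of at most half a turn; short arcs are needed to map one chart domain into another.\<close>

definition circle_param :: "'a atlas \<Rightarrow> (real \<Rightarrow> 'a) \<Rightarrow> bool" where
  "circle_param A u \<longleftrightarrow> (\<forall>s t. u s = u t \<longleftrightarrow> cis s = cis t) \<and>
     (\<forall>t d. 0 < d \<longrightarrow> d \<le> pi / 2 \<longrightarrow> (u ` ball t d, inv_into (ball t d) u) \<in> A)"

definition circle_cover :: "'a atlas \<Rightarrow> (real \<Rightarrow> 'a) set \<Rightarrow> bool" where
  "circle_cover A P \<longleftrightarrow> (\<forall>u\<in>P. circle_param A u) \<and> carrier A = (\<Union>u\<in>P. range u) \<and>
     (\<forall>u\<in>P. \<forall>v\<in>P. u \<noteq> v \<longrightarrow> range u \<inter> range v = {})"

lemma cis_eq_iff: "cis s = cis t \<longleftrightarrow> (\<exists>n::int. s = t + 2 * pi * of_int n)"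
  using sin_cos_eq_iff[of s t] by (auto simp: complex_eq_iff cis.ctr)

lemma cis_eq_near:
  assumes "cis s = cis t" "\<bar>s - t\<bar> < 2 * pi" shows "s = t"
proof -
  obtain n :: int where n: "s = t + 2 * pi * of_int n" using assms(1) unfolding cis_eq_iff by blast
  have "\<bar>2 * pi * of_int n\<bar> < 2 * pi * 1" using assms(2) n by simp
  then have "\<bar>of_int n\<bar> < (1::real)" unfolding abs_mult by simp
  then have "n = 0" by linarith
  then show ?thesis using n by simp
qed

lemma circle_param_eq: "circle_param A u \<Longrightarrow> u s = u t \<longleftrightarrow> cis s = cis t"
  by (simp add: circle_param_def)

lemma circle_param_chart:
  "circle_param A u \<Longrightarrow> 0 < d \<Longrightarrow> d \<le> pi / 2 \<Longrightarrow> (u ` ball t d, inv_into (ball t d) u) \<in> A"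
  by (simp add: circle_param_def)

lemma circle_param_in_carrier: "circle_param A u \<Longrightarrow> u t \<in> carrier A"
  using circle_param_chart[of A u 1 t] pi_ge_two
  by (auto simp: carrier_def intro!: bexI[of _ "(u ` ball t 1, inv_into (ball t 1) u)"])

lemma circle_param_inj:
  assumes "circle_param A u" "d \<le> pi / 2" shows "inj_on u (ball t d)"
proof (rule inj_onI)
  fix x y assume xy: "x \<in> ball t d" "y \<in> ball t d" "u x = u y"
  have "\<bar>x - y\<bar> < 2 * pi" using xy(1,2) assms(2) pi_gt_zero unfolding mem_ball dist_real_def by linarith
  then show "x = y" using xy(3) circle_param_eq[OF assms(1)] cis_eq_near by blast
qed

lemma circle_param_inverse:
  assumes "circle_param A u" "d \<le> pi / 2" "s \<in> ball t d"
  shows "inv_into (ball t d) u (u s) = s"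
    and "inv_into (u ` ball t d) (inv_into (ball t d) u) s = u s"
proof -
  show *: "inv_into (ball t d) u (u s) = s"
    using circle_param_inj[OF assms(1,2)] assms(3) by (rule inv_into_f_f)
  have "inj_on (inv_into (ball t d) u) (u ` ball t d)"
    by (rule inj_on_inv_into) simp
  from inv_into_f_f[OF this, of "u s"] * assms(3)
  show "inv_into (u ` ball t d) (inv_into (ball t d) u) s = u s" by simp
qed

lemma circle_param_coordinate_image:
  assumes "circle_param A u" "d \<le> pi / 2" "K \<subseteq> ball t d"
  shows "inv_into (ball t d) u ` u ` K = K"
proof -
  have "inv_into (ball t d) u (u s) = s" if "s \<in> K" for s
    using circle_param_inverse(1)[OF assms(1,2)] that assms(3) by blast
  then show ?thesis by (auto simp: image_image)
qed

lemma circle_param_shift: "circle_param A u \<Longrightarrow> u (t + 2 * pi * of_int n) = u t"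
  using circle_param_eq[of A u] cis_eq_iff by blast

lemma chart_inverse:
  assumes "compatible_atlas A" "(U, \<phi>) \<in> A" "p \<in> U"
  shows "inv_into U \<phi> (\<phi> p) = p"
  using assms unfolding compatible_atlas_def by (intro inv_into_f_f) blast+

lemma transition:
  assumes "compatible_atlas A" "(U, \<phi>) \<in> A" "(V, \<psi>) \<in> A" "p \<in> U" "p \<in> V"
  obtains I where "\<phi> p \<in> I" "I \<subseteq> \<phi> ` (U \<inter> V)" "smooth_on I (\<psi> \<circ> inv_into U \<phi>)"
proof -
  have "\<exists>I. \<phi> p \<in> I \<and> I \<subseteq> \<phi> ` (U \<inter> V) \<and> smooth_on I (\<psi> \<circ> inv_into U \<phi>)"
    using assms(1)[unfolded compatible_atlas_def, THEN conjunct2] assms(2-5) by simp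
  then show thesis using that by blast
qed

text \<open>On a short arc the parametrisation is the inverse of a chart, so this is smoothness of a transition function.\<close>

lemma chart_along_circle_param:
  assumes "compatible_atlas A" "circle_param A u" "(U, \<phi>) \<in> A" "u t \<in> U"
  obtains I where "t \<in> I" "u ` I \<subseteq> U" "smooth_on I (\<lambda>s. \<phi> (u s))"
proof -
  have one: "1 \<le> pi / 2" using pi_ge_two by simp
  note inv = circle_param_inverse[OF assms(2) one]
  have t: "t \<in> ball t 1" by simp
  obtain I where I: "inv_into (ball t 1) u (u t) \<in> I"
    "I \<subseteq> inv_into (ball t 1) u ` (u ` ball t 1 \<inter> U)"
    "smooth_on I (\<phi> \<circ> inv_into (u ` ball t 1) (inv_into (ball t 1) u))"
    using transition[OF assms(1) circle_param_chart[OF assms(2) zero_less_one one] assms(3) _ assms(4)] t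
    by blast
  have s: "s \<in> ball t 1 \<and> u s \<in> U" if s: "s \<in> I" for s
  proof -
    obtain r where "r \<in> ball t 1" "u r \<in> U" "s = inv_into (ball t 1) u (u r)" using I(2) s by blast
    then show ?thesis using inv(1) by simp
  qed
  have "smooth_on I (\<lambda>s. \<phi> (u s))"
    by (rule smooth_on_cong[OF I(3)]) (use s inv(2) in auto)
  then show thesis using that[of I] I(1) s inv(1)[OF t] by auto
qed

definition smooth_lift :: "'a atlas \<Rightarrow> 'b atlas \<Rightarrow> (real \<Rightarrow> 'a) \<Rightarrow> (real \<Rightarrow> 'b) \<Rightarrow> ('a \<Rightarrow> 'b) \<Rightarrow> (real \<Rightarrow> real) \<Rightarrow> bool" where
  "smooth_lift A B u w f F \<longleftrightarrow>
     circle_param A u \<and> circle_param B w \<and> smooth_on UNIV F \<and> (\<forall>t. f (u t) = w (F t))"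

lemma local_rep_circle_param:
  assumes "circle_param A u" "d \<le> pi / 2" "s \<in> ball t d"
  shows "local_rep (u ` ball t d) (inv_into (ball t d) u) \<psi> f s = \<psi> (f (u s))"
  using circle_param_inverse(2)[OF assms] by (simp add: local_rep_def)

lemma local_rep_smooth_lift:
  assumes "smooth_lift A B u w f F" "d \<le> pi / 2" "s \<in> ball t d" "e \<le> pi / 2" "F s \<in> ball x e"
  shows "local_rep (u ` ball t d) (inv_into (ball t d) u) (inv_into (ball x e) w) f s = F s"
proof -
  have u: "circle_param A u" and w: "circle_param B w" and fu: "f (u s) = w (F s)"
    using assms(1) by (simp_all add: smooth_lift_def)
  show ?thesis
    unfolding local_rep_circle_param[OF u assms(2,3)] fu by (rule circle_param_inverse(1)[OF w assms(4,5)])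
qed

lemma smooth_lift_charts:
  assumes "smooth_lift A B u w f F"
  obtains U \<phi> V \<psi> where "(U, \<phi>) \<in> A" "(V, \<psi>) \<in> B" "u t \<in> U" "f ` U \<subseteq> V" "open (\<phi> ` U)"
    "\<phi> (u t) = t" "\<And>s. s \<in> \<phi> ` U \<Longrightarrow> local_rep U \<phi> \<psi> f s = F s"
proof -
  have u: "circle_param A u" and w: "circle_param B w" and F: "smooth_on UNIV F"
    and fu: "\<And>t. f (u t) = w (F t)" using assms by (simp_all add: smooth_lift_def)
  have one: "1 \<le> pi / 2" using pi_ge_two by simp
  have "isCont F t"
    using smooth_on_continuous_on[OF F] by (simp add: continuous_on_eq_continuous_at)
  then obtain d0 where d0: "d0 > 0" "\<And>s. dist s t < d0 \<Longrightarrow> dist (F s) (F t) < 1"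
    unfolding continuous_at_eps_delta by (metis zero_less_one)
  define d where "d = min d0 1"
  have d: "0 < d" "d \<le> pi / 2" using d0(1) one by (auto simp: d_def)
  have Fb: "F s \<in> ball (F t) 1" if "s \<in> ball t d" for s
    using d0(2)[of s] that by (simp add: d_def dist_commute)
  have image: "inv_into (ball t d) u ` u ` ball t d = ball t d"
    by (rule circle_param_coordinate_image[OF u d(2) subset_refl])
  show thesis
  proof (rule that)
    show "(u ` ball t d, inv_into (ball t d) u) \<in> A" by (rule circle_param_chart[OF u d])
    show "(w ` ball (F t) 1, inv_into (ball (F t) 1) w) \<in> B"
      by (rule circle_param_chart[OF w zero_less_one one])
    show "f ` (u ` ball t d) \<subseteq> w ` ball (F t) 1" using Fb fu by auto
    show "local_rep (u ` ball t d) (inv_into (ball t d) u) (inv_into (ball (F t) 1) w) f s = F s"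
      if "s \<in> inv_into (ball t d) u ` u ` ball t d" for s
      using local_rep_smooth_lift[OF assms d(2) _ one Fb] that unfolding image by blast
  qed (use circle_param_inverse(1)[OF u d(2), of t] d(1) in \<open>simp_all add: image\<close>)
qed

text \<open>On a sufficiently short arc, the representation of \<open>f\<close> in the charts given by \<open>u\<close> and \<open>w\<close> is the lift itself.\<close>

lemma smooth_map_from_lifts:
  assumes "\<And>p. p \<in> carrier A \<Longrightarrow> \<exists>u w F t. smooth_lift A B u w f F \<and> p = u t"
  shows "smooth_map A B f"
  unfolding smooth_map_def
proof
  fix p assume "p \<in> carrier A"
  then obtain u w F t where l: "smooth_lift A B u w f F" and p: "p = u t" using assms by blast
  obtain U \<phi> V \<psi> where ch: "(U, \<phi>) \<in> A" "(V, \<psi>) \<in> B" "u t \<in> U" "f ` U \<subseteq> V" "open (\<phi> ` U)"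
    "\<And>s. s \<in> \<phi> ` U \<Longrightarrow> local_rep U \<phi> \<psi> f s = F s"
    using smooth_lift_charts[OF l, of t] by metis
  have "smooth_on UNIV F" using l by (simp add: smooth_lift_def)
  then have "smooth_on (\<phi> ` U) F" using ch(5) by (rule smooth_on_subset[OF _ subset_UNIV])
  then have "smooth_on (\<phi> ` U) (local_rep U \<phi> \<psi> f)" by (rule smooth_on_cong) (simp add: ch(6))
  then show "\<exists>(U, \<phi>)\<in>A. \<exists>(V, \<psi>)\<in>B. p \<in> U \<and> f ` U \<subseteq> V \<and> smooth_on (\<phi> ` U) (local_rep U \<phi> \<psi> f)"
    using ch(3,4) p by (intro bexI[OF _ ch(1)] case_prodI bexI[OF _ ch(2)]) simp
qed

lemma smooth_map_charts:
  assumes "smooth_map A B f" "p \<in> carrier A"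
  obtains U \<phi> V \<psi> where "(U, \<phi>) \<in> A" "(V, \<psi>) \<in> B" "p \<in> U" "f ` U \<subseteq> V"
    "smooth_on (\<phi> ` U) (local_rep U \<phi> \<psi> f)"
  using assms unfolding smooth_map_def by blast

text \<open>In any charts a map read along \<open>u\<close> and \<open>w\<close> factors, near a given parameter, through its
  representation in those charts and two transition functions.\<close>

lemma local_rep_factorization:
  assumes A: "compatible_atlas A" and B: "compatible_atlas B"
    and u: "circle_param A u" and w: "circle_param B w"
    and U: "(U, \<phi>) \<in> A" "u t \<in> U" and V: "(V, \<psi>) \<in> B" "f ` U \<subseteq> V"
    and e: "0 < e" "e \<le> pi / 2" and x: "f (u t) \<in> w ` ball x e"
  obtains I J \<tau> where "t \<in> I" "u ` I \<subseteq> U" "smooth_on I (\<lambda>s. \<phi> (u s))"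
    "local_rep U \<phi> \<psi> f (\<phi> (u t)) \<in> J" "smooth_on J \<tau>"
    "\<And>s. s \<in> I \<Longrightarrow> local_rep U \<phi> \<psi> f (\<phi> (u s)) = \<psi> (f (u s))"
    "\<And>s. s \<in> I \<Longrightarrow> \<psi> (f (u s)) \<in> J \<Longrightarrow>
        f (u s) \<in> w ` ball x e \<and> \<tau> (\<psi> (f (u s))) = inv_into (ball x e) w (f (u s))"
proof -
  obtain I where I: "t \<in> I" "u ` I \<subseteq> U" "smooth_on I (\<lambda>s. \<phi> (u s))"
    by (rule chart_along_circle_param[OF A u U])
  have fV: "f (u s) \<in> V" if "s \<in> I" for s using that I(2) V(2) by blast
  obtain J where J: "\<psi> (f (u t)) \<in> J" "J \<subseteq> \<psi> ` (V \<inter> w ` ball x e)"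
    "smooth_on J (inv_into (ball x e) w \<circ> inv_into V \<psi>)"
    by (rule transition[OF B V(1) circle_param_chart[OF w e] fV[OF I(1)] x])
  have rep: "local_rep U \<phi> \<psi> f (\<phi> (u s)) = \<psi> (f (u s))" if "s \<in> I" for s
    using chart_inverse[OF A U(1), of "u s"] I(2) that by (auto simp: local_rep_def)
  have val: "f (u s) \<in> w ` ball x e \<and> (inv_into (ball x e) w \<circ> inv_into V \<psi>) (\<psi> (f (u s)))
      = inv_into (ball x e) w (f (u s))" if s: "s \<in> I" "\<psi> (f (u s)) \<in> J" for s
  proof -
    obtain q where q: "q \<in> V" "q \<in> w ` ball x e" "\<psi> (f (u s)) = \<psi> q" using J(2) s(2) by blast
    have "q = f (u s)"
      using chart_inverse[OF B V(1) q(1)] chart_inverse[OF B V(1) fV[OF s(1)]] q(3) by simp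
    then show ?thesis using q(2) chart_inverse[OF B V(1) fV[OF s(1)]] by simp
  qed
  show thesis
    by (rule that[OF I _ J(3) rep val]) (use J(1) rep[OF I(1)] in auto)
qed

lemma smooth_map_along_circle_params:
  assumes A: "compatible_atlas A" and B: "compatible_atlas B" and g: "smooth_map A B g"
    and u: "circle_param A u" and w: "circle_param B w"
    and e: "0 < e" "e \<le> pi / 2" and x: "g (u t) \<in> w ` ball x e"
  obtains I where "t \<in> I" "smooth_on I (\<lambda>s. inv_into (ball x e) w (g (u s)))"
proof -
  obtain U \<phi> V \<psi> where ch: "(U, \<phi>) \<in> A" "(V, \<psi>) \<in> B" "u t \<in> U" "g ` U \<subseteq> V"
    and sm: "smooth_on (\<phi> ` U) (local_rep U \<phi> \<psi> g)"
    by (rule smooth_map_charts[OF g circle_param_in_carrier[OF u]])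
  obtain I J \<tau> where I: "t \<in> I" "u ` I \<subseteq> U" "smooth_on I (\<lambda>s. \<phi> (u s))"
    and J: "local_rep U \<phi> \<psi> g (\<phi> (u t)) \<in> J" "smooth_on J \<tau>"
    and rep: "\<And>s. s \<in> I \<Longrightarrow> local_rep U \<phi> \<psi> g (\<phi> (u s)) = \<psi> (g (u s))"
    and val: "\<And>s. s \<in> I \<Longrightarrow> \<psi> (g (u s)) \<in> J \<Longrightarrow>
        g (u s) \<in> w ` ball x e \<and> \<tau> (\<psi> (g (u s))) = inv_into (ball x e) w (g (u s))"
    by (rule local_rep_factorization[OF A B u w ch(1,3,2,4) e x]) blast
  have smI: "smooth_on I (\<lambda>s. local_rep U \<phi> \<psi> g (\<phi> (u s)))"
    by (rule smooth_on_compose[OF sm I(3)]) (use I(2) in blast)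
  define I' where "I' = I \<inter> (\<lambda>s. local_rep U \<phi> \<psi> g (\<phi> (u s))) -` J"
  have "open I'"
    unfolding I'_def Int_commute[of I]
    using continuous_on_open_vimage[OF smooth_on_open[OF smI]] smooth_on_continuous_on[OF smI]
      smooth_on_open[OF J(2)] by blast
  have sm': "smooth_on I' (\<lambda>s. local_rep U \<phi> \<psi> g (\<phi> (u s)))"
    by (rule smooth_on_subset[OF smI _ \<open>open I'\<close>]) (simp add: I'_def)
  have "smooth_on I' (\<lambda>s. \<tau> (local_rep U \<phi> \<psi> g (\<phi> (u s))))"
    by (rule smooth_on_compose[OF J(2) sm']) (simp add: I'_def)
  then have "smooth_on I' (\<lambda>s. inv_into (ball x e) w (g (u s)))"
  proof (rule smooth_on_cong)
    fix s assume "s \<in> I'"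
    then have s: "s \<in> I" "\<psi> (g (u s)) \<in> J" using rep[of s] by (simp_all add: I'_def)
    show "\<tau> (local_rep U \<phi> \<psi> g (\<phi> (u s))) = inv_into (ball x e) w (g (u s))"
      unfolding rep[OF s(1)] using val[OF s] by (rule conjunct2)
  qed
  then show thesis by (rule that[rotated]) (simp add: I'_def I(1) J(1))
qed

text \<open>Being critical is witnessed by one pair of charts. By the factorization the derivative of the lift is a multiple
of the derivative in those charts, so the lift detects all critical points.\<close>

lemma critical_point_lift:
  assumes A: "compatible_atlas A" and B: "compatible_atlas B" and l: "smooth_lift A B u w f F"
    and crit: "critical_point A B f (u t)"
  shows "deriv F t = 0"
proof -
  have u: "circle_param A u" and w: "circle_param B w" and F: "smooth_on UNIV F"
    and fu: "\<And>t. f (u t) = w (F t)" using l by (simp_all add: smooth_lift_def)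
  have one: "1 \<le> pi / 2" using pi_ge_two by simp
  obtain U \<phi> V \<psi> where ch: "(U, \<phi>) \<in> A" "(V, \<psi>) \<in> B" "u t \<in> U" "f ` U \<subseteq> V"
    and der: "(local_rep U \<phi> \<psi> f has_real_derivative 0) (at (\<phi> (u t)))"
    using crit unfolding critical_point_def by blast
  have x: "f (u t) \<in> w ` ball (F t) 1" using fu by simp
  obtain I J \<tau> where I: "t \<in> I" "u ` I \<subseteq> U" "smooth_on I (\<lambda>s. \<phi> (u s))"
    and J: "local_rep U \<phi> \<psi> f (\<phi> (u t)) \<in> J" "smooth_on J \<tau>"
    and rep: "\<And>s. s \<in> I \<Longrightarrow> local_rep U \<phi> \<psi> f (\<phi> (u s)) = \<psi> (f (u s))"
    and val: "\<And>s. s \<in> I \<Longrightarrow> \<psi> (f (u s)) \<in> J \<Longrightarrow>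
        f (u s) \<in> w ` ball (F t) 1 \<and> \<tau> (\<psi> (f (u s))) = inv_into (ball (F t) 1) w (f (u s))"
    by (rule local_rep_factorization[OF A B u w ch(1,3,2,4) zero_less_one one x]) blast
  define R where "R s = local_rep U \<phi> \<psi> f (\<phi> (u s))" for s
  have R0: "(R has_real_derivative 0) (at t)"
    unfolding R_def using DERIV_chain2[where f = "local_rep U \<phi> \<psi> f" and g = "\<lambda>s. \<phi> (u s)",
        OF der smooth_on_has_deriv[OF I(3,1)]] by simp
  have \<tau>R: "((\<lambda>s. \<tau> (R s)) has_real_derivative 0) (at t)"
    using DERIV_chain2[where f = \<tau> and g = R, OF smooth_on_has_deriv[OF J(2)] R0] J(1)
    by (simp add: R_def)
  have "\<forall>\<^sub>F s in nhds t. s \<in> I"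
    using I(1) smooth_on_open[OF I(3)] by (rule eventually_nhds_in_open[rotated])
  moreover have "\<forall>\<^sub>F s in nhds t. R s \<in> J"
  proof -
    have "(R \<longlongrightarrow> R t) (nhds t)"
      using DERIV_isCont[OF R0] by (simp add: continuous_at tendsto_nhds_iff)
    moreover have "R t \<in> J" unfolding R_def by (rule J(1))
    ultimately show ?thesis using smooth_on_open[OF J(2)] by (metis topological_tendstoD)
  qed
  moreover have "\<forall>\<^sub>F s in nhds t. F s \<in> ball (F t) 1"
  proof -
    have "(F \<longlongrightarrow> F t) (nhds t)"
      using DERIV_isCont[OF smooth_on_has_deriv[OF F UNIV_I, of t]]
      by (simp add: continuous_at tendsto_nhds_iff)
    then show ?thesis by (rule topological_tendstoD) simp_all
  qed
  ultimately have "\<forall>\<^sub>F s in nhds t. \<tau> (R s) = F s"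
  proof eventually_elim
    case (elim s)
    then have "\<tau> (R s) = inv_into (ball (F t) 1) w (w (F s))"
      using rep[of s] val[of s] by (simp add: R_def fu)
    also have "\<dots> = F s" by (rule circle_param_inverse(1)[OF w one elim(3)])
    finally show ?case .
  qed
  from DERIV_cong_ev[OF refl this refl] \<tau>R have "(F has_real_derivative 0) (at t)" by simp
  then show ?thesis by (rule DERIV_imp_deriv)
qed

lemma funpow_deriv_cong:
  fixes f g :: "real \<Rightarrow> real"
  assumes "open S" "\<And>x. x \<in> S \<Longrightarrow> f x = g x" "x \<in> S"
  shows "(deriv ^^ n) f x = (deriv ^^ n) g x"
  using assms(3)
proof (induction n arbitrary: x)
  case (Suc n)
  have "\<forall>\<^sub>F y in nhds x. (deriv ^^ n) f y = (deriv ^^ n) g y"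
    using eventually_nhds_in_open[OF assms(1) Suc.prems] by eventually_elim (rule Suc.IH)
  then show ?case by (simp add: deriv_cong_ev)
qed (simp add: assms(2))

text \<open>The charts given by \<open>u\<close> and \<open>w\<close> witness the fold, since \<open>f\<close> is represented in them by \<open>F\<close>.\<close>

lemma fold_point_lift:
  assumes l: "smooth_lift A B u w f F" and "deriv F t = 0" "deriv (deriv F) t \<noteq> 0"
  shows "fold_point A B f (u t)"
proof -
  obtain U \<phi> V \<psi> where ch: "(U, \<phi>) \<in> A" "(V, \<psi>) \<in> B" "u t \<in> U" "f ` U \<subseteq> V" "open (\<phi> ` U)"
    "\<phi> (u t) = t" "\<And>s. s \<in> \<phi> ` U \<Longrightarrow> local_rep U \<phi> \<psi> f s = F s"
    using smooth_lift_charts[OF l, of t] by metis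
  have t: "t \<in> \<phi> ` U" using ch(3,6) by force
  have "(F has_real_derivative 0) (at t)"
    using smooth_on_has_deriv[of UNIV F t] l assms(2) by (simp add: smooth_lift_def)
  then have 1: "(local_rep U \<phi> \<psi> f has_real_derivative 0) (at t)"
    by (rule has_field_derivative_transform_within_open[OF _ ch(5) t]) (simp add: ch(7))
  have "(deriv ^^ 2) (local_rep U \<phi> \<psi> f) t = (deriv ^^ 2) F t"
    by (rule funpow_deriv_cong[OF ch(5) _ t]) (rule ch(7))
  then have 2: "(deriv ^^ 2) (local_rep U \<phi> \<psi> f) t \<noteq> 0" using assms(3) by (simp add: numeral_2_eq_2)
  show ?thesis
    unfolding fold_point_def
    by (intro bexI[OF _ ch(1)] case_prodI bexI[OF _ ch(2)]) (use ch(3,4,6) 1 2 in auto)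
qed

lemma fold_point_imp_critical_point: "fold_point A B f p \<Longrightarrow> critical_point A B f p"
  unfolding fold_point_def critical_point_def by blast

text \<open>Changing the parameter of a point by a period changes the value of the lift by a period, so the image of the
  point is well defined. The inverse map comes from the inverse lifts in the same way, and the smoothness
  of both is visible in the lifts.\<close>

lemma diffeomorphism_from_lifts:
  assumes P: "circle_cover A P" and \<eta>: "\<And>u. u \<in> P \<Longrightarrow> circle_lift (\<eta> u)"
  obtains h where "diffeomorphism A A h" "\<And>u t. u \<in> P \<Longrightarrow> h (u t) = u (\<eta> u t)"
proof -
  have par: "circle_param A u" if "u \<in> P" for u using P that by (simp add: circle_cover_def)
  have car: "carrier A = (\<Union>u\<in>P. range u)" using P by (simp add: circle_cover_def)
  have disj: "u = v" if "u \<in> P" "v \<in> P" "u s = v t" for u v s t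
  proof (rule ccontr)
    assume "u \<noteq> v"
    then have "range u \<inter> range v = {}" using P that unfolding circle_cover_def by blast
    then show False using that(3) by (metis disjoint_iff rangeI)
  qed
  have ex: "\<exists>h. \<forall>u\<in>P. \<forall>t. h (u t) = u (\<eta> u t)" if \<eta>: "\<And>u. u \<in> P \<Longrightarrow> circle_lift (\<eta> u)" for \<eta>
  proof -
    define h where "h p = (SOME q. \<exists>u\<in>P. \<exists>s. p = u s \<and> q = u (\<eta> u s))" for p
    have "h (u t) = u (\<eta> u t)" if "u \<in> P" for u t
    proof -
      have "\<exists>q. \<exists>v\<in>P. \<exists>s. u t = v s \<and> q = v (\<eta> v s)" using that by blast
      from someI_ex[OF this] obtain v s where v: "v \<in> P" "u t = v s" "h (u t) = v (\<eta> v s)"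
        unfolding h_def by blast
      have "v = u" using disj[OF that v(1,2)] by simp
      then have "cis t = cis s" using v(2) circle_param_eq[OF par[OF that]] by simp
      then obtain n :: int where "t = s + 2 * pi * of_int n" unfolding cis_eq_iff by blast
      then have "\<eta> u t = \<eta> u s + 2 * pi * of_int n"
        using shift_int[of "\<eta> u" "2 * pi" s n] \<eta>[OF that] by (simp add: circle_lift_def)
      then show ?thesis using v(3) \<open>v = u\<close> circle_param_shift[OF par[OF that]] by simp
    qed
    then show ?thesis by blast
  qed
  obtain h where h: "\<And>u t. u \<in> P \<Longrightarrow> h (u t) = u (\<eta> u t)" using ex[of \<eta>] \<eta> by blast
  obtain h' where h': "\<And>u t. u \<in> P \<Longrightarrow> h' (u t) = u (inv (\<eta> u) t)"
  proof -
    have "circle_lift (inv (\<eta> u))" if "u \<in> P" for u by (rule circle_lift_inv[OF \<eta>[OF that]])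
    from ex[of "\<lambda>u. inv (\<eta> u)", OF this] that show thesis by blast
  qed
  have \<eta>inv: "\<eta> u (inv (\<eta> u) t) = t" "inv (\<eta> u) (\<eta> u t) = t" if "u \<in> P" for u t
    using circle_lift_bij[OF \<eta>[OF that]] by (simp_all add: bij_def surj_f_inv_f)
  have hh': "h (h' p) = p" "h' (h p) = p" if "p \<in> carrier A" for p
    using that h h' \<eta>inv by (auto simp: car)
  have mem: "h p \<in> carrier A" "h' p \<in> carrier A" if p: "p \<in> carrier A" for p
  proof -
    obtain u t where ut: "u \<in> P" "p = u t" using p by (auto simp: car)
    show "h p \<in> carrier A" "h' p \<in> carrier A"
      unfolding ut(2) h[OF ut(1)] h'[OF ut(1)] car using ut(1) by blast+
  qed
  have bij: "bij_betw h (carrier A) (carrier A)"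
    by (rule bij_betwI[where g = h']) (use hh' mem in auto)
  have inv: "inv_into (carrier A) h p = h' p" if "p \<in> carrier A" for p
    using inv_into_f_f[OF bij_betw_imp_inj_on[OF bij] mem(2)[OF that]] hh'(1)[OF that] by simp
  have "smooth_map A A h"
  proof (rule smooth_map_from_lifts)
    fix p assume "p \<in> carrier A"
    then obtain u t where u: "u \<in> P" "p = u t" by (auto simp: car)
    then have "smooth_lift A A u u h (\<eta> u)"
      using par h \<eta>[OF u(1)] by (simp add: smooth_lift_def circle_lift_def)
    then show "\<exists>u w F t. smooth_lift A A u w h F \<and> p = u t" using u(2) by blast
  qed
  moreover have "smooth_map A A (inv_into (carrier A) h)"
  proof (rule smooth_map_from_lifts)
    fix p assume "p \<in> carrier A"
    then obtain u t where u: "u \<in> P" "p = u t" by (auto simp: car)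
    have "inv_into (carrier A) h (u s) = u (inv (\<eta> u) s)" for s
      using inv[of "u s"] h'[OF u(1), of s] u(1) by (auto simp: car)
    then have "smooth_lift A A u u (inv_into (carrier A) h) (inv (\<eta> u))"
      using par[OF u(1)] circle_lift_inv[OF \<eta>[OF u(1)]] by (simp add: smooth_lift_def circle_lift_def)
    then show "\<exists>u w F t. smooth_lift A A u w (inv_into (carrier A) h) F \<and> p = u t" using u(2) by blast
  qed
  ultimately show thesis using that bij h by (simp add: diffeomorphism_def)
qed

section \<open>Neighbourhoods in the smooth topology\<close>

text \<open>The values of a nearby map have several arguments, but as \<open>\<epsilon> \<le> 1 < \<pi>\<close> only one of them lies within
  \<open>\<epsilon>\<close> of the given lift \<open>F\<close>; these arguments form the lift \<open>G\<close>. The neighbourhood is an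
  intersection of finitely many subbasic ones, for compact arcs of radius \<open>1/4\<close> that cover one period. As \<open>F\<close>
  is Lipschitz with constant 2, it maps each of them into the interval of radius \<open>1/2\<close> about the image of the
  centre, well inside the coordinate arc of radius \<open>3/2\<close>.\<close>

lemma smooth_neighbourhood_of_lift:
  assumes A: "compatible_atlas A" and B: "compatible_atlas B"
    and smf: "smooth_map A B f" and l: "smooth_lift A B u w f F"
    and shift: "\<And>t. F (t + 2 * pi) = F t + D"
    and lip: "\<And>t. \<bar>deriv F t\<bar> \<le> 2" and \<epsilon>: "0 < \<epsilon>" "\<epsilon> \<le> 1"
  obtains W where "openin (Cinf_topology A B) W" "f \<in> W"
    "\<And>g. g \<in> W \<Longrightarrow> \<exists>G. smooth_lift A B u w g G \<and> (\<forall>t. G (t + 2 * pi) = G t + D) \<and>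
       (\<forall>t. \<bar>G t - F t\<bar> < \<epsilon> \<and> \<bar>deriv G t - deriv F t\<bar> < \<epsilon> \<and>
            \<bar>deriv (deriv G) t - deriv (deriv F) t\<bar> < \<epsilon>)"
proof -
  have u: "circle_param A u" and w: "circle_param B w" and smF: "smooth_on UNIV F"
    and fu: "\<And>t. f (u t) = w (F t)" using l by (simp_all add: smooth_lift_def)
  have pi: "1 \<le> pi / 2" "3 / 2 \<le> pi / 2" "pi > 3" "pi < 4" using pi_gt3 pi_less_4 by linarith+
  have dF: "(F has_real_derivative deriv F t) (at t)" for t
    by (rule smooth_on_has_deriv[OF smF UNIV_I])
  have Lip: "\<bar>F s - F t\<bar> \<le> 2 * \<bar>s - t\<bar>" for s t
  proof -
    have "norm (F s - F t) \<le> 2 * norm (s - t)"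
      by (rule field_differentiable_bound[where S = UNIV and f' = "deriv F"])
        (use lip has_field_derivative_at_within[OF dF] in auto)
    then show ?thesis by simp
  qed
  define c where "c i = real i / 4" for i
  define U where "U i = u ` ball (c i) 1" for i
  define \<phi> where "\<phi> i = inv_into (ball (c i) 1) u" for i
  define V where "V i = w ` ball (F (c i)) (3 / 2)" for i
  define \<psi> where "\<psi> i = inv_into (ball (F (c i)) (3 / 2)) w" for i
  define K where "K i = u ` cball (c i) (1 / 4)" for i
  define N where "N i = Cinf_subbasic A B f 2 (U i) (\<phi> i) (V i) (\<psi> i) (K i) \<epsilon>" for i
  \<comment> \<open>The centres have distance \<open>1/4\<close>, so 32 of them reach 8, which exceeds the period.\<close>
  define W where "W = (\<Inter>i\<in>{..<32}. N i)"
  have \<phi>K: "\<phi> i ` K i = cball (c i) (1 / 4)" for i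
    unfolding \<phi>_def K_def by (rule circle_param_coordinate_image[OF u pi(1)]) auto
  have Fball: "F t \<in> ball (F (c i)) (3 / 2)" if "t \<in> cball (c i) (1 / 4)" for i t
  proof -
    have "2 * \<bar>c i - t\<bar> \<le> 1 / 2" using that by (simp add: dist_real_def)
    then have "\<bar>F (c i) - F t\<bar> \<le> 1 / 2" using Lip[of "c i" t] by (rule order_trans[rotated])
    then show ?thesis by (simp add: dist_real_def)
  qed
  have fK: "f ` K i \<subseteq> V i" for i using Fball[of _ i] fu by (auto simp: K_def V_def)
  have "openin (Cinf_topology A B) (N i)" for i
  proof -
    have "(U i, \<phi> i) \<in> A" unfolding U_def \<phi>_def by (rule circle_param_chart[OF u _ pi(1)]) simp
    moreover have "(V i, \<psi> i) \<in> B" unfolding V_def \<psi>_def by (rule circle_param_chart[OF w _ pi(2)]) simp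
    moreover have "K i \<subseteq> U i" unfolding K_def U_def by (intro image_mono) auto
    moreover have "compact (\<phi> i ` K i)" unfolding \<phi>K by simp
    ultimately show ?thesis
      unfolding Cinf_topology_def N_def
      by (intro topology_generated_by_Basis) (use smf fK \<epsilon>(1) in blast)
  qed
  then have openW: "openin (Cinf_topology A B) W"
    unfolding W_def by (intro openin_INT2) (simp_all add: lessThan_empty_iff)
  have fW: "f \<in> W"
    unfolding W_def N_def Cinf_subbasic_def using smf fK \<epsilon>(1) by simp
  \<comment> \<open>\<open>u\<close> has period \<open>2 pi\<close>, so \<open>D\<close> is a multiple of \<open>2 pi\<close>.\<close>
  have cisD: "cis (x + D * of_int n) = cis x" for x and n :: int
  proof -
    have "w (F 0 + D) = w (F 0)"
      using fu[of "0 + 2 * pi"] fu[of 0] circle_param_shift[OF u, of 0 1] shift[of 0] by simp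
    then have "cis (F 0 + D) = cis (F 0)" using circle_param_eq[OF w] by simp
    then obtain m :: int where "F 0 + D = F 0 + 2 * pi * of_int m" unfolding cis_eq_iff by blast
    then have "x + D * of_int n = x + 2 * pi * of_int (m * n)" by simp
    then show ?thesis unfolding cis_eq_iff by blast
  qed
  have key: "\<exists>G. smooth_lift A B u w g G \<and> (\<forall>t. G (t + 2 * pi) = G t + D) \<and>
       (\<forall>t. \<bar>G t - F t\<bar> < \<epsilon> \<and> \<bar>deriv G t - deriv F t\<bar> < \<epsilon> \<and>
            \<bar>deriv (deriv G) t - deriv (deriv F) t\<bar> < \<epsilon>)" if gW: "g \<in> W" for g
  proof -
    have "g \<in> N 0" using gW unfolding W_def by (rule INT_D) simp
    then have smg: "smooth_map A B g" by (simp add: N_def Cinf_subbasic_def)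
    define L where "L i t = \<psi> i (g (u t))" for i t
    have gV: "g (u t) \<in> V i" and close: "j \<le> 2 \<Longrightarrow> \<bar>(deriv ^^ j) (local_rep (U i) (\<phi> i) (\<psi> i) g) t -
        (deriv ^^ j) (local_rep (U i) (\<phi> i) (\<psi> i) f) t\<bar> < \<epsilon>"
      if "i < 32" "t \<in> cball (c i) (1 / 4)" for i t j
    proof -
      have *: "g \<in> N i" using gW that(1) by (auto simp: W_def)
      then have "g ` K i \<subseteq> V i" by (simp add: N_def Cinf_subbasic_def)
      then show "g (u t) \<in> V i" using that(2) by (auto simp: K_def)
      show "\<bar>(deriv ^^ j) (local_rep (U i) (\<phi> i) (\<psi> i) g) t -
        (deriv ^^ j) (local_rep (U i) (\<phi> i) (\<psi> i) f) t\<bar> < \<epsilon>" if "j \<le> 2"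
        using * \<open>t \<in> cball (c i) (1 / 4)\<close> that unfolding N_def Cinf_subbasic_def \<phi>K by blast
    qed
    have in1: "t \<in> ball (c i) 1" if "t \<in> cball (c i) (1 / 4)" for i t using that by auto
    have repg: "local_rep (U i) (\<phi> i) (\<psi> i) g t = L i t" if "t \<in> cball (c i) (1 / 4)" for i t
      unfolding U_def \<phi>_def L_def by (rule local_rep_circle_param[OF u pi(1) in1[OF that]])
    have repf: "local_rep (U i) (\<phi> i) (\<psi> i) f t = F t" if "t \<in> cball (c i) (1 / 4)" for i t
      unfolding U_def \<phi>_def \<psi>_def
      by (rule local_rep_smooth_lift[OF l pi(1) in1[OF that] pi(2) Fball[OF that]])
    have wL: "w (L i t) = g (u t)" if "i < 32" "t \<in> cball (c i) (1 / 4)" for i t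
      using gV[OF that] unfolding V_def L_def \<psi>_def by (rule f_inv_into_f)
    have LF: "\<bar>L i t - F t\<bar> < \<epsilon>" if "i < 32" "t \<in> cball (c i) (1 / 4)" for i t
      using close[OF that, of 0] repg[OF that(2)] repf[OF that(2)] by simp
    have index: "\<exists>i<32. t \<in> ball (c i) (1 / 4)" if "0 \<le> t" "t < 2 * pi" for t
    proof (intro exI conjI)
      have fl: "real (nat \<lfloor>4 * t\<rfloor>) = of_int \<lfloor>4 * t\<rfloor>" using that(1) by simp
      have "of_int \<lfloor>4 * t\<rfloor> < (32 :: real)" using that(2) pi(4) by linarith
      then show "nat \<lfloor>4 * t\<rfloor> < 32" by linarith
      have "of_int \<lfloor>4 * t\<rfloor> \<le> 4 * t" "4 * t < of_int \<lfloor>4 * t\<rfloor> + 1" by linarith+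
      then show "t \<in> ball (c (nat \<lfloor>4 * t\<rfloor>)) (1 / 4)"
        unfolding c_def fl mem_ball dist_real_def by linarith
    qed
    have unique: "x = y" if "w x = w y" "\<bar>x - F t\<bar> < \<epsilon>" "\<bar>y - F t\<bar> < \<epsilon>" for x y t
    proof (rule cis_eq_near)
      show "cis x = cis y" using that(1) circle_param_eq[OF w] by simp
      show "\<bar>x - y\<bar> < 2 * pi" using that(2,3) \<epsilon>(2) pi(3) by linarith
    qed
    have Fn: "F (t + 2 * pi * of_int n) = F t + D * of_int n" for t n
      by (rule shift_int) (rule shift)
    have "\<exists>x. w x = g (u t) \<and> \<bar>x - F t\<bar> < \<epsilon>" for t
    proof -
      obtain n :: int where n: "0 \<le> t + 2 * pi * of_int n" "t + 2 * pi * of_int n < 0 + 2 * pi"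
        by (rule shift_into_period)
      let ?t = "t + 2 * pi * of_int n"
      obtain i where i: "i < 32" "?t \<in> ball (c i) (1 / 4)" using index[of ?t] n by auto
      then have i': "?t \<in> cball (c i) (1 / 4)" by auto
      have "cis (L i ?t + D * of_int (- n)) = cis (L i ?t)" by (rule cisD)
      then have "w (L i ?t + D * of_int (- n)) = g (u t)"
        using circle_param_eq[OF w, of _ "L i ?t"] wL[OF i(1) i'] circle_param_shift[OF u, of t n] by metis
      moreover have "\<bar>L i ?t + D * of_int (- n) - F t\<bar> < \<epsilon>" using LF[OF i(1) i'] Fn[of t n] by simp
      ultimately show ?thesis by blast
    qed
    then obtain G where wG: "\<And>t. w (G t) = g (u t)" and GF: "\<And>t. \<bar>G t - F t\<bar> < \<epsilon>" by metis
    have GL: "G t = L i t" if "i < 32" "t \<in> cball (c i) (1 / 4)" for i t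
      by (rule unique[where t = t]) (simp_all add: wG GF wL[OF that] LF[OF that])
    have Gshift: "G (t + 2 * pi) = G t + D" for t
    proof (rule unique[where t = "t + 2 * pi"])
      have "cis (G t + D) = cis (G t)" using cisD[of "G t" 1] by simp
      then have "w (G t + D) = w (G t)" using circle_param_eq[OF w] by blast
      then show "w (G (t + 2 * pi)) = w (G t + D)"
        using circle_param_shift[OF u, of t 1] by (simp add: wG)
      show "\<bar>G (t + 2 * pi) - F (t + 2 * pi)\<bar> < \<epsilon>" by (rule GF)
      show "\<bar>G t + D - F (t + 2 * pi)\<bar> < \<epsilon>" using GF[of t] by (simp add: shift)
    qed
    have smG: "smooth_on UNIV G"
    proof (rule smooth_on_periodic[where a = 0 and f = G, OF Gshift])
      fix t :: real assume t: "0 \<le> t" "t < 0 + 2 * pi"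
      obtain i where i: "i < 32" "t \<in> ball (c i) (1 / 4)" using index[of t] t by auto
      then have i': "t \<in> cball (c i) (1 / 4)" by auto
      have "g (u t) \<in> w ` ball (F (c i)) (3 / 2)" using gV[OF i(1) i'] by (simp add: V_def)
      then obtain I where I: "t \<in> I" "smooth_on I (\<lambda>s. inv_into (ball (F (c i)) (3 / 2)) w (g (u s)))"
        using smooth_map_along_circle_params[OF A B smg u w _ pi(2)] by (metis zero_less_divide_iff zero_less_numeral)
      then have "smooth_on (I \<inter> ball (c i) (1 / 4)) (L i)"
        unfolding L_def \<psi>_def using smooth_on_open[OF I(2)] by (intro smooth_on_subset[OF I(2)]) auto
      then have "smooth_on (I \<inter> ball (c i) (1 / 4)) G"
        by (rule smooth_on_cong) (rule GL[OF i(1), symmetric], auto)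
      then show "\<exists>U. t \<in> U \<and> smooth_on U G" using I(1) i(2) by blast
    qed
    have derivs: "\<bar>deriv G t - deriv F t\<bar> < \<epsilon> \<and> \<bar>deriv (deriv G) t - deriv (deriv F) t\<bar> < \<epsilon>"
      (is "?close t") for t
    proof (rule periodic_all[where Pr = ?close and a = 0])
      fix t :: real assume t: "0 \<le> t" "t < 0 + 2 * pi"
      obtain i where i: "i < 32" "t \<in> ball (c i) (1 / 4)" using index[of t] t by auto
      then have i': "t \<in> cball (c i) (1 / 4)" by auto
      have "(deriv ^^ j) (local_rep (U i) (\<phi> i) (\<psi> i) g) t = (deriv ^^ j) G t"
        "(deriv ^^ j) (local_rep (U i) (\<phi> i) (\<psi> i) f) t = (deriv ^^ j) F t" for j
        by (rule funpow_deriv_cong[OF open_ball _ i(2)]; simp add: repg GL[OF i(1)] repf)+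
      then have "\<bar>(deriv ^^ j) G t - (deriv ^^ j) F t\<bar> < \<epsilon>" if "j \<le> 2" for j
        using close[OF i(1) i' that] by simp
      from this[of 1] this[of 2] show "?close t" by (simp add: numeral_2_eq_2)
    next
      fix t :: real
      have "deriv H (s + 2 * pi) = deriv H s" if "smooth_on UNIV H" "\<And>t. H (t + 2 * pi) = H t + e" for H s e
        by (rule deriv_periodic[OF that(2,1)])
      note d1 = this[OF smG Gshift] this[OF smF shift]
      have "deriv (deriv H) (s + 2 * pi) = deriv (deriv H) s"
        if "smooth_on UNIV H" "\<And>t. deriv H (t + 2 * pi) = deriv H t" for H s
        using deriv_periodic[of "deriv H" 0] that smooth_on_deriv by simp
      note this[OF smG d1(1)] this[OF smF d1(2)]
      then show "?close (t + 2 * pi) = ?close t" unfolding d1 by simp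
    qed
    show ?thesis
      using u w smG wG Gshift GF derivs by (intro exI[of _ G]) (simp add: smooth_lift_def)
  qed
  show thesis by (rule that[OF openW fW key])
qed

section \<open>Stable maps to a circle\<close>

lemma smooth_map_of_circle_cover:
  assumes "circle_cover A P" "\<And>u. u \<in> P \<Longrightarrow> smooth_lift A B u w f (F u)"
  shows "smooth_map A B f"
proof (rule smooth_map_from_lifts)
  fix p assume "p \<in> carrier A"
  then obtain u t where "u \<in> P" "p = u t" using assms(1) by (auto simp: circle_cover_def)
  then show "\<exists>u w F t. smooth_lift A B u w f F \<and> p = u t" using assms(2) by blast
qed

lemma circle_lift_near_ident:
  assumes "smooth_on UNIV G" "\<And>t. G (t + 2 * pi) = G t + 2 * pi"
    and "\<And>t. \<bar>deriv G t - deriv (\<lambda>t. t) t\<bar> < 1"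
  shows "circle_lift G"
  unfolding circle_lift_def
proof (intro conjI allI assms(1,2))
  show "0 < deriv G t" for t using assms(3)[of t] by simp
qed

lemma diffeomorphism_from_lift:
  assumes "circle_cover A {u}" "circle_lift \<eta>"
  obtains h where "diffeomorphism A A h" "\<And>t. h (u t) = u (\<eta> t)"
proof -
  obtain h where h: "diffeomorphism A A h" "\<And>v t. v \<in> {u} \<Longrightarrow> h (v t) = v (\<eta> t)"
    using diffeomorphism_from_lifts[where \<eta> = "\<lambda>v. \<eta>", OF assms] by blast
  show thesis by (rule that[OF h(1) h(2)[OF singletonI]])
qed

text \<open>Every map near a family of diffeomorphisms onto the circle is again such a family, and the inverses of
  its lifts carry the one to the other.\<close>

theorem stable_coverings:
  assumes A: "compatible_atlas A" and B: "compatible_atlas B"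
    and P: "circle_cover A P" "finite P" "P \<noteq> {}" and w: "circle_cover B {w}"
    and fu: "\<And>u t. u \<in> P \<Longrightarrow> f (u t) = w t"
  shows "stable_map A B f" and "\<not> (\<exists>p\<in>carrier A. critical_point A B f p)"
    and "\<And>u. u \<in> P \<Longrightarrow> bij_betw f (range u) (carrier B)"
proof -
  have l: "smooth_lift A B u w f (\<lambda>t. t)" if "u \<in> P" for u
    using P(1) w fu[OF that] that by (simp add: smooth_lift_def circle_cover_def smooth_on_ident)
  have car: "carrier A = (\<Union>u\<in>P. range u)" "carrier B = range w"
    using P(1) w by (simp_all add: circle_cover_def)
  have smf: "smooth_map A B f" by (rule smooth_map_of_circle_cover[OF P(1) l])
  have "\<exists>W. openin (Cinf_topology A B) W \<and> f \<in> W \<and>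
      (\<forall>g\<in>W. \<exists>G. circle_lift G \<and> (\<forall>t. g (u t) = w (G t)))" if u: "u \<in> P" for u
  proof -
    obtain W where W: "openin (Cinf_topology A B) W" "f \<in> W"
      "\<And>g. g \<in> W \<Longrightarrow> \<exists>G. smooth_lift A B u w g G \<and> (\<forall>t. G (t + 2 * pi) = G t + 2 * pi) \<and>
         (\<forall>t. \<bar>G t - t\<bar> < 1 \<and> \<bar>deriv G t - deriv (\<lambda>t. t) t\<bar> < 1 \<and>
            \<bar>deriv (deriv G) t - deriv (deriv (\<lambda>t. t)) t\<bar> < 1)"
      by (rule smooth_neighbourhood_of_lift[OF A B smf l[OF u], of "2 * pi" 1]) simp_all
    have "\<exists>G. circle_lift G \<and> (\<forall>t. g (u t) = w (G t))" if g: "g \<in> W" for g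
    proof -
      obtain G where G: "smooth_lift A B u w g G" "\<And>t. G (t + 2 * pi) = G t + 2 * pi"
         "\<And>t. \<bar>deriv G t - deriv (\<lambda>t. t) t\<bar> < 1" using W(3)[OF g] by blast
      have "circle_lift G" using G by (intro circle_lift_near_ident) (simp_all add: smooth_lift_def)
      then show ?thesis using G(1) by (auto simp: smooth_lift_def)
    qed
    then show ?thesis using W(1,2) by blast
  qed
  then obtain W where W: "\<And>u. u \<in> P \<Longrightarrow> openin (Cinf_topology A B) (W u)" "\<And>u. u \<in> P \<Longrightarrow> f \<in> W u"
    "\<And>u g. u \<in> P \<Longrightarrow> g \<in> W u \<Longrightarrow> \<exists>G. circle_lift G \<and> (\<forall>t. g (u t) = w (G t))" by metis
  have "equivalent_maps A B f g" if g: "g \<in> (\<Inter>u\<in>P. W u)" for g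
  proof -
    obtain G where G: "\<And>u. u \<in> P \<Longrightarrow> circle_lift (G u)" "\<And>u t. u \<in> P \<Longrightarrow> g (u t) = w (G u t)"
    proof -
      have "\<forall>u\<in>P. \<exists>G. circle_lift G \<and> (\<forall>t. g (u t) = w (G t))"
      proof
        fix u assume "u \<in> P"
        moreover from this g have "g \<in> W u" by simp
        ultimately show "\<exists>G. circle_lift G \<and> (\<forall>t. g (u t) = w (G t))" by (rule W(3))
      qed
      from bchoice[OF this] that show thesis by blast
    qed
    obtain h where h: "diffeomorphism A A h" "\<And>u t. u \<in> P \<Longrightarrow> h (u t) = u (inv (G u) t)"
      using diffeomorphism_from_lifts[where \<eta> = "\<lambda>u. inv (G u)", OF P(1) circle_lift_inv[OF G(1)]] by blast
    obtain k where k: "diffeomorphism B B k" "\<And>t. k (w t) = w t"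
      using diffeomorphism_from_lift[OF w circle_lift_ident] by blast
    have "g (h p) = k (f p)" if "p \<in> carrier A" for p
    proof -
      obtain u t where u: "u \<in> P" "p = u t" using \<open>p \<in> carrier A\<close> by (auto simp: car)
      have "G u (inv (G u) t) = t" using circle_lift_bij[OF G(1)[OF u(1)]] by (simp add: bij_def surj_f_inv_f)
      then show ?thesis unfolding u(2) h(2)[OF u(1)] G(2)[OF u(1)] fu[OF u(1)] k(2) by simp
    qed
    then show ?thesis using h(1) k(1) unfolding equivalent_maps_def by blast
  qed
  moreover have "openin (Cinf_topology A B) (\<Inter>u\<in>P. W u)"
    by (rule openin_INT2) (use P W(1) in auto)
  moreover have "f \<in> (\<Inter>u\<in>P. W u)" using W(2) by blast
  ultimately show "stable_map A B f" using smf unfolding stable_map_def by blast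
  show "\<not> (\<exists>p\<in>carrier A. critical_point A B f p)"
  proof
    assume "\<exists>p\<in>carrier A. critical_point A B f p"
    then obtain u t where u: "u \<in> P" "critical_point A B f (u t)" by (auto simp: car)
    from critical_point_lift[OF A B l[OF u(1)] u(2)] show False by simp
  qed
  show "bij_betw f (range u) (carrier B)" if "u \<in> P" for u
  proof (rule bij_betw_imageI)
    have eq: "u s = u t \<longleftrightarrow> cis s = cis t" "w s = w t \<longleftrightarrow> cis s = cis t" for s t
      using P(1) w that circle_param_eq[of A u] circle_param_eq[of B w] by (simp_all add: circle_cover_def)
    show "inj_on f (range u)" using fu[OF that] eq by (auto intro!: inj_onI)
    show "f ` range u = carrier B" unfolding image_image fu[OF that] car ..
  qed
qed

text \<open>Maps near \<open>f\<close> have lifts near \<open>fold_angle \<kappa>\<close>, so the analysis of its perturbations gives the two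
diffeomorphisms. The fold points are the critical points of \<open>fold_angle \<kappa>\<close> in one period.\<close>

theorem stable_fold:
  assumes A: "compatible_atlas A" and B: "compatible_atlas B"
    and u: "circle_cover A {u}" and w: "circle_cover B {w}" and \<kappa>: "0 < \<kappa>" "\<kappa> < 1"
    and fu: "\<And>t. f (u t) = w (fold_angle \<kappa> t)"
  shows "stable_map A B f" and "card {p \<in> carrier A. fold_point A B f p} = 2"
proof -
  have l: "smooth_lift A B u w f (fold_angle \<kappa>)"
    using u w fu fold_angle_smooth[OF \<kappa>] by (simp add: smooth_lift_def circle_cover_def)
  have upar: "circle_param A u" using l by (simp add: smooth_lift_def)
  have car: "carrier A = range u" "carrier B = range w"
    using u w by (simp_all add: circle_cover_def)
  have smf: "smooth_map A B f"
    by (rule smooth_map_of_circle_cover[where F = "\<lambda>u. fold_angle \<kappa>" and w = w, OF u]) (simp add: l)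
  define \<epsilon> where "\<epsilon> = \<kappa> * (1 - \<kappa>\<^sup>2)"
  have \<epsilon>: "0 < \<epsilon>" "\<epsilon> \<le> 1"
    using \<kappa> mult_le_one[of \<kappa> "1 - \<kappa>\<^sup>2"] by (simp_all add: \<epsilon>_def power_less_one_iff power_le_one)
  obtain W where W: "openin (Cinf_topology A B) W" "f \<in> W"
    "\<And>g. g \<in> W \<Longrightarrow> \<exists>G. smooth_lift A B u w g G \<and> (\<forall>t. G (t + 2 * pi) = G t + 0) \<and>
       (\<forall>t. \<bar>G t - fold_angle \<kappa> t\<bar> < \<epsilon> \<and> \<bar>deriv G t - deriv (fold_angle \<kappa>) t\<bar> < \<epsilon> \<and>
            \<bar>deriv (deriv G) t - deriv (deriv (fold_angle \<kappa>)) t\<bar> < \<epsilon>)"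
    by (rule smooth_neighbourhood_of_lift[OF A B smf l, of 0 \<epsilon>])
      (simp_all add: \<epsilon> fold_angle_periodic[OF \<kappa>] deriv_fold_angle_abs_le[OF \<kappa>])
  have "equivalent_maps A B f g" if g: "g \<in> W" for g
  proof -
    obtain G where G: "smooth_lift A B u w g G" "\<And>t. G (t + 2 * pi) = G t + 0"
      "\<And>t. \<bar>G t - fold_angle \<kappa> t\<bar> < \<epsilon>" "\<And>t. \<bar>deriv G t - deriv (fold_angle \<kappa>) t\<bar> < \<epsilon>"
      "\<And>t. \<bar>deriv (deriv G) t - deriv (deriv (fold_angle \<kappa>)) t\<bar> < \<epsilon>"
      using W(3)[OF g] by blast
    have Gs: "smooth_on UNIV G" "\<And>t. g (u t) = w (G t)" using G(1) by (simp_all add: smooth_lift_def)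
    obtain \<eta> \<theta> where \<eta>: "circle_lift \<eta>" "circle_lift \<theta>" "\<And>t. G (\<eta> t) = \<theta> (fold_angle \<kappa> t)"
      using fold_angle_perturbation[OF \<kappa> Gs(1)] G(2-5) unfolding \<epsilon>_def add_0_right by blast
    obtain h where h: "diffeomorphism A A h" "\<And>t. h (u t) = u (\<eta> t)"
      using diffeomorphism_from_lift[OF u \<eta>(1)] by blast
    obtain k where k: "diffeomorphism B B k" "\<And>t. k (w t) = w (\<theta> t)"
      using diffeomorphism_from_lift[OF w \<eta>(2)] by blast
    have "g (h p) = k (f p)" if "p \<in> carrier A" for p
    proof -
      obtain t where t: "p = u t" using \<open>p \<in> carrier A\<close> by (auto simp: car)
      show ?thesis unfolding t h(2) Gs(2) \<eta>(3) fu k(2) ..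
    qed
    then show ?thesis using h(1) k(1) unfolding equivalent_maps_def by blast
  qed
  then show "stable_map A B f" using smf W(1,2) unfolding stable_map_def by blast
  have M: "simple_Morse (fold_angle \<kappa>) (- (pi / 2)) (pi / 2)" by (rule fold_angle_simple_Morse[OF \<kappa>])
  have "{p \<in> carrier A. fold_point A B f p} = {u (- (pi / 2)), u (pi / 2)}"
  proof (intro equalityI subsetI)
    fix p assume "p \<in> {p \<in> carrier A. fold_point A B f p}"
    then obtain s where s: "p = u s" "fold_point A B f (u s)" by (auto simp: car)
    obtain n :: int where n: "- (pi / 2) \<le> s + 2 * pi * of_int n" "s + 2 * pi * of_int n < - (pi / 2) + 2 * pi"
      by (rule shift_into_period)
    let ?t = "s + 2 * pi * of_int n"
    have p: "p = u ?t" using s(1) circle_param_shift[OF upar, of s n] by simp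
    have "deriv (fold_angle \<kappa>) ?t = 0"
      using critical_point_lift[OF A B l] fold_point_imp_critical_point s p by metis
    then have "?t = - (pi / 2) \<or> ?t = pi / 2"
      using M n unfolding simple_Morse_def by (metis less_irrefl order_less_le linorder_neqE_linordered_idom)
    then show "p \<in> {u (- (pi / 2)), u (pi / 2)}" using p by (elim disjE) simp_all
  next
    fix p assume "p \<in> {u (- (pi / 2)), u (pi / 2)}"
    moreover have "fold_point A B f (u (- (pi / 2)))" "fold_point A B f (u (pi / 2))"
      using M by (intro fold_point_lift[OF l]; simp add: simple_Morse_def)+
    ultimately show "p \<in> {p \<in> carrier A. fold_point A B f p}" by (auto simp: car)
  qed
  moreover have "u (- (pi / 2)) \<noteq> u (pi / 2)"
    using circle_param_eq[OF upar] by (simp add: complex_eq_iff)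
  ultimately show "card {p \<in> carrier A. fold_point A B f p} = 2" by simp
qed

section \<open>Circles in quotient manifolds\<close>

lemma smooth_on_subsetE:
  assumes "smooth_on_subset S f" "x \<in> S"
  obtains U g where "x \<in> U" "smooth_on U g" "\<And>y. y \<in> S \<Longrightarrow> y \<in> U \<Longrightarrow> g y = f y"
proof -
  from bspec[OF assms(1)[unfolded smooth_on_subset_def] assms(2)]
  obtain U g where "x \<in> U \<and> smooth_on U g \<and> (\<forall>y\<in>S \<inter> U. g y = f y)" by (elim exE)
  then show thesis by (intro that[of U g]) simp_all
qed

lemma smooth_on_imp_smooth_on_subset:
  assumes "smooth_on U f" "S \<subseteq> U"
  shows "smooth_on_subset S f"
  unfolding smooth_on_subset_def using assms by (intro ballI exI[of _ U] exI[of _ f]) auto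

lemma smooth_on_subset_continuous_on:
  assumes "smooth_on_subset S f"
  shows "continuous_on S f"
  unfolding continuous_on_def
proof
  fix x assume x: "x \<in> S"
  obtain U g where U: "x \<in> U" "smooth_on U g" "\<And>y. y \<in> S \<Longrightarrow> y \<in> U \<Longrightarrow> g y = f y"
    by (rule smooth_on_subsetE[OF assms x]) blast
  have "isCont g x"
    using smooth_on_continuous_on[OF U(2)] smooth_on_open[OF U(2)] U(1)
    by (simp add: continuous_on_eq_continuous_at)
  then have "(g \<longlongrightarrow> f x) (at x within S)"
    unfolding U(3)[OF x U(1), symmetric] by (simp add: continuous_at tendsto_within_subset[where S = UNIV])
  moreover have "\<forall>\<^sub>F y in at x within S. g y = f y"
    unfolding eventually_at_topological using U smooth_on_open[OF U(2)] by blast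
  ultimately show "(f \<longlongrightarrow> f x) (at x within S)" by (rule Lim_transform_eventually)
qed

text \<open>Near a common point a transition function is the composition of a smooth curve in \<open>S\<close> that lifts the inverse of the
first coordinate with a smooth extension of the pullback of the second coordinate.\<close>

lemma compatible_quotient_atlas:
  fixes S :: "'e::euclidean_space set"
  shows "compatible_atlas (quotient_atlas S \<pi>)"
proof -
  have "\<exists>I. \<phi> p \<in> I \<and> I \<subseteq> \<phi> ` (U \<inter> V) \<and> smooth_on I (\<psi> \<circ> inv_into U \<phi>)"
    if U: "(U, \<phi>) \<in> quotient_atlas S \<pi>" and V: "(V, \<psi>) \<in> quotient_atlas S \<pi>" and p: "p \<in> U" "p \<in> V"
    for U V \<phi> \<psi> p
  proof -
    have inj: "inj_on \<phi> U" using U by (simp add: quotient_atlas_def)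
    obtain J \<gamma> where J: "\<phi> p \<in> J" "smooth_on J \<gamma>"
      "\<And>t. t \<in> J \<Longrightarrow> \<gamma> t \<in> S \<and> \<pi> (\<gamma> t) \<in> U \<and> \<phi> (\<pi> (\<gamma> t)) = t"
      using U p(1) unfolding quotient_atlas_def by blast
    have inv: "inv_into U \<phi> t = \<pi> (\<gamma> t)" if "t \<in> J" for t
      using inv_into_f_f[OF inj, of "\<pi> (\<gamma> t)"] J(3)[OF that] by simp
    have "\<pi> (\<gamma> (\<phi> p)) = p" using J(3)[OF J(1)] p(1) inj by (auto dest: inj_onD)
    then have x: "\<gamma> (\<phi> p) \<in> {x \<in> S. \<pi> x \<in> V}" using J(3)[OF J(1)] p(2) by simp
    have "smooth_on_subset {x \<in> S. \<pi> x \<in> V} (\<psi> \<circ> \<pi>)" using V by (simp add: quotient_atlas_def)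
    then obtain O' g where O': "\<gamma> (\<phi> p) \<in> O'" "smooth_on O' g"
      "\<And>y. y \<in> {x \<in> S. \<pi> x \<in> V} \<Longrightarrow> y \<in> O' \<Longrightarrow> g y = (\<psi> \<circ> \<pi>) y"
      using smooth_on_subsetE[OF _ x] by blast
    have "openin (top_of_set S) {x \<in> S. \<pi> x \<in> V}" using V by (simp add: quotient_atlas_def)
    then obtain T where T: "open T" "{x \<in> S. \<pi> x \<in> V} = S \<inter> T" unfolding openin_open by blast
    define I where "I = \<gamma> -` (O' \<inter> T) \<inter> J"
    have "open I"
      unfolding I_def using continuous_on_open_vimage[OF smooth_on_open[OF J(2)]]
        smooth_on_continuous_on[OF J(2)] T(1) smooth_on_open[OF O'(2)] by blast
    have I: "t \<in> J \<and> \<gamma> t \<in> O' \<and> \<gamma> t \<in> {x \<in> S. \<pi> x \<in> V}" if "t \<in> I" for t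
      using that J(3)[of t] T(2) by (auto simp: I_def)
    have "smooth_on I \<gamma>"
      by (rule smooth_on_subset[OF J(2) _ \<open>open I\<close>]) (simp add: I_def)
    then have "smooth_on I (\<lambda>t. g (\<gamma> t))"
      by (rule smooth_on_compose[OF O'(2)]) (use I in blast)
    then have "smooth_on I (\<psi> \<circ> inv_into U \<phi>)"
      by (rule smooth_on_cong) (use I inv O'(3) in auto)
    moreover have "\<phi> p \<in> I" using J(1) O'(1) x T(2) by (auto simp: I_def)
    moreover have "I \<subseteq> \<phi> ` (U \<inter> V)"
    proof
      fix t assume "t \<in> I"
      then have "\<pi> (\<gamma> t) \<in> U \<inter> V" "t = \<phi> (\<pi> (\<gamma> t))" using I[of t] J(3)[of t] by auto
      then show "t \<in> \<phi> ` (U \<inter> V)" by (rule rev_image_eqI)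
    qed
    ultimately show ?thesis by blast
  qed
  moreover have "inj_on \<phi> U \<and> open (\<phi> ` U)" if "(U, \<phi>) \<in> quotient_atlas S \<pi>" for U \<phi>
    using that by (simp add: quotient_atlas_def)
  ultimately show ?thesis unfolding compatible_atlas_def by blast
qed

lemma unit_complex_near_angle:
  assumes "cmod z = 1"
  obtains s where "\<bar>s - t\<bar> \<le> pi" "z = cis s"
proof -
  let ?v = "z * cis (- t)"
  have v: "cmod ?v = 1" using assms by (simp add: norm_mult)
  then have "?v \<noteq> 0" by auto
  then have "cis (Arg ?v) = ?v" using cis_Arg[of ?v] v by (simp add: sgn_div_norm)
  then have "cis (t + Arg ?v) = cis t * (z * cis (- t))" by (simp only: cis_mult[symmetric])
  also have "\<dots> = z * (cis t * cis (- t))" by (simp only: mult.left_commute)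
  also have "\<dots> = z" by (simp add: cis_mult)
  finally have "z = cis (t + Arg ?v)" by simp
  moreover have "\<bar>(t + Arg ?v) - t\<bar> \<le> pi" using Arg_bounded[of ?v] by (simp add: abs_le_iff)
  ultimately show thesis using that by blast
qed

lemma Re_cis_rotate: "Re (cis s * cis (- t)) = cos (s - t)" "Im (cis s * cis (- t)) = sin (s - t)"
  by (simp_all add: cis_mult)

text \<open>A function \<open>\<omega>\<close> with values on the unit circle that separates the fibres, together with a smooth curve
  in \<open>S\<close> along which \<open>\<omega>\<close> runs once around the circle, makes an open part of the quotient a circle:
  the arguments of \<open>\<omega>\<close> are coordinates.\<close>

lemma circle_param_quotient_atlas:
  fixes S :: "'e::euclidean_space set" and \<omega> :: "'e \<Rightarrow> complex"
  assumes S0: "openin (top_of_set S) S0"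
    and \<omega>: "smooth_on_subset S0 \<omega>" "\<And>x. x \<in> S0 \<Longrightarrow> cmod (\<omega> x) = 1"
    and c: "smooth_on UNIV c" "\<And>t. c t \<in> S0" "\<And>t. \<omega> (c t) = cis t"
    and fibre: "\<And>x y. x \<in> S \<Longrightarrow> y \<in> S0 \<Longrightarrow> \<pi> x = \<pi> y \<longleftrightarrow> x \<in> S0 \<and> \<omega> x = \<omega> y"
  shows "circle_param (quotient_atlas S \<pi>) (\<lambda>t. \<pi> (c t))" and "range (\<lambda>t. \<pi> (c t)) = \<pi> ` S0"
proof -
  have S0S: "S0 \<subseteq> S" using openin_imp_subset[OF S0] .
  define u where "u t = \<pi> (c t)" for t
  have eq: "u s = u t \<longleftrightarrow> cis s = cis t" for s t
    unfolding u_def using fibre[of "c s" "c t"] c S0S by auto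
  have lift: "\<exists>s. \<bar>s - t\<bar> \<le> pi \<and> \<omega> x = cis s \<and> \<pi> x = u s" if x: "x \<in> S0" for x t
  proof -
    obtain s where s: "\<bar>s - t\<bar> \<le> pi" "\<omega> x = cis s"
      by (rule unit_complex_near_angle[OF \<omega>(2)[OF x]])
    then show ?thesis using fibre[of x "c s"] c x S0S by (auto simp: u_def)
  qed
  have "range u = \<pi> ` S0"
  proof
    show "range u \<subseteq> \<pi> ` S0" using c(2) by (auto simp: u_def)
    show "\<pi> ` S0 \<subseteq> range u" using lift by blast
  qed
  then show "range (\<lambda>t. \<pi> (c t)) = \<pi> ` S0" by (simp add: u_def[abs_def])
  have chart: "(u ` ball t d, inv_into (ball t d) u) \<in> quotient_atlas S \<pi>" if d: "0 < d" "d \<le> pi / 2" for t d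
  proof -
    let ?J = "ball t d" and ?\<phi> = "inv_into (ball t d) u"
    have inj: "inj_on u ?J"
    proof (rule inj_onI)
      fix x y assume xy: "x \<in> ?J" "y \<in> ?J" "u x = u y"
      have "\<bar>x - y\<bar> < 2 * pi" using xy(1,2) d(2) pi_gt_zero unfolding mem_ball dist_real_def by linarith
      then show "x = y" using xy(3) eq cis_eq_near by blast
    qed
    have \<phi>: "?\<phi> (u s) = s" if "s \<in> ?J" for s using inv_into_f_f[OF inj that] .
    define X where "X = {x \<in> S. \<pi> x \<in> u ` ?J}"
    have X: "x \<in> S0 \<and> (\<exists>s\<in>?J. \<omega> x = cis s \<and> \<pi> x = u s)" if x: "x \<in> X" for x
    proof -
      obtain s where s: "s \<in> ?J" "\<pi> x = \<pi> (c s)" "x \<in> S" using x by (auto simp: X_def u_def)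
      then have "x \<in> S0 \<and> \<omega> x = cis s" using fibre[OF s(3) c(2), of s] c(3) by simp
      then show ?thesis using s by (auto simp: u_def)
    qed
    \<comment> \<open>The cosine of the angular distance from \<open>t\<close> decides membership, which makes the preimage open.\<close>
    have X_eq: "X = S0 \<inter> (\<lambda>x. Re (\<omega> x * cis (- t))) -` {cos d<..}"
    proof (intro equalityI subsetI)
      fix x assume "x \<in> X"
      from X[OF this] obtain s where s: "x \<in> S0" "s \<in> ?J" "\<omega> x = cis s" by blast
      have "cos d < cos \<bar>s - t\<bar>"
        using s(2) d by (subst cos_mono_less_eq) (auto simp: dist_real_def abs_minus_commute)
      also have "cos \<bar>s - t\<bar> = Re (\<omega> x * cis (- t))" unfolding s(3) Re_cis_rotate by simp
      finally show "x \<in> S0 \<inter> (\<lambda>x. Re (\<omega> x * cis (- t))) -` {cos d<..}" using s(1) by simp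
    next
      fix x assume x: "x \<in> S0 \<inter> (\<lambda>x. Re (\<omega> x * cis (- t))) -` {cos d<..}"
      then obtain s where s: "\<bar>s - t\<bar> \<le> pi" "\<omega> x = cis s" "\<pi> x = u s" using lift[of x t] by blast
      have "cos d < Re (\<omega> x * cis (- t))" using x by simp
      also have "\<dots> = cos \<bar>s - t\<bar>" unfolding s(2) Re_cis_rotate by simp
      finally have "cos d < cos \<bar>s - t\<bar>" .
      then have "\<bar>s - t\<bar> < d" using s(1) d by (subst (asm) cos_mono_less_eq) auto
      then have "s \<in> ?J" by (simp add: dist_real_def abs_minus_commute)
      then show "x \<in> X" using x s(3) S0S by (auto simp: X_def)
    qed
    have openX: "openin (top_of_set S) X"
    proof -
      have "continuous_on S0 (\<lambda>x. Re (\<omega> x * cis (- t)))"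
        by (intro continuous_intros smooth_on_subset_continuous_on \<omega>(1))
      then have "openin (top_of_set S0) X"
        unfolding X_eq by (rule continuous_openin_preimage_gen) (rule open_greaterThan)
      then show ?thesis using S0 by (rule openin_trans)
    qed
    have smX: "smooth_on_subset X (?\<phi> \<circ> \<pi>)"
      unfolding smooth_on_subset_def
    proof
      fix x assume x: "x \<in> X"
      obtain U g where U: "x \<in> U" "smooth_on U g" "\<And>y. y \<in> S0 \<Longrightarrow> y \<in> U \<Longrightarrow> g y = \<omega> y"
        by (rule smooth_on_subsetE[OF \<omega>(1)]) (use X[OF x] in blast)+
      let ?v = "\<lambda>y. g y * cis (- t)"
      let ?U = "(\<lambda>y. Re (?v y)) -` {0<..} \<inter> U"
      have smv: "smooth_on U ?v" using U(2) smooth_on_open[OF U(2)] by (intro smooth_intros)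
      then have "smooth_on U (\<lambda>y. Re (?v y))" by (rule smooth_on_Re)
      then have openU: "open ?U"
        using continuous_on_open_vimage[OF smooth_on_open[OF U(2)]] smooth_on_continuous_on
          open_greaterThan by blast
      have smv': "smooth_on ?U ?v" by (rule smooth_on_subset[OF smv _ openU]) simp
      have smG: "smooth_on ?U (\<lambda>y. t + arctan (Im (?v y) / Re (?v y)))"
        by (intro smooth_intros smv' openU) auto
      have val: "0 < Re (?v y) \<and> t + arctan (Im (?v y) / Re (?v y)) = (?\<phi> \<circ> \<pi>) y"
        if "y \<in> X" "y \<in> U" for y
      proof -
        obtain s where s: "y \<in> S0" "s \<in> ?J" "\<omega> y = cis s" "\<pi> y = u s" using X[OF \<open>y \<in> X\<close>] by blast
        have g: "g y = cis s" using U(3)[OF s(1) \<open>y \<in> U\<close>] s(3) by simp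
        have b: "- (pi / 2) < s - t" "s - t < pi / 2"
          using s(2) d(2) unfolding mem_ball dist_real_def by linarith+
        have "arctan (sin (s - t) / cos (s - t)) = s - t"
          using arctan_tan[OF b] by (simp add: tan_def)
        then show ?thesis
          using cos_gt_zero_pi[OF b] s \<phi>[OF s(2)] unfolding g Re_cis_rotate by simp
      qed
      show "\<exists>U g. x \<in> U \<and> smooth_on U g \<and> (\<forall>y\<in>X \<inter> U. g y = (?\<phi> \<circ> \<pi>) y)"
      proof (intro exI conjI ballI)
        show "x \<in> ?U" using val[OF x U(1)] U(1) by simp
        show "smooth_on ?U (\<lambda>y. t + arctan (Im (?v y) / Re (?v y)))" by (rule smG)
        show "t + arctan (Im (?v y) / Re (?v y)) = (?\<phi> \<circ> \<pi>) y" if "y \<in> X \<inter> ?U" for y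
          using val[of y] that by blast
      qed
    qed
    have image: "?\<phi> ` u ` ?J = ?J"
      using \<phi> by (auto simp: image_image)
    have "\<exists>J \<gamma>. ?\<phi> p \<in> J \<and> smooth_on J \<gamma> \<and>
        (\<forall>s\<in>J. \<gamma> s \<in> S \<and> \<pi> (\<gamma> s) \<in> u ` ?J \<and> ?\<phi> (\<pi> (\<gamma> s)) = s)" if "p \<in> u ` ?J" for p
    proof (intro exI conjI ballI)
      show "?\<phi> p \<in> ?J" using that \<phi> by auto
      show "smooth_on ?J c" by (rule smooth_on_subset[OF c(1)]) simp_all
      show "c s \<in> S" "\<pi> (c s) \<in> u ` ?J" "?\<phi> (\<pi> (c s)) = s" if "s \<in> ?J" for s
        using c(2) S0S \<phi>[OF that] that by (auto simp: u_def)
    qed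
    moreover have "u ` ?J \<subseteq> \<pi> ` S" using c(2) S0S by (auto simp: u_def)
    moreover have "inj_on ?\<phi> (u ` ?J)" by (rule inj_on_inv_into) simp
    moreover have "open (?\<phi> ` u ` ?J)" unfolding image by simp
    ultimately show ?thesis
      using openX smX unfolding quotient_atlas_def X_def by blast
  qed
  show "circle_param (quotient_atlas S \<pi>) (\<lambda>t. \<pi> (c t))"
    unfolding circle_param_def u_def[symmetric] using eq chart by simp
qed

lemma circle_cover_quotient_atlas:
  assumes "\<And>u. u \<in> P \<Longrightarrow> circle_param (quotient_atlas S \<pi>) u" "\<pi> ` S = (\<Union>u\<in>P. range u)"
    and "\<And>u v. u \<in> P \<Longrightarrow> v \<in> P \<Longrightarrow> u \<noteq> v \<Longrightarrow> range u \<inter> range v = {}"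
  shows "circle_cover (quotient_atlas S \<pi>) P"
proof -
  have "carrier (quotient_atlas S \<pi>) \<subseteq> \<pi> ` S" by (auto simp: carrier_def quotient_atlas_def)
  moreover have "u t \<in> carrier (quotient_atlas S \<pi>)" if "u \<in> P" for u t
    by (rule circle_param_in_carrier[OF assms(1)[OF that]])
  ultimately have "carrier (quotient_atlas S \<pi>) = (\<Union>u\<in>P. range u)"
    by (intro equalityI UN_least image_subsetI) (simp_all only: assms(2))
  then show ?thesis using assms(1,3) by (simp add: circle_cover_def)
qed

text \<open>Used to see that the circles in the moduli space are connected.\<close>

lemma continuous_map_quotient_curve:
  assumes "continuous_on UNIV c" "range c \<subseteq> S"
  shows "continuous_map euclidean (quotient_topology (top_of_set S) \<pi>) (\<lambda>t. \<pi> (c t))"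
proof -
  have "continuous_map euclidean (top_of_set S) c"
    using assms by (simp add: continuous_map_in_subtopology image_subset_iff_funcset)
  from continuous_map_compose[OF this quotient_imp_continuous_map[OF quotient_map_quotient_topology]]
  show ?thesis by (simp add: o_def)
qed

lemma connected_components_of_partition:
  assumes "\<And>K. K \<in> \<K> \<Longrightarrow> connectedin X K" "\<And>K. K \<in> \<K> \<Longrightarrow> openin X K" "\<And>K. K \<in> \<K> \<Longrightarrow> K \<noteq> {}"
    and "\<Union>\<K> = topspace X" "pairwise disjnt \<K>"
  shows "connected_components_of X = \<K>"
proof -
  have comp: "connected_component_of_set X x = K" if K: "K \<in> \<K>" and x: "x \<in> K" for x K
  proof
    show "K \<subseteq> connected_component_of_set X x"
      by (rule connected_component_of_maximal[OF assms(1)[OF K] x])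
    have "L \<inter> K = {}" if "L \<in> \<K> - {K}" for L
      using pairwiseD[OF assms(5), of L K] that K by (simp add: disjnt_def)
    then have "topspace X - K = \<Union>(\<K> - {K})"
      unfolding assms(4)[symmetric] by blast
    then have "closedin X K"
      using assms(2) openin_subset[OF assms(2)[OF K]] by (auto simp: closedin_def)
    moreover have "x \<in> connected_component_of_set X x"
      using openin_subset[OF assms(2)[OF K]] x by (auto simp: connected_component_of_refl)
    ultimately show "connected_component_of_set X x \<subseteq> K"
      using connectedin_clopen_cases[OF connectedin_connected_component_of _ assms(2)[OF K], of x] x
      unfolding disjnt_def by blast
  qed
  show ?thesis
    unfolding connected_components_of_def
  proof (intro equalityI subsetI)
    fix C assume "C \<in> connected_component_of_set X ` topspace X"
    then show "C \<in> \<K>" using comp assms(4) by blast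
  next
    fix C assume C: "C \<in> \<K>"
    then obtain x where "x \<in> C" using assms(3) by blast
    then show "C \<in> connected_component_of_set X ` topspace X"
      using comp[OF C] assms(4) C by blast
  qed
qed

section \<open>Coordinates on the moduli space of a quadrilateral\<close>

locale nondegenerate_linkage =
  fixes a b c d :: real
  assumes linkage: "quadrilateral_linkage a b c d" and nondeg: "nondegenerate a b c d"
begin

text \<open>\<open>P\<close> and \<open>Q\<close> below are the unit complex numbers whose arguments are the angles of the quadrilateral at its second
and fourth vertex, so the argument of \<open>W\<close> is the sum of two opposite angles; \<open>y\<close> is twice the signed area.
Computing the length of the diagonal between the first and third vertex on both sides gives the closing relation
\<open>\<alpha> Re P - \<beta> Re Q = k\<close>, and Bretschneider's formula for the area reads \<open>y\<^sup>2 = m - n Re W\<close>.\<close>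

definition \<alpha> where "\<alpha> = a * b"
definition \<beta> where "\<beta> = c * d"
definition k where "k = (a\<^sup>2 + b\<^sup>2 - c\<^sup>2 - d\<^sup>2) / 2"
definition m where "m = \<alpha>\<^sup>2 + \<beta>\<^sup>2 - k\<^sup>2"
definition n where "n = 2 * \<alpha> * \<beta>"
definition r where "r = (a * c) / (b * d)"

definition P :: "quadruple \<Rightarrow> complex" where
  "P V = of_real (b / a) * (fst V - fst (snd V)) / (fst (snd (snd V)) - fst (snd V))"

definition Q :: "quadruple \<Rightarrow> complex" where
  "Q V = of_real (d / c) * (fst (snd (snd V)) - snd (snd (snd V))) / (fst V - snd (snd (snd V)))"

definition W :: "quadruple \<Rightarrow> complex" where
  "W V = P V * Q V"

definition y :: "quadruple \<Rightarrow> real" where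
  "y V = \<alpha> * Im (P V) + \<beta> * Im (Q V)"

lemma pos: "a > 0" "b > 0" "c > 0" "d > 0"
  using linkage by (simp_all add: quadrilateral_linkage_def)

lemma nonzero: "a \<noteq> 0" "b \<noteq> 0" "c \<noteq> 0" "d \<noteq> 0"
  using pos by simp_all

lemma strict: "d < a + b + c" "c < a + b + d" "b < a + c + d" "a < b + c + d"
  and signs: "a + b - c - d \<noteq> 0" "a - b + c - d \<noteq> 0" "a - b - c + d \<noteq> 0"
proof -
  have *: "a + s * b + t * c + u * d \<noteq> 0" if "s \<in> {1, -1}" "t \<in> {1, -1}" "u \<in> {1, -1}" for s t u
    using nondeg that unfolding nondegenerate_def by blast
  show "d < a + b + c" "c < a + b + d" "b < a + c + d" "a < b + c + d"
    using linkage *[of 1 1 "-1"] *[of 1 "-1" 1] *[of "-1" 1 1] *[of "-1" "-1" "-1"]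
    by (simp_all add: quadrilateral_linkage_def)
  show "a + b - c - d \<noteq> 0" "a - b + c - d \<noteq> 0" "a - b - c + d \<noteq> 0"
    using *[of 1 "-1" "-1"] *[of "-1" 1 "-1"] *[of "-1" "-1" 1] by simp_all
qed

lemma n_pos: "n > 0" and r_pos: "r > 0"
  using pos by (simp_all add: n_def \<alpha>_def \<beta>_def r_def)

text \<open>Each factor is the excess of the sum of three sides over the fourth.\<close>

lemma m_plus_n: "m + n > 0"
proof -
  have eq: "m + n = ((c + d + a - b) * (c + d + b - a) / 2) * ((a + b + c - d) * (a + b + d - c) / 2)"
    by (simp add: m_def n_def \<alpha>_def \<beta>_def k_def power2_eq_square) algebra
  show ?thesis unfolding eq by (intro mult_pos_pos divide_pos_pos) (use strict in linarith)+
qed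

text \<open>The factors are the signed sums of the sides with two minus signs, and the perimeter. The sign of the product
decides between one and two components.\<close>

lemma m_neq_n: "m \<noteq> n"
proof -
  have "m - n = - ((a - b + c - d) * (a - b - c + d) / 2) * ((a + b - c - d) * (a + b + c + d) / 2)"
    by (simp add: m_def n_def \<alpha>_def \<beta>_def k_def power2_eq_square) algebra
  moreover have "a + b + c + d \<noteq> 0" using pos by linarith
  ultimately have "m - n \<noteq> 0" using signs by simp
  then show ?thesis by simp
qed

lemma unit_norm: "cmod z = 1 \<Longrightarrow> (Re z)\<^sup>2 + (Im z)\<^sup>2 = 1"
  by (metis cmod_power2 one_power2)

lemma law_of_cosines:
  assumes "cmod z = 1"
  shows "(cmod (of_real s * z - of_real t))\<^sup>2 = s\<^sup>2 + t\<^sup>2 - 2 * s * t * Re z"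
proof -
  have "(cmod (of_real s * z - of_real t))\<^sup>2 = s\<^sup>2 * ((Re z)\<^sup>2 + (Im z)\<^sup>2) + t\<^sup>2 - 2 * s * t * Re z"
    unfolding cmod_power2 by (simp add: power2_eq_square algebra_simps)
  then show ?thesis by (simp add: unit_norm[OF assms])
qed

abbreviation "S \<equiv> configurations a b c d"
abbreviation "proj \<equiv> moduli_proj a b c d"

lemma configuration:
  assumes "(v1, v2, v3, v4) \<in> S"
  shows "v3 \<noteq> v2" "v1 \<noteq> v4"
    and "v1 - v2 = of_real (a / b) * P (v1, v2, v3, v4) * (v3 - v2)"
    and "v3 - v4 = of_real (c / d) * Q (v1, v2, v3, v4) * (v1 - v4)"
    and "cmod (P (v1, v2, v3, v4)) = 1" "cmod (Q (v1, v2, v3, v4)) = 1"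
proof -
  have e: "cmod (v1 - v2) = a" "cmod (v3 - v2) = b" "cmod (v3 - v4) = c" "cmod (v1 - v4) = d"
    using assms by (simp_all add: configurations_def norm_minus_commute)
  show ne: "v3 \<noteq> v2" "v1 \<noteq> v4" using e pos by auto
  show "v1 - v2 = of_real (a / b) * P (v1, v2, v3, v4) * (v3 - v2)"
    "v3 - v4 = of_real (c / d) * Q (v1, v2, v3, v4) * (v1 - v4)"
    using ne nonzero by (simp_all add: P_def Q_def)
  show "cmod (P (v1, v2, v3, v4)) = 1" "cmod (Q (v1, v2, v3, v4)) = 1"
    using e pos by (simp_all add: P_def Q_def norm_mult norm_divide)
qed

lemma closing_relation:
  assumes "(v1, v2, v3, v4) \<in> S"
  shows "\<alpha> * Re (P (v1, v2, v3, v4)) - \<beta> * Re (Q (v1, v2, v3, v4)) = k"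
proof -
  define p q where "p = P (v1, v2, v3, v4)" and "q = Q (v1, v2, v3, v4)"
  note conf = configuration[OF assms, folded p_def q_def]
  have e: "cmod (v3 - v2) = b" "cmod (v1 - v4) = d"
    using assms by (simp_all add: configurations_def norm_minus_commute)
  have "v1 - v3 = (v1 - v2) - (v3 - v2)" by simp
  also have "\<dots> = (of_real a * p - of_real b) * (v3 - v2) / of_real b"
    unfolding conf(3) using nonzero by (simp add: field_simps)
  finally have 1: "cmod (v1 - v3) = cmod (of_real a * p - of_real b)"
    using e pos by (simp add: norm_mult norm_divide)
  have "v3 - v1 = (v3 - v4) - (v1 - v4)" by simp
  also have "\<dots> = (of_real c * q - of_real d) * (v1 - v4) / of_real d"
    unfolding conf(4) using nonzero by (simp add: field_simps)
  finally have 2: "cmod (v3 - v1) = cmod (of_real c * q - of_real d)"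
    using e pos by (simp add: norm_mult norm_divide)
  have "cmod (of_real a * p - of_real b) = cmod (of_real c * q - of_real d)"
    using 1 2 norm_minus_commute[of v1 v3] by simp
  then have "a\<^sup>2 + b\<^sup>2 - 2 * a * b * Re p = c\<^sup>2 + d\<^sup>2 - 2 * c * d * Re q"
    using law_of_cosines[OF conf(5), of a b] law_of_cosines[OF conf(6), of c d] by simp
  then show ?thesis
    unfolding p_def[symmetric] q_def[symmetric] by (simp add: \<alpha>_def \<beta>_def k_def field_simps)
qed

text \<open>The diagonal can only collapse when \<open>a = b\<close> and \<open>c = d\<close>, which contradicts non-degeneracy.\<close>

lemma diagonal_nonzero:
  assumes "cmod p = 1" "cmod q = 1" "\<alpha> * Re p - \<beta> * Re q = k"
  shows "of_real a * p - of_real b \<noteq> 0" "of_real c * q - of_real d \<noteq> 0"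
proof -
  have eq: "(cmod (of_real a * p - of_real b))\<^sup>2 = (cmod (of_real c * q - of_real d))\<^sup>2"
    unfolding law_of_cosines[OF assms(1)] law_of_cosines[OF assms(2)]
    using assms(3) by (simp add: \<alpha>_def \<beta>_def k_def field_simps)
  have "\<not> (of_real a * p = of_real b \<and> of_real c * q = of_real d)"
  proof
    assume *: "of_real a * p = of_real b \<and> of_real c * q = of_real d"
    then have "cmod (of_real a * p) = b" "cmod (of_real c * q) = d" using pos by simp_all
    then have "a = b" "c = d" using assms(1,2) pos by (simp_all add: norm_mult)
    then show False using signs(2) by simp
  qed
  moreover have "of_real a * p - of_real b = 0 \<longleftrightarrow> of_real c * q - of_real d = 0"
    using eq by (metis norm_eq_zero power_eq_0_iff power_zero_numeral zero_power2)
  ultimately show "of_real a * p - of_real b \<noteq> 0" "of_real c * q - of_real d \<noteq> 0" by auto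
qed

lemma congruent_imp_same_ratios:
  assumes "(V, V') \<in> congruence a b c d"
  shows "P V = P V'" "Q V = Q V'"
proof -
  obtain v1 v2 v3 v4 u w where V: "V = (v1, v2, v3, v4)"
      "V' = (u * v1 + w, u * v2 + w, u * v3 + w, u * v4 + w)" "cmod u = 1"
    using assms by (auto simp: congruence_def direct_isometries_def)
  have "u \<noteq> 0" using V(3) by auto
  have diff: "(u * x + w) - (u * x' + w) = u * (x - x')" for x x' by (simp add: algebra_simps)
  have cancel: "s * (u * x) / (u * x') = s * x / x'" for s x x' :: complex
    using \<open>u \<noteq> 0\<close> by simp
  show "P V = P V'" "Q V = Q V'"
    unfolding V(1,2) P_def Q_def fst_conv snd_conv diff cancel by (rule refl)+
qed

text \<open>The first three vertices are determined by \<open>P\<close> up to a rotation and a translation; the fourth vertex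
  is then the solution of a linear equation with the nonzero coefficient \<open>1 - (c/d) Q\<close>.\<close>

lemma same_ratios_imp_congruent:
  assumes V: "V \<in> S" and V': "V' \<in> S" and PQ: "P V = P V'" "Q V = Q V'"
  shows "(V, V') \<in> congruence a b c d"
proof -
  obtain v1 v2 v3 v4 where v: "V = (v1, v2, v3, v4)" by (cases V)
  obtain w1 w2 w3 w4 where w: "V' = (w1, w2, w3, w4)" by (cases V')
  note cv = configuration[OF V[unfolded v], folded v]
  note cw = configuration[OF V'[unfolded w], folded w]
  define u where "u = (w3 - w2) / (v3 - v2)"
  define g where "g z = u * z + (w2 - u * v2)" for z
  have "cmod (v3 - v2) = b" "cmod (w3 - w2) = b"
    using V V' by (simp_all add: v w configurations_def)
  then have "cmod u = 1" using pos by (simp add: u_def norm_divide)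
  then have g: "g \<in> direct_isometries" unfolding g_def direct_isometries_def by blast
  have uv: "u * (v3 - v2) = w3 - w2" using cv(1) by (simp add: u_def)
  have g2: "g v2 = w2" by (simp add: g_def)
  have g3: "g v3 = w3" using uv by (simp add: g_def algebra_simps)
  have "w1 - w2 = of_real (a / b) * P V' * (u * (v3 - v2))" unfolding uv by (rule cw(3))
  also have "\<dots> = u * (v1 - v2)" unfolding cv(3) PQ by (simp only: mult_ac)
  finally have g1: "g v1 = w1" by (simp add: g_def algebra_simps)
  define q where "q = of_real (c / d) * Q V"
  have "of_real c * Q V - of_real d \<noteq> 0"
    using diagonal_nonzero(2)[OF cv(5,6)] closing_relation[OF V[unfolded v]] by (simp add: v)
  then have q1: "1 - q \<noteq> 0" using nonzero by (simp add: q_def field_simps)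
  have "v3 - v4 = q * (v1 - v4)" "w3 - w4 = q * (w1 - w4)"
    using cv(4) cw(4) by (simp_all add: q_def PQ)
  then have "v4 * (1 - q) = v3 - q * v1" "w4 * (1 - q) = w3 - q * w1" by (simp_all add: algebra_simps)
  moreover have "g v4 * (1 - q) = u * (v4 * (1 - q)) + (w2 - u * v2) * (1 - q)"
    by (simp add: g_def algebra_simps)
  moreover have "g v3 - q * g v1 = u * (v3 - q * v1) + (w2 - u * v2) * (1 - q)"
    by (simp add: g_def algebra_simps)
  ultimately have "g v4 * (1 - q) = w4 * (1 - q)" using g1 g3 by simp
  then have "g v4 = w4" using q1 by simp
  then show ?thesis
    unfolding congruence_def v w using V V' g g1 g2 g3 by (auto simp: v w intro!: bexI[of _ g])
qed

lemma W_unit: "V \<in> S \<Longrightarrow> cmod (W V) = 1"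
  using configuration(5,6) by (cases V) (simp add: W_def norm_mult)

lemma area_equation:
  assumes "cmod w = 1"
  shows "cmod (of_real \<alpha> * w - of_real \<beta>) ^ 2 = m + k\<^sup>2 - n * Re w"
  unfolding law_of_cosines[OF assms] by (simp add: m_def n_def)

text \<open>If \<open>\<alpha> w = \<beta>\<close> then \<open>\<alpha> = \<beta>\<close> and \<open>w = 1\<close>, and the area equation forces \<open>k = t = 0\<close>, hence \<open>m = n\<close>.\<close>

lemma W_nonzero:
  assumes "cmod w = 1" "t\<^sup>2 = m - n * Re w"
  shows "of_real \<alpha> * w - of_real \<beta> \<noteq> (0::complex)"
proof
  assume 0: "of_real \<alpha> * w - of_real \<beta> = (0::complex)"
  have ab: "\<alpha> > 0" "\<beta> > 0" using pos by (simp_all add: \<alpha>_def \<beta>_def)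
  have "k\<^sup>2 + t\<^sup>2 = 0" using area_equation[OF assms(1)] assms(2) 0 by simp
  then have kt: "t = 0" by (simp add: sum_power2_eq_zero_iff)
  have "cmod (of_real \<alpha> * w) = \<beta>" using 0 ab by simp
  then have "\<alpha> = \<beta>" using ab assms(1) by (simp add: norm_mult)
  then have "w = 1" using 0 ab by simp
  then show False using assms(2) kt m_neq_n by simp
qed

text \<open>For \<open>Z = \<alpha> P - \<beta> \<bar>Q\<bar>\<close>, with the bar for conjugation, the closing relation says \<open>Re Z = k\<close>, while \<open>Im Z = y\<close>
  and \<open>Q Z = \<alpha> W - \<beta>\<close>. So \<open>W\<close> and \<open>y\<close> determine \<open>Q\<close> and then \<open>P\<close>.\<close>

lemma ratios_from_W_y:
  assumes "V \<in> S"
  shows "cnj (Q V) * (of_real \<alpha> * W V - of_real \<beta>) = Complex k (y V)" "P V = W V * cnj (Q V)"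
    and "(y V)\<^sup>2 = m - n * Re (W V)"
proof -
  obtain v1 v2 v3 v4 where v: "V = (v1, v2, v3, v4)" by (cases V)
  note conf = configuration[OF assms[unfolded v], folded v]
  have QQ: "Q V * cnj (Q V) = 1" using conf(6) by (simp add: complex_norm_square[symmetric])
  show PW: "P V = W V * cnj (Q V)" unfolding W_def mult.assoc QQ by simp
  have "cnj (Q V) * (of_real \<alpha> * W V - of_real \<beta>)
      = of_real \<alpha> * (W V * cnj (Q V)) - of_real \<beta> * cnj (Q V)"
    by (simp add: algebra_simps)
  also have "\<dots> = of_real \<alpha> * P V - of_real \<beta> * cnj (Q V)" unfolding PW ..
  also have "\<dots> = Complex k (y V)"
    using closing_relation[OF assms[unfolded v], folded v] by (simp add: complex_eq_iff y_def)
  finally show Z: "cnj (Q V) * (of_real \<alpha> * W V - of_real \<beta>) = Complex k (y V)" .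
  have "cmod (Complex k (y V)) ^ 2 = m + k\<^sup>2 - n * Re (W V)"
    unfolding Z[symmetric] norm_mult using conf(6) area_equation[OF W_unit[OF assms]] by simp
  then show "(y V)\<^sup>2 = m - n * Re (W V)" by (simp add: cmod_power2)
qed

lemma same_point_iff:
  assumes "V \<in> S" "V' \<in> S"
  shows "proj V = proj V' \<longleftrightarrow> W V = W V' \<and> y V = y V'"
proof -
  have "proj V = proj V' \<longleftrightarrow> (V, V') \<in> congruence a b c d"
    unfolding moduli_proj_def by (rule eq_equiv_class_iff[OF equiv_congruence assms])
  also have "\<dots> \<longleftrightarrow> P V = P V' \<and> Q V = Q V'"
    using congruent_imp_same_ratios same_ratios_imp_congruent[OF assms] by blast
  also have "\<dots> \<longleftrightarrow> W V = W V' \<and> y V = y V'"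
  proof
    assume *: "W V = W V' \<and> y V = y V'"
    have "cnj (Q V) * (of_real \<alpha> * W V - of_real \<beta>) = cnj (Q V') * (of_real \<alpha> * W V - of_real \<beta>)"
      using ratios_from_W_y(1)[OF assms(1)] ratios_from_W_y(1)[OF assms(2)] * by simp
    then have "cnj (Q V) = cnj (Q V')"
      using W_nonzero[OF W_unit[OF assms(1)] ratios_from_W_y(3)[OF assms(1)]] by simp
    then show "P V = P V' \<and> Q V = Q V'"
      using ratios_from_W_y(2)[OF assms(1)] ratios_from_W_y(2)[OF assms(2)] * by simp
  qed (simp add: W_def y_def)
  finally show ?thesis .
qed

text \<open>The solution for \<open>Q\<close> of the equations that express \<open>k\<close> and \<open>y\<close> in terms of \<open>W\<close> and \<open>Q\<close>.\<close>

definition Q_section :: "complex \<Rightarrow> real \<Rightarrow> complex" where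
  "Q_section w t = cnj ((of_real k + \<i> * of_real t) / (of_real \<alpha> * w - of_real \<beta>))"

text \<open>The configuration with given \<open>W\<close> and \<open>y\<close> in the position where the second vertex is \<open>0\<close> and the third is \<open>b\<close>.\<close>

definition config_section :: "complex \<Rightarrow> real \<Rightarrow> quadruple" where
  "config_section w t =
     (of_real a * (w * cnj (Q_section w t)), 0, of_real b,
      (of_real (d * b) - of_real (a * c) * w) / (of_real d - of_real c * Q_section w t))"

lemma config_section:
  assumes w: "cmod w = 1" and t: "t\<^sup>2 = m - n * Re w"
  shows "config_section w t \<in> S" "W (config_section w t) = w" "y (config_section w t) = t"
    and "of_real d - of_real c * Q_section w t \<noteq> 0"
proof -
  define q p where "q = Q_section w t" and "p = w * cnj q"
  note nz = W_nonzero[OF w t]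
  have cq: "cnj q * (of_real \<alpha> * w - of_real \<beta>) = Complex k t"
    using nz by (simp add: q_def Q_section_def Complex_eq)
  have "cmod (cnj q) * cmod (of_real \<alpha> * w - of_real \<beta>) = cmod (Complex k t)"
    unfolding cq[symmetric] norm_mult ..
  moreover have "cmod (Complex k t) ^ 2 = cmod (of_real \<alpha> * w - of_real \<beta>) ^ 2"
    unfolding area_equation[OF w] using t by (simp add: cmod_power2)
  then have "cmod (Complex k t) = cmod (of_real \<alpha> * w - of_real \<beta>)" by (simp add: power2_eq_iff_nonneg)
  ultimately have q1: "cmod q = 1" using nz by simp
  then have p1: "cmod p = 1" using w by (simp add: p_def norm_mult)
  have qq: "q * cnj q = 1" using q1 by (simp add: complex_norm_square[symmetric])
  have pq: "p * q = w" unfolding p_def mult.assoc mult.commute[of "cnj q"] qq by simp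
  have "of_real \<alpha> * p - of_real \<beta> * cnj q = cnj q * (of_real \<alpha> * w - of_real \<beta>)"
    by (simp add: p_def algebra_simps)
  then have Z: "of_real \<alpha> * p - of_real \<beta> * cnj q = Complex k t" unfolding cq .
  have Re: "\<alpha> * Re p - \<beta> * Re q = k" and Im: "\<alpha> * Im p + \<beta> * Im q = t"
    using arg_cong[OF Z, of Re] arg_cong[OF Z, of Im] by simp_all
  note dn = diagonal_nonzero[OF p1 q1 Re]
  define D where "D = of_real d - of_real c * q"
  have D: "D \<noteq> 0" using dn(2) by (simp add: D_def)
  then show "of_real d - of_real c * Q_section w t \<noteq> 0" by (simp add: D_def q_def)
  define v4 where "v4 = (of_real (d * b) - of_real (a * c) * w) / D"
  have sec: "config_section w t = (of_real a * p, 0, of_real b, v4)"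
    by (simp add: config_section_def p_def q_def v4_def D_def)
  have v4b: "of_real b - v4 = of_real c * q * (of_real a * p - of_real b) / D"
    using D pq by (simp add: v4_def field_simps D_def)
  have v4a: "of_real a * p - v4 = of_real d * (of_real a * p - of_real b) / D"
    using D pq by (simp add: v4_def field_simps D_def)
  have "(cmod D)\<^sup>2 = (cmod (of_real a * p - of_real b))\<^sup>2"
    unfolding D_def norm_minus_commute[of "of_real d"] law_of_cosines[OF q1] law_of_cosines[OF p1]
    using Re by (simp add: \<alpha>_def \<beta>_def k_def field_simps)
  then have nD: "cmod (of_real a * p - of_real b) = cmod D" by (simp add: power2_eq_iff_nonneg)
  have "cmod (of_real b - v4) = c" "cmod (of_real a * p - v4) = d"
    unfolding v4b v4a norm_divide norm_mult nD using D q1 pos by simp_all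
  then show "config_section w t \<in> S"
    unfolding sec configurations_def using p1 pos by (simp add: norm_mult norm_minus_commute)
  have Psec: "P (config_section w t) = p" using nonzero by (simp add: sec P_def)
  have Qsec: "Q (config_section w t) = q"
    unfolding Q_def sec fst_conv snd_conv v4b v4a using D dn(1) nonzero by simp
  show "W (config_section w t) = w" unfolding W_def Psec Qsec by (rule pq)
  show "y (config_section w t) = t" unfolding y_def Psec Qsec by (rule Im)
qed

text \<open>\<open>r W\<close> is the quotient \<open>R = (v\<^sub>2 - v\<^sub>1) (v\<^sub>4 - v\<^sub>3) / ((v\<^sub>2 - v\<^sub>3) (v\<^sub>4 - v\<^sub>1))\<close>, and \<open>Cr = 1 - R\<close> is an
identity between cross-ratios of four points.\<close>

lemma cross_ratio_W:
  assumes "V \<in> S"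
  shows "cross_ratio V = 1 - of_real r * W V"
proof -
  obtain v1 v2 v3 v4 where v: "V = (v1, v2, v3, v4)" by (cases V)
  note conf = configuration[OF assms[unfolded v], folded v]
  have ne: "v3 - v2 \<noteq> 0" "v1 - v4 \<noteq> 0" "v4 - v1 \<noteq> 0" using conf(1,2) by auto
  have "of_real r * W V = ((v1 - v2) * (v3 - v4)) / ((v3 - v2) * (v1 - v4))"
    using nonzero by (simp add: r_def W_def P_def Q_def v)
  also have "\<dots> = - (((v1 - v2) * (v3 - v4)) / ((v3 - v2) * (v4 - v1)))"
  proof -
    have "(v3 - v2) * (v1 - v4) = - ((v3 - v2) * (v4 - v1))" by (simp add: algebra_simps)
    then show ?thesis by (simp only: divide_minus_right)
  qed
  finally have "1 - of_real r * W V = 1 + ((v1 - v2) * (v3 - v4)) / ((v3 - v2) * (v4 - v1))" by simp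
  also have "\<dots> = ((v3 - v2) * (v4 - v1) + (v1 - v2) * (v3 - v4)) / ((v3 - v2) * (v4 - v1))"
    using ne by (simp add: add_divide_distrib)
  also have "(v3 - v2) * (v4 - v1) + (v1 - v2) * (v3 - v4) = (v3 - v1) * (v4 - v2)" by algebra
  finally show ?thesis by (simp add: v)
qed

lemma smooth_coordinates:
  obtains U where "S \<subseteq> U" "smooth_on U W" "smooth_on U y"
proof -
  define U :: "quadruple set" where
    "U = {V. fst (snd (snd V)) \<noteq> fst (snd V)} \<inter> {V. fst V \<noteq> snd (snd (snd V))}"
  have U: "open U" unfolding U_def by (intro open_Int open_Collect_neq continuous_intros)
  have SU: "S \<subseteq> U"
  proof
    fix V assume "V \<in> S"
    then show "V \<in> U" using configuration(1,2) by (cases V) (simp add: U_def)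
  qed
  have PQ: "smooth_on U P" "smooth_on U Q"
    unfolding P_def[abs_def] Q_def[abs_def]
    by (intro smooth_intros U; simp add: U_def)+
  have "smooth_on U W" unfolding W_def[abs_def] by (intro smooth_intros PQ)
  moreover have "smooth_on U y" unfolding y_def[abs_def] by (intro smooth_intros PQ U)
  ultimately show thesis using that SU by blast
qed

lemma smooth_config_section:
  assumes "smooth_on UNIV w" "smooth_on UNIV t"
    and "\<And>s. cmod (w s) = 1" "\<And>s. (t s)\<^sup>2 = m - n * Re (w s)"
  shows "smooth_on UNIV (\<lambda>s::real. config_section (w s) (t s))"
proof -
  have "smooth_on UNIV (\<lambda>s. Q_section (w s) (t s))"
    unfolding Q_section_def using W_nonzero[OF assms(3,4)]
    by (intro smooth_intros assms open_UNIV)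
  then show ?thesis
    unfolding config_section_def using config_section(4)[OF assms(3,4)]
    by (intro smooth_intros assms open_UNIV)
qed

lemma target_circle_cover:
  "circle_cover (submanifold_atlas (target_circle a b c d)) {\<lambda>t. 1 - of_real r * cis t}"
proof -
  let ?C = "target_circle a b c d"
  let ?\<omega> = "\<lambda>z. (1 - z) / of_real r :: complex"
  have rn: "of_real r \<noteq> (0 :: complex)" using r_pos by simp
  have C: "z \<in> ?C \<longleftrightarrow> cmod (?\<omega> z) = 1" for z
    using r_pos by (simp add: target_circle_def r_def[symmetric] norm_divide norm_minus_commute divide_eq_eq)
  have sm\<omega>: "smooth_on UNIV ?\<omega>" using rn by (intro smooth_intros open_UNIV)
  have \<omega>: "?\<omega> (1 - of_real r * cis t) = cis t" for t using rn by simp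
  have 1: "openin (top_of_set ?C) ?C" by simp
  have 2: "smooth_on_subset ?C ?\<omega>" by (rule smooth_on_imp_smooth_on_subset[OF sm\<omega>]) simp
  have 3: "smooth_on UNIV (\<lambda>t. 1 - of_real r * cis t)" by (intro smooth_intros open_UNIV)
  have 4: "1 - of_real r * cis t \<in> ?C" for t unfolding C \<omega> by simp
  have 5: "z = z' \<longleftrightarrow> z \<in> ?C \<and> ?\<omega> z = ?\<omega> z'" if "z \<in> ?C" "z' \<in> ?C" for z z'
    using that rn by auto
  note par = circle_param_quotient_atlas[where \<pi> = "\<lambda>z. z" and \<omega> = ?\<omega>, OF 1 2 _ 3 4 \<omega> 5]
  show ?thesis
    unfolding submanifold_atlas_def
  proof (rule circle_cover_quotient_atlas)
    fix u assume "u \<in> {\<lambda>t. 1 - of_real r * cis t}"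
    then have u: "u = (\<lambda>t. 1 - of_real r * cis t)" by simp
    show "circle_param (quotient_atlas ?C (\<lambda>x. x)) u"
      unfolding u by (rule par(1)) (simp_all add: C)
  next
    have "range (\<lambda>t. 1 - of_real r * cis t) = (\<lambda>z. z) ` ?C"
      by (rule par(2)) (simp_all add: C)
    then show "(\<lambda>z. z) ` ?C = (\<Union>u\<in>{\<lambda>t. 1 - of_real r * cis t}. range u)" by simp
  qed simp
qed

end

section \<open>The image of the fold\<close>

lemma fold_angle_image:
  assumes \<kappa>: "0 < \<kappa>" "\<kappa> < 1"
  shows "range (\<lambda>t. 2 * arcsin (\<kappa> * sin t)) = {- (2 * arcsin \<kappa>)..2 * arcsin \<kappa>}"
proof (intro equalityI subsetI)
  fix x assume "x \<in> range (\<lambda>t. 2 * arcsin (\<kappa> * sin t))"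
  then obtain t where t: "x = 2 * arcsin (\<kappa> * sin t)" by blast
  have "- \<kappa> \<le> \<kappa> * sin t" "\<kappa> * sin t \<le> \<kappa>"
    using \<kappa> mult_left_mono[of "- 1" "sin t" \<kappa>] mult_left_mono[of "sin t" 1 \<kappa>] by simp_all
  then have "arcsin (- \<kappa>) \<le> arcsin (\<kappa> * sin t)" "arcsin (\<kappa> * sin t) \<le> arcsin \<kappa>"
    using \<kappa> by (intro arcsin_le_arcsin; linarith)+
  then show "x \<in> {- (2 * arcsin \<kappa>)..2 * arcsin \<kappa>}" using \<kappa> by (simp add: t arcsin_minus)
next
  fix x assume x: "x \<in> {- (2 * arcsin \<kappa>)..2 * arcsin \<kappa>}"
  have b: "- (pi / 2) < arcsin \<kappa>" "arcsin \<kappa> < pi / 2" using arcsin_lt_bounded[of \<kappa>] \<kappa> by simp_all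
  then have x2: "- (pi / 2) \<le> x / 2" "x / 2 \<le> pi / 2" "- arcsin \<kappa> \<le> x / 2" "x / 2 \<le> arcsin \<kappa>"
    using x by simp_all
  have "sin (- arcsin \<kappa>) \<le> sin (x / 2)" "sin (x / 2) \<le> sin (arcsin \<kappa>)"
    using b x2 by (intro sin_monotone_2pi_le; linarith)+
  then have "- 1 \<le> sin (x / 2) / \<kappa>" "sin (x / 2) / \<kappa> \<le> 1"
    using \<kappa> by (simp_all add: divide_le_eq le_divide_eq)
  then have "sin (arcsin (sin (x / 2) / \<kappa>)) = sin (x / 2) / \<kappa>" by (rule sin_arcsin)
  then have "\<kappa> * sin (arcsin (sin (x / 2) / \<kappa>)) = sin (x / 2)" using \<kappa> by simp
  then have "x = 2 * arcsin (\<kappa> * sin (arcsin (sin (x / 2) / \<kappa>)))"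
    using arcsin_sin[OF x2(1,2)] by simp
  then show "x \<in> range (\<lambda>t. 2 * arcsin (\<kappa> * sin t))" by blast
qed

lemma circle_arc_fold:
  assumes \<kappa>: "0 < \<kappa>" "\<kappa> < 1"
  shows "circle_arc 1 r (range (\<lambda>t. 1 - of_real r * cis (fold_angle \<kappa> t)))"
  unfolding circle_arc_def
proof (intro exI conjI)
  have b: "0 < arcsin \<kappa>" "arcsin \<kappa> < pi / 2"
    using arcsin_lt_bounded[of \<kappa>] arcsin_less_arcsin[of 0 \<kappa>] \<kappa> by simp_all
  then show "- (2 * arcsin \<kappa>) < 2 * arcsin \<kappa>" "2 * arcsin \<kappa> < - (2 * arcsin \<kappa>) + 2 * pi" by simp_all
  have "1 - of_real r * cis (fold_angle \<kappa> t) = 1 + of_real r * cis (2 * arcsin (\<kappa> * sin t))" for t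
  proof -
    have "cis (fold_angle \<kappa> t) = - cis (2 * arcsin (\<kappa> * sin t))"
      unfolding fold_angle_def cis_mult[symmetric] by simp
    then show ?thesis by simp
  qed
  then have "range (\<lambda>t. 1 - of_real r * cis (fold_angle \<kappa> t))
      = (\<lambda>x. 1 + of_real r * cis x) ` range (\<lambda>t. 2 * arcsin (\<kappa> * sin t))"
    by (simp only: image_image)
  then show "range (\<lambda>t. 1 - of_real r * cis (fold_angle \<kappa> t))
      = (\<lambda>x. 1 + of_real r * cis x) ` {- (2 * arcsin \<kappa>)..2 * arcsin \<kappa>}"
    unfolding fold_angle_image[OF \<kappa>] .
qed

section \<open>The two kinds of moduli spaces\<close>

text \<open>Here \<open>s\<close> is the sine of half the angle of \<open>w\<close> measured from \<open>-1\<close>. Away from \<open>1\<close> it is a coordinate on the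
  unit circle; the formula avoids the choice of an argument.\<close>

lemma half_angle:
  assumes "cmod w = 1" "Re w < 1"
  defines "s \<equiv> - Im w / sqrt (2 * (1 - Re w))"
  shows "Re w = 2 * s\<^sup>2 - 1" "Im w = - (2 * s * sqrt (1 - s\<^sup>2))"
proof -
  have p: "2 * (1 - Re w) > 0" using assms(2) by simp
  have norm: "(Re w)\<^sup>2 + (Im w)\<^sup>2 = 1" using assms(1) by (metis cmod_power2 one_power2)
  have "s\<^sup>2 = (Im w)\<^sup>2 / (2 * (1 - Re w))" using p by (simp add: s_def power_divide)
  also have "(Im w)\<^sup>2 = (1 + Re w) * (1 - Re w)" using norm by (simp add: power2_eq_square algebra_simps)
  also have "(1 + Re w) * (1 - Re w) / (2 * (1 - Re w)) = (1 + Re w) / 2"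
    by (rule mult_divide_mult_cancel_right) (use assms(2) in simp)
  finally have s2: "s\<^sup>2 = (1 + Re w) / 2" .
  then show "Re w = 2 * s\<^sup>2 - 1" by simp
  have "2 * (1 - Re w) = 2\<^sup>2 * (1 - s\<^sup>2)" using s2 by simp
  then have "sqrt (2 * (1 - Re w)) = 2 * sqrt (1 - s\<^sup>2)" by (simp only: real_sqrt_mult real_sqrt_abs)
  moreover have "Im w = - (s * sqrt (2 * (1 - Re w)))" using p by (simp add: s_def)
  ultimately show "Im w = - (2 * s * sqrt (1 - s\<^sup>2))" by simp
qed

lemma cis_fold_angle:
  assumes \<kappa>: "0 < \<kappa>" "\<kappa> < 1"
  shows "cos (fold_angle \<kappa> t) = 2 * (\<kappa> * sin t)\<^sup>2 - 1"
    and "- sin (fold_angle \<kappa> t) / sqrt (2 * (1 - cos (fold_angle \<kappa> t))) = \<kappa> * sin t"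
proof -
  define x where "x = arcsin (\<kappa> * sin t)"
  have "\<bar>\<kappa> * sin t\<bar> < 1" by (rule fold_angle_abs_less[OF \<kappa>])
  then have x: "sin x = \<kappa> * sin t" "- (pi / 2) < x" "x < pi / 2"
    using arcsin_lt_bounded[of "\<kappa> * sin t"] by (simp_all add: x_def abs_less_iff)
  then have cx: "cos x > 0" by (intro cos_gt_zero_pi)
  have c: "cos (fold_angle \<kappa> t) = - cos (2 * x)" and s: "sin (fold_angle \<kappa> t) = - sin (2 * x)"
    by (simp_all add: fold_angle_def x_def cos_add sin_add)
  show cosf: "cos (fold_angle \<kappa> t) = 2 * (\<kappa> * sin t)\<^sup>2 - 1"
    unfolding c cos_double_sin x(1) by simp
  have "2 * (1 - cos (fold_angle \<kappa> t)) = (2 * cos x)\<^sup>2"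
    unfolding c cos_double_cos by (simp add: power2_eq_square)
  then have "sqrt (2 * (1 - cos (fold_angle \<kappa> t))) = 2 * cos x"
    using cx by (metis less_eq_real_def mult_nonneg_nonneg real_sqrt_unique zero_le_numeral)
  then show "- sin (fold_angle \<kappa> t) / sqrt (2 * (1 - cos (fold_angle \<kappa> t))) = \<kappa> * sin t"
    unfolding s sin_double x(1)[symmetric] using cx by simp
qed

context nondegenerate_linkage
begin

lemma config_curve:
  assumes "smooth_on UNIV w" "smooth_on UNIV t"
    and "\<And>s. cmod (w s) = 1" "\<And>s. (t s)\<^sup>2 = m - n * Re (w s)"
  shows "smooth_on UNIV (\<lambda>s::real. config_section (w s) (t s))"
    and "continuous_map euclideanreal (moduli_topology a b c d)
           (\<lambda>s. proj (config_section (w s) (t s)))"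
    and "Cr (proj (config_section (w s) (t s))) = 1 - of_real r * w s"
proof -
  show sm: "smooth_on UNIV (\<lambda>s::real. config_section (w s) (t s))"
    by (rule smooth_config_section[OF assms])
  show "continuous_map euclideanreal (moduli_topology a b c d)
      (\<lambda>s. proj (config_section (w s) (t s)))"
    unfolding moduli_topology_def
    by (rule continuous_map_quotient_curve[OF smooth_on_continuous_on[OF sm]])
      (use config_section(1)[OF assms(3,4)] in blast)
  show "Cr (proj (config_section (w s) (t s))) = 1 - of_real r * w s"
    using config_section(1,2)[OF assms(3,4)] by (simp add: Cr_moduli_proj cross_ratio_W)
qed

lemma moduli_space_image: "moduli_space a b c d = proj ` S"
  by (auto simp: moduli_space_def quotient_def moduli_proj_def)

text \<open>If \<open>m < n\<close> the curve \<open>y\<^sup>2 = m - n Re W\<close> is connected: with \<open>s\<close> the sine of half the angle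
  of \<open>W\<close>, measured from \<open>-1\<close>, it becomes the ellipse \<open>y\<^sup>2 + 2 n s\<^sup>2 = m + n\<close>.\<close>

lemma connected_case:
  assumes mn: "m < n"
  obtains \<kappa> u where "0 < \<kappa>" "\<kappa> < 1" "circle_cover (moduli_atlas a b c d) {u}"
    "\<And>t. Cr (u t) = 1 - of_real r * cis (fold_angle \<kappa> t)"
    "range u = moduli_space a b c d" "continuous_map euclideanreal (moduli_topology a b c d) u"
proof -
  \<comment> \<open>The half-axes of the ellipse in the directions of \<open>s\<close> and \<open>y\<close>.\<close>
  define \<kappa> where "\<kappa> = sqrt ((m + n) / (2 * n))"
  define Y where "Y = sqrt (m + n)"
  have Y: "Y > 0" "Y\<^sup>2 = m + n" using m_plus_n by (simp_all add: Y_def)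
  have \<kappa>: "0 < \<kappa>" "\<kappa> < 1" "\<kappa>\<^sup>2 = (m + n) / (2 * n)"
    using m_plus_n n_pos mn by (simp_all add: \<kappa>_def)
  define \<sigma> where "\<sigma> V = - Im (W V) / sqrt (2 * (1 - Re (W V)))" for V
  define \<omega> where "\<omega> V = of_real (y V / Y) + \<i> * of_real (\<sigma> V / \<kappa>)" for V
  have Re1: "Re (W V) < 1" if "V \<in> S" for V
  proof -
    have "n * Re (W V) = m - (y V)\<^sup>2" using ratios_from_W_y(3)[OF that] by simp
    also have "\<dots> < n * 1" using mn zero_le_power2[of "y V"] by linarith
    finally show ?thesis using n_pos by simp
  qed
  obtain U where U: "S \<subseteq> U" "smooth_on U W" "smooth_on U y" by (rule smooth_coordinates)
  define U' where "U' = (\<lambda>V. Re (W V)) -` {..<1} \<inter> U"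
  have "open U'"
    unfolding U'_def using continuous_on_open_vimage[OF smooth_on_open[OF U(2)]]
      smooth_on_continuous_on[OF smooth_on_Re[OF U(2)]] open_lessThan by blast
  have smU': "smooth_on U' W" "smooth_on U' y"
    using \<open>open U'\<close> by (auto intro: smooth_on_subset[OF U(2)] smooth_on_subset[OF U(3)] simp: U'_def)
  have U'1: "Re (W V) < 1" if "V \<in> U'" for V using that by (simp add: U'_def)
  have sm\<sigma>: "smooth_on U' \<sigma>"
    unfolding \<sigma>_def[abs_def]
    by (intro smooth_on_divide smooth_on_sqrt smooth_intros smU' \<open>open U'\<close>) (simp_all add: U'1 less_imp_neq[OF U'1])
  have "smooth_on U' \<omega>"
    unfolding \<omega>_def[abs_def]
    by (intro smooth_intros sm\<sigma> smU' \<open>open U'\<close>) (use Y(1) \<kappa>(1) in simp_all)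
  then have sm\<omega>: "smooth_on_subset S \<omega>"
    by (rule smooth_on_imp_smooth_on_subset) (use U(1) Re1 in \<open>auto simp: U'_def\<close>)
  have Re\<omega>: "Re (\<omega> V) = y V / Y" and Im\<omega>: "Im (\<omega> V) = \<sigma> V / \<kappa>" for V by (simp_all add: \<omega>_def)
  have norm\<omega>: "cmod (\<omega> V) = 1" if "V \<in> S" for V
  proof -
    have s: "Re (W V) = 2 * (\<sigma> V)\<^sup>2 - 1"
      unfolding \<sigma>_def by (rule half_angle(1)[OF W_unit[OF that] Re1[OF that]])
    have "(cmod (\<omega> V))\<^sup>2 = (y V)\<^sup>2 / (m + n) + (\<sigma> V)\<^sup>2 / ((m + n) / (2 * n))"
      by (simp add: cmod_power2 Re\<omega> Im\<omega> power_divide Y(2) \<kappa>(3))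
    also have "\<dots> = ((y V)\<^sup>2 + 2 * n * (\<sigma> V)\<^sup>2) / (m + n)"
      unfolding divide_divide_eq_right by (simp add: add_divide_distrib mult_ac)
    also have "(y V)\<^sup>2 + 2 * n * (\<sigma> V)\<^sup>2 = m + n"
      unfolding ratios_from_W_y(3)[OF that] s by (simp add: algebra_simps)
    finally have "(cmod (\<omega> V))\<^sup>2 = 1" using m_plus_n by simp
    then show ?thesis by (intro power2_eq_imp_eq[of _ 1]) simp_all
  qed
  define w where "w t = cis (fold_angle \<kappa> t)" for t
  define h where "h t = Y * cos t" for t
  have w1: "cmod (w t) = 1" for t by (simp add: w_def)
  have wh: "(h t)\<^sup>2 = m - n * Re (w t)" for t
  proof -
    have "n * (\<kappa> * sin t)\<^sup>2 * 2 = (m + n) * (sin t)\<^sup>2"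
      using n_pos by (simp add: power_mult_distrib \<kappa>(3))
    then have "m - n * Re (w t) = (m + n) * (1 - (sin t)\<^sup>2)"
      unfolding w_def cis.sel cis_fold_angle(1)[OF \<kappa>(1,2)] by (simp add: algebra_simps)
    then show ?thesis by (simp add: h_def power_mult_distrib Y(2) cos_squared_eq)
  qed
  have smw: "smooth_on UNIV w" "smooth_on UNIV h"
    unfolding w_def[abs_def] h_def[abs_def]
    by (intro smooth_intros open_UNIV fold_angle_smooth[OF \<kappa>(1,2)])+
  define cv where "cv t = config_section (w t) (h t)" for t
  note curve = config_curve[OF smw w1 wh, folded cv_def]
  note sec = config_section[OF w1 wh, folded cv_def]
  have \<omega>c: "\<omega> (cv t) = cis t" for t
  proof -
    have "\<sigma> (cv t) = \<kappa> * sin t"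
      unfolding \<sigma>_def sec(2) using cis_fold_angle(2)[OF \<kappa>(1,2), of t] by (simp add: w_def)
    then show ?thesis
      using Y(1) \<kappa>(1) by (simp add: complex_eq_iff Re\<omega> Im\<omega> sec(3) h_def)
  qed
  have fibre: "proj V = proj V' \<longleftrightarrow> V \<in> S \<and> \<omega> V = \<omega> V'"
    if V: "V \<in> S" "V' \<in> S" for V V'
  proof
    assume "proj V = proj V'"
    then show "V \<in> S \<and> \<omega> V = \<omega> V'" using same_point_iff[OF V] V by (simp add: \<omega>_def \<sigma>_def)
  next
    assume "V \<in> S \<and> \<omega> V = \<omega> V'"
    then have "Re (\<omega> V) = Re (\<omega> V')" "Im (\<omega> V) = Im (\<omega> V')" by simp_all
    then have "y V = y V'" "\<sigma> V = \<sigma> V'" using Y(1) \<kappa>(1) by (simp_all add: Re\<omega> Im\<omega>)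
    moreover from this have "W V = W V'"
      using half_angle[OF W_unit[OF V(1)] Re1[OF V(1)], folded \<sigma>_def]
        half_angle[OF W_unit[OF V(2)] Re1[OF V(2)], folded \<sigma>_def] by (simp add: complex_eq_iff)
    ultimately show "proj V = proj V'" using same_point_iff[OF V] by simp
  qed
  have openS: "openin (top_of_set S) S" by simp
  note par = circle_param_quotient_atlas[where \<pi> = "proj",
      OF openS sm\<omega> norm\<omega> curve(1) sec(1) \<omega>c fibre]
  have par1: "circle_param (moduli_atlas a b c d) (\<lambda>t. proj (cv t))"
    unfolding moduli_atlas_def by (rule par(1))
  have ran: "range (\<lambda>t. proj (cv t)) = proj ` S" by (rule par(2))
  have "circle_cover (moduli_atlas a b c d) {\<lambda>t. proj (cv t)}"
    unfolding moduli_atlas_def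
    by (rule circle_cover_quotient_atlas) (use par1 ran in \<open>simp_all add: moduli_atlas_def\<close>)
  then show thesis
    using that[OF \<kappa>(1,2) _ _ _ curve(2)] curve(3) ran by (simp add: moduli_space_image w_def)
qed

text \<open>If \<open>m > n\<close> the sign of \<open>y\<close> distinguishes two components, and \<open>W\<close> maps each of them bijectively
  onto the unit circle.\<close>

lemma disconnected_case:
  assumes mn: "n < m"
  obtains u v where "circle_cover (moduli_atlas a b c d) {u, v}"
    "\<And>t. Cr (u t) = 1 - of_real r * cis t" "\<And>t. Cr (v t) = 1 - of_real r * cis t"
    "range u \<union> range v = moduli_space a b c d" "range u \<inter> range v = {}"
    "openin (moduli_topology a b c d) (range u)" "openin (moduli_topology a b c d) (range v)"
    "continuous_map euclideanreal (moduli_topology a b c d) u"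
    "continuous_map euclideanreal (moduli_topology a b c d) v"
proof -
  define h where "h e t = e * sqrt (m - n * cos t)" for e t
  define cv where "cv e t = config_section (cis t) (h e t)" for e t
  define u where "u e t = proj (cv e t)" for e t
  define T where "T e = {V \<in> S. 0 < e * y V}" for e :: real
  obtain U where U: "S \<subseteq> U" "smooth_on U W" "smooth_on U y" by (rule smooth_coordinates)
  have rad: "m - n * cos t > 0" for t
  proof -
    have "n * cos t \<le> n * 1" using n_pos by (intro mult_left_mono) auto
    then show ?thesis using mn by linarith
  qed
  have T: "T 1 \<union> T (-1) = S"
  proof -
    have "y V \<noteq> 0" if "V \<in> S" for V
    proof
      assume "y V = 0"
      then have "m = n * Re (W V)" using ratios_from_W_y(3)[OF that] by simp
      moreover have "n * Re (W V) \<le> n * 1"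
        using n_pos complex_Re_le_cmod[of "W V"] W_unit[OF that] by (intro mult_left_mono) auto
      ultimately show False using mn by simp
    qed
    then show ?thesis by (auto simp: T_def not_less order_less_le)
  qed
  have saturated: "{V \<in> S. proj V \<in> proj ` T e} = T e" for e
    using same_point_iff by (auto simp: T_def)
  have openT: "openin (top_of_set S) (T e)" for e
  proof -
    have "continuous_on S (\<lambda>V. e * y V)"
      using continuous_on_subset[OF smooth_on_continuous_on[OF U(3)] U(1)] by (intro continuous_intros)
    then have "openin (top_of_set S) (S \<inter> (\<lambda>V. e * y V) -` {0<..})"
      by (rule continuous_openin_preimage_gen) (rule open_greaterThan)
    moreover have "S \<inter> (\<lambda>V. e * y V) -` {0<..} = T e" by (auto simp: T_def)
    ultimately show ?thesis by simp
  qed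
  have facts: "circle_param (moduli_atlas a b c d) (u e)" "range (u e) = proj ` T e"
    "Cr (u e t) = 1 - of_real r * cis t" "openin (moduli_topology a b c d) (range (u e))"
    "continuous_map euclideanreal (moduli_topology a b c d) (u e)" if e: "e \<in> {1, -1}" for e t
  proof -
    have w1: "cmod (cis t) = 1" for t by simp
    have wh: "(h e t)\<^sup>2 = m - n * Re (cis t)" for t
      using e rad[of t] by (auto simp: h_def power_mult_distrib)
    have smh: "smooth_on UNIV cis" "smooth_on UNIV (h e)"
      unfolding h_def[abs_def] using rad
      by (auto intro!: smooth_intros smooth_on_cis[OF smooth_on_ident])
    note curve = config_curve[OF smh w1 wh, folded cv_def]
    note sec = config_section[OF w1 wh, folded cv_def]
    have cT: "cv e t \<in> T e" for t
      using sec(1,3) e rad[of t] by (auto simp: T_def h_def)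
    have sm: "smooth_on_subset (T e) W"
      by (rule smooth_on_imp_smooth_on_subset[OF U(2)]) (use U(1) in \<open>auto simp: T_def\<close>)
    have unit: "cmod (W V) = 1" if "V \<in> T e" for V using that W_unit by (simp add: T_def)
    have fibre: "proj V = proj V' \<longleftrightarrow> V \<in> T e \<and> W V = W V'"
      if V: "V \<in> S" "V' \<in> T e" for V V'
    proof
      have V': "V' \<in> S" using V(2) by (simp add: T_def)
      show "V \<in> T e \<and> W V = W V'" if "proj V = proj V'"
        using that same_point_iff[OF V(1) V'] V by (simp add: T_def)
      show "proj V = proj V'" if *: "V \<in> T e \<and> W V = W V'"
      proof -
        have "(y V)\<^sup>2 = (y V')\<^sup>2"
          using * ratios_from_W_y(3)[OF V(1)] ratios_from_W_y(3)[OF V'] by simp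
        then have "y V = y V' \<or> y V = - y V'" by (simp add: power2_eq_iff)
        moreover have "0 < e * y V" "0 < e * y V'" using * V(2) by (simp_all add: T_def)
        ultimately have "y V = y V'" by auto
        then show ?thesis using * same_point_iff[OF V(1) V'] by simp
      qed
    qed
    note par = circle_param_quotient_atlas[where \<pi> = "proj" and \<omega> = W,
        OF openT sm unit curve(1) cT sec(2) fibre]
    show "circle_param (moduli_atlas a b c d) (u e)"
      unfolding moduli_atlas_def u_def[abs_def] by (rule par(1))
    show ran: "range (u e) = proj ` T e" unfolding u_def[abs_def] by (rule par(2))
    show "Cr (u e t) = 1 - of_real r * cis t" unfolding u_def by (rule curve(3))
    show "continuous_map euclideanreal (moduli_topology a b c d) (u e)"
      unfolding u_def[abs_def] by (rule curve(2))
    show "openin (moduli_topology a b c d) (range (u e))"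
      unfolding ran moduli_topology_def openin_quotient_topology topspace_euclidean_subtopology saturated
      using openT by (auto simp: T_def)
  qed
  have disj: "range (u 1) \<inter> range (u (-1)) = {}"
  proof -
    have "y V = y V'" if "V \<in> T 1" "V' \<in> T (-1)" "proj V = proj V'" for V V'
      using that same_point_iff[of V V'] by (simp add: T_def)
    then show ?thesis unfolding facts(2)[of 1, simplified] facts(2)[of "-1", simplified]
      by (fastforce simp: T_def)
  qed
  have un: "range (u 1) \<union> range (u (-1)) = proj ` S"
    unfolding facts(2)[of 1, simplified] facts(2)[of "-1", simplified] image_Un[symmetric] T ..
  have "circle_cover (moduli_atlas a b c d) {u 1, u (-1)}"
    unfolding moduli_atlas_def
  proof (rule circle_cover_quotient_atlas)
    show "circle_param (quotient_atlas S (proj)) v" if "v \<in> {u 1, u (-1)}" for v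
      using that facts(1)[of 1] facts(1)[of "-1"] by (auto simp: moduli_atlas_def)
    show "proj ` S = (\<Union>v\<in>{u 1, u (-1)}. range v)" using un by simp
    show "range v \<inter> range v' = {}" if "v \<in> {u 1, u (-1)}" "v' \<in> {u 1, u (-1)}" "v \<noteq> v'" for v v'
      using that disj by blast
  qed
  then show thesis
    using that[of "u 1" "u (-1)"] facts(3-5)[of 1] facts(3-5)[of "-1"] un disj
    by (simp add: moduli_space_image)
qed

end

theorem theorem3p6:
  fixes a b c d :: real
  assumes "quadrilateral_linkage a b c d"
    and "nondegenerate a b c d"
  shows "let M = moduli_atlas a b c d;
             C = submanifold_atlas (target_circle a b c d);
             components = connected_components_of (moduli_topology a b c d)
         in (card components = 1 \<longrightarrow>
               stable_map M C Cr \<and>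
               card {p \<in> moduli_space a b c d. fold_point M C Cr p} = 2 \<and>
               circle_arc 1 ((a * c) / (b * d)) (Cr ` moduli_space a b c d)) \<and>
            (card components = 2 \<longrightarrow>
               stable_map M C Cr \<and>
               \<not> (\<exists>p \<in> moduli_space a b c d. critical_point M C Cr p) \<and>
               (\<forall>K \<in> components. bij_betw Cr K (target_circle a b c d)))"
proof -
  interpret nondegenerate_linkage a b c d by standard (rule assms)+
  let ?M = "moduli_atlas a b c d" and ?C = "submanifold_atlas (target_circle a b c d)"
  let ?X = "moduli_topology a b c d"
  let ?w = "\<lambda>t. 1 - of_real r * cis t"
  have A: "compatible_atlas ?M" unfolding moduli_atlas_def by (rule compatible_quotient_atlas)
  have B: "compatible_atlas ?C" unfolding submanifold_atlas_def by (rule compatible_quotient_atlas)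
  have carC: "carrier ?C = target_circle a b c d"
  proof -
    have "range ?w = target_circle a b c d"
    proof (intro equalityI subsetI)
      fix z assume "z \<in> range ?w"
      then show "z \<in> target_circle a b c d"
        using r_pos by (auto simp: target_circle_def r_def[symmetric] norm_mult)
    next
      fix z assume z: "z \<in> target_circle a b c d"
      then have "cmod ((1 - z) / of_real r) = 1"
        using r_pos by (simp add: target_circle_def r_def[symmetric] norm_divide norm_minus_commute)
      then obtain s where "(1 - z) / of_real r = cis s" by (rule unit_complex_near_angle)
      then have "z = ?w s" using r_pos by (simp add: field_simps)
      then show "z \<in> range ?w" by blast
    qed
    then show ?thesis using target_circle_cover by (simp add: circle_cover_def)
  qed
  have connected: "connectedin ?X (range u)" if "continuous_map euclideanreal ?X u" for u
    using connectedin_continuous_map_image[OF that, of UNIV] by simp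
  show ?thesis
  proof (cases "m < n")
    case True
    obtain \<kappa> u where \<kappa>: "0 < \<kappa>" "\<kappa> < 1" and u: "circle_cover ?M {u}"
      "\<And>t. Cr (u t) = ?w (fold_angle \<kappa> t)" "range u = moduli_space a b c d" "continuous_map euclideanreal ?X u"
      by (rule connected_case[OF True]) blast
    have car: "carrier ?M = moduli_space a b c d" using u(1,3) by (simp add: circle_cover_def)
    have "connected_components_of ?X = {range u}"
    proof (rule connected_components_of_partition)
      show "openin ?X K" if "K \<in> {range u}" for K
        using that u(3) openin_topspace[of ?X] by (simp add: topspace_moduli_topology)
      show "\<Union>{range u} = topspace ?X" using u(3) by (simp add: topspace_moduli_topology)
    qed (use connected[OF u(4)] in auto)
    moreover have "Cr ` moduli_space a b c d = range (\<lambda>t. ?w (fold_angle \<kappa> t))"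
      unfolding u(3)[symmetric] image_image u(2) ..
    ultimately show ?thesis
      using stable_fold[OF A B u(1) target_circle_cover \<kappa> u(2)] circle_arc_fold[OF \<kappa>, of r]
      by (simp add: car r_def)
  next
    case False
    then have "n < m" using m_neq_n by linarith
    then obtain u v where uv: "circle_cover ?M {u, v}"
      "\<And>t. Cr (u t) = ?w t" "\<And>t. Cr (v t) = ?w t"
      "range u \<union> range v = moduli_space a b c d" "range u \<inter> range v = {}"
      "openin ?X (range u)" "openin ?X (range v)"
      "continuous_map euclideanreal ?X u" "continuous_map euclideanreal ?X v"
      by (rule disconnected_case) blast
    have lift: "Cr (x t) = ?w t" if "x \<in> {u, v}" for x t using that uv(2,3) by auto
    have car: "carrier ?M = moduli_space a b c d" using uv(1,4) by (simp add: circle_cover_def)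
    have ne: "range u \<noteq> range v" using uv(5) by auto
    have comp: "connected_components_of ?X = {range u, range v}"
    proof (rule connected_components_of_partition)
      show "\<Union>{range u, range v} = topspace ?X" using uv(4) by (simp add: topspace_moduli_topology)
      show "pairwise disjnt {range u, range v}"
        using uv(5) by (simp add: pairwise_insert disjnt_def Int_commute)
    qed (use connected[OF uv(8)] connected[OF uv(9)] uv(6,7) in auto)
    note st = stable_coverings[where f = Cr, OF A B uv(1) _ _ target_circle_cover]
    have "stable_map ?M ?C Cr" by (rule st(1)) (simp, simp, rule lift)
    moreover have "\<not> (\<exists>p\<in>moduli_space a b c d. critical_point ?M ?C Cr p)"
      unfolding car[symmetric] by (rule st(2)) (simp, simp, rule lift)
    moreover have "bij_betw Cr (range x) (target_circle a b c d)" if "x \<in> {u, v}" for x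
    proof -
      have "bij_betw Cr (range x) (carrier ?C)" by (rule st(3)[OF _ _ _ that]) (simp, simp, rule lift)
      then show ?thesis unfolding carC .
    qed
    ultimately show ?thesis using ne by (simp add: comp)
  qed
qed

end
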